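(* Let $G$ be a finite abelian group with $|G|\ge 3$. Suppose that at least one of the following conditions holds: (a) $G$ is a cyclic group of odd order; (b) $G$ is not cyclic and $\mathsf D(G)=\mathsf D^*(G)$; (c) $G$ has odd order and there is some $U\in\mathcal A(G)$ of length $|U|=\mathsf D(G)$ that is not squarefree; (d) $G= C_2^4\oplus C_{2k}$ with $k\ge 70$. Then there are $g_1,g_2\in G$ and minimal zero-sum sequences $U_1,U_2$ over $G$ such that $|U_1|=|U_2|=\mathsf D(G)$, $g_1g_2\mid U_1$ and $(g_1+g_2)\mid U_2$ (divisibility in $\mathcal F(G)$).
   Context: For a finite abelian group $G$ (written additively), $\mathcal F(G)$ is the free abelian monoid with basis $G$ (written multiplicatively), whose elements are called sequences over $G$. For $S=g_1\cdots g_\ell\in\mathcal F(G)$: $|S|=\ell$ is its length, $\sigma(S)=g_1+\dots+g_\ell$ its sum, $\mathrm{supp}(S)=\{g_1,\dots,g_\ell\}$ its support; $S$ is a zero-sum sequence if $\sigma(S)=0$, and squarefree if $|S|=|\mathrm{supp}(S)|$. $\mathcal B(G)$ is the submonoid of $\mathcal F(G)$ of all zero-sum sequences; $\mathcal A(G)$ is its set of atoms (irreducible elements), called minimal zero-sum sequences over $G$. The Davenport constant is $\mathsf D(G)=\max\{|U|:U\in\mathcal A(G)\}$. Writing $G\cong C_{n_1}\oplus\dots\oplus C_{n_r}$ with $r\in\mathbb N_0$ and $1<n_1\mid\dots\mid n_r$, one sets $\mathsf D^*(G)=1+\sum_{i=1}^r(n_i-1)$. $C_n$ denotes a cyclic group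 of order $n$. *)

theory Defs
  imports
    "HOL-Algebra.Divisibility" "HOL-Algebra.FiniteProduct" "HOL-Algebra.Product_Groups"
    "HOL-Library.Multiset"
begin

text \<open>
  A finite abelian group is a \<^const>\<open>comm_group\<close> of HOL-Algebra with finite carrier. HOL-Algebra
  writes its operation multiplicatively, so \<open>g\<^sub>1 \<otimes> g\<^sub>2\<close> below is the sum \<open>g\<^sub>1 + g\<^sub>2\<close> of the literature.
  Sequences over \<open>G\<close> are multisets over \<open>carrier G\<close>: the length \<open>|S|\<close> is \<^term>\<open>size S\<close>, the support
  is \<^term>\<open>set_mset S\<close>, and the product of sequences is the sum of multisets.
\<close>

definition free_abelian_monoid :: "'a set \<Rightarrow> 'a multiset monoid" where
  "free_abelian_monoid A = \<lparr>carrier = {S. set_mset S \<subseteq> A}, monoid.mult = (+), one = {#}\<rparr>"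

abbreviation sequences :: "('a, 'b) monoid_scheme \<Rightarrow> 'a multiset monoid" where
  "sequences G \<equiv> free_abelian_monoid (carrier G)"

text \<open>\<open>\<sigma>(S) = \<Sum>\<^bsub>g \<in> supp(S)\<^esub> v\<^sub>g(S) g\<close>, where \<open>v\<^sub>g(S)\<close> is the multiplicity of \<open>g\<close> in \<open>S\<close>.\<close>

definition seq_sum :: "('a, 'b) monoid_scheme \<Rightarrow> 'a multiset \<Rightarrow> 'a" where
  "seq_sum G S = (\<Otimes>\<^bsub>G\<^esub>g \<in> set_mset S. g [^]\<^bsub>G\<^esub> count S g)"

definition squarefree_seq :: "'a multiset \<Rightarrow> bool" where
  "squarefree_seq S \<longleftrightarrow> size S = card (set_mset S)"

definition zero_sum_monoid :: "('a, 'b) monoid_scheme \<Rightarrow> 'a multiset monoid" where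
  "zero_sum_monoid G =
     (sequences G)\<lparr>carrier := {S \<in> carrier (sequences G). seq_sum G S = \<one>\<^bsub>G\<^esub>}\<rparr>"

definition minimal_zero_sum_seqs :: "('a, 'b) monoid_scheme \<Rightarrow> 'a multiset set" where
  "minimal_zero_sum_seqs G =
     {U \<in> carrier (zero_sum_monoid G). irreducible (zero_sum_monoid G) U}"

definition davenport :: "('a, 'b) monoid_scheme \<Rightarrow> nat" where
  "davenport G = Max (size ` minimal_zero_sum_seqs G)"

definition invariant_factors :: "('a, 'b) monoid_scheme \<Rightarrow> nat list \<Rightarrow> bool" where
  "invariant_factors G ns \<longleftrightarrow>
     (\<forall>n \<in> set ns. 1 < n) \<and>
     (\<forall>i. Suc i < length ns \<longrightarrow> ns ! i dvd ns ! Suc i) \<and>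
     G \<cong> product_group {..<length ns} (\<lambda>i. integer_mod_group (ns ! i))"

text \<open>
  A finite abelian group has exactly one list of invariant factors (the empty one if it is trivial),
  so the choice below is determined.
\<close>

definition davenport_star :: "('a, 'b) monoid_scheme \<Rightarrow> nat" where
  "davenport_star G = 1 + (\<Sum>n \<leftarrow> (SOME ns. invariant_factors G ns). n - 1)"

end

theory Submission
  imports Defs "HOL-Algebra.Multiplicative_Group" "HOL-Computational_Algebra.Primes"
    "HOL-Library.Disjoint_Sets"
begin

text \<open>
  Automorphisms of \<open>G\<close> permute the atoms of maximal length. So it is enough to find one such atom \<open>U\<close>
  with terms \<open>g\<^sub>1 g\<^sub>2 | U\<close> and an automorphism that maps a term of some atom of maximal length to
  \<open>g\<^sub>1 + g\<^sub>2\<close>. The four hypotheses provide the automorphism in three ways. (The comments write groups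
  additively, as in the literature.)

  \<^item> If the order is odd and \<open>g\<close> is a repeated term, take \<open>g\<^sub>1 = g\<^sub>2 = g\<close> and the automorphism
    \<open>x \<mapsto> 2 x\<close>. A cyclic group of order \<open>n\<close> has the atom \<open>g\<^sup>n\<close> with a repeated term.

  \<^item> A basis \<open>e\<^sub>1, \<dots>, e\<^sub>r\<close> with orders \<open>n\<^sub>1 | \<dots> | n\<^sub>r\<close> gives the atom of length \<open>1 + \<Sum> (n\<^sub>i - 1)\<close> that
    contains each \<open>e\<^sub>i\<close> with multiplicity \<open>n\<^sub>i - 1\<close> and the element \<open>e\<^sub>1 + \<dots> + e\<^sub>r\<close> once. Replacing
    \<open>e\<^sub>j\<close> by \<open>e\<^sub>i + e\<^sub>j\<close> with \<open>n\<^sub>i | n\<^sub>j\<close> preserves independence and the orders, so \<open>e\<^sub>i + e\<^sub>j\<close> is a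
    term of another atom of that length (\<open>sum_linked_independent\<close>). This settles \<open>D(G) = D\<^sup>*(G)\<close>
    for groups that are not cyclic, once bases are known to exist (\<open>ex_invariant_factors\<close>).

  \<^item> Let \<open>G = C\<^sub>2\<^sup>4 \<oplus> C\<^sub>2\<^sub>k\<close>. The basis shows \<open>D(G) \<ge> 2 k + 4\<close> and settles the case of equality, so let
    \<open>U\<close> be an atom of length at least \<open>2 k + 5\<close>. Put \<open>H = 2 G\<close>, a subgroup of order \<open>k\<close> and index 32.

  In the last case, pairs of terms in the same class modulo \<open>H\<close> have their sum in \<open>H\<close>. Splitting off
  such pairs leaves a set \<open>A\<close> of at most 31 terms in distinct nonzero classes. The sums of the pairs
  form a minimal zero-sum sequence over \<open>H\<close>, together with the sums of a few blocks that make up \<open>A\<close>.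
  Its length is close to \<open>k\<close>, and Scherk's theorem on sumsets implies that most of its terms are equal
  to one element \<open>c\<close> (\<open>frequent_term_atom\<close>). Hence \<open>c\<close> generates \<open>H\<close>, and every block \<open>B\<close> with sum in
  \<open>H\<close> has an index \<open>j(B) \<in> {1..k}\<close> with \<open>\<sigma>(B) = j(B) c\<close>. As \<open>c\<close> is so frequent, the indices of the
  blocks of a partition of \<open>U\<close> add up to exactly \<open>k\<close>, not only modulo \<open>k\<close> (\<open>total_idx\<close>).

  Two facts follow. Exchanging terms between two pairs of sum \<open>c\<close> in the same class forces all four
  terms to be equal to an element \<open>f\<close> with \<open>2 f = c\<close> (\<open>ex_square_root_in_U\<close>). Moreover, the length of \<open>U\<close>
  turns into \<open>|A| \<ge> 2 j(A) + 5\<close>, and a theorem on codes of redundancy five shows that such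
  a set \<open>A\<close> contains \<open>p \<noteq> q\<close> with \<open>2 (p + q) = c\<close> (\<open>unit_pair_of_long_code\<close>). Now \<open>f\<close> and \<open>p + q\<close> are outside
  \<open>H\<close> and have the same double. They differ by an element \<open>e\<close> with \<open>2 e = 0\<close>, and
  \<open>z \<mapsto> z + \<lambda>(z) e\<close> is an automorphism mapping \<open>f\<close> to \<open>p + q\<close>, where \<open>\<lambda>\<close> is a homomorphism to
  \<open>{0, 1}\<close> with \<open>\<lambda>(f) = 1\<close> and \<open>\<lambda>(e) = 0\<close> (\<open>automorphism_of_equal_squares\<close>).
\<close>

section \<open>Zero-sum sequences and their atoms\<close>

context comm_group
begin

lemma seq_sum_superset:
  assumes "finite T" "set_mset S \<subseteq> T" "T \<subseteq> carrier G"
  shows "seq_sum G S = (\<Otimes>g\<in>T. g [^] count S g)"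
  unfolding seq_sum_def
  by (rule finprod_mono_neutral_cong_left) (use assms in \<open>auto simp: not_in_iff\<close>)

lemma seq_sum_closed [simp]: "set_mset S \<subseteq> carrier G \<Longrightarrow> seq_sum G S \<in> carrier G"
  unfolding seq_sum_def by (rule finprod_closed) auto

lemma seq_sum_empty [simp]: "seq_sum G {#} = \<one>"
  unfolding seq_sum_def by simp

lemma seq_sum_union:
  assumes "set_mset S \<subseteq> carrier G" "set_mset T \<subseteq> carrier G"
  shows "seq_sum G (S + T) = seq_sum G S \<otimes> seq_sum G T"
proof -
  let ?U = "set_mset S \<union> set_mset T"
  have U: "finite ?U" "?U \<subseteq> carrier G" using assms by auto
  have "seq_sum G (S + T) = (\<Otimes>g\<in>?U. g [^] count S g \<otimes> g [^] count T g)"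
    unfolding seq_sum_superset[of ?U "S + T", OF U(1) _ U(2), simplified]
    by (rule finprod_cong') (use U in \<open>auto simp: nat_pow_mult\<close>)
  also have "\<dots> = (\<Otimes>g\<in>?U. g [^] count S g) \<otimes> (\<Otimes>g\<in>?U. g [^] count T g)"
    by (rule finprod_multf) (use U in auto)
  finally show ?thesis using seq_sum_superset[OF U(1) _ U(2)] by simp
qed

lemma seq_sum_single [simp]: "g \<in> carrier G \<Longrightarrow> seq_sum G {#g#} = g"
  unfolding seq_sum_def by simp

lemma seq_sum_add_mset:
  "g \<in> carrier G \<Longrightarrow> set_mset S \<subseteq> carrier G \<Longrightarrow> seq_sum G (add_mset g S) = g \<otimes> seq_sum G S"
  using seq_sum_union[of "{#g#}" S] by simp

lemma seq_sum_Diff: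
  assumes "set_mset S \<subseteq> carrier G" "T \<subseteq># S"
  shows "seq_sum G S = seq_sum G T \<otimes> seq_sum G (S - T)"
proof -
  have "S = T + (S - T)" using assms(2) by simp
  moreover have "set_mset T \<subseteq> carrier G" "set_mset (S - T) \<subseteq> carrier G"
    using assms set_mset_mono[OF assms(2)] by (auto dest: in_diffD)
  ultimately show ?thesis using seq_sum_union by metis
qed

lemma seq_sum_replicate: "g \<in> carrier G \<Longrightarrow> seq_sum G (replicate_mset n g) = g [^] n"
  by (induction n) (auto simp: seq_sum_add_mset nat_pow_Suc2 m_comm)

lemma seq_sum_hom:
  assumes "comm_group H" "h \<in> hom G H" "set_mset S \<subseteq> carrier G"
  shows "seq_sum H (image_mset h S) = h (seq_sum G S)"
  using assms(3)
proof (induction S)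
  case empty
  then show ?case using assms(1,2) is_group hom_one comm_group.seq_sum_empty comm_group.axioms(2) by fastforce
next
  case (add x S)
  have "set_mset (image_mset h S) \<subseteq> carrier H" "h x \<in> carrier H"
    using add.prems assms(2) by (auto simp: hom_def)
  then show ?case using add assms comm_group.seq_sum_add_mset[OF assms(1)] seq_sum_add_mset
    by (simp add: hom_mult)
qed

lemma seq_sum_Union:
  assumes "\<And>w. w \<in># W \<Longrightarrow> set_mset w \<subseteq> carrier G"
  shows "seq_sum G (\<Sum>\<^sub># W) = seq_sum G (image_mset (seq_sum G) W)"
  using assms
proof (induction W)
  case (add w W)
  have "set_mset (\<Sum>\<^sub># W) \<subseteq> carrier G" using add.prems by auto
  moreover have "set_mset (image_mset (seq_sum G) W) \<subseteq> carrier G" using add.prems by auto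
  ultimately show ?case using add by (simp add: seq_sum_union seq_sum_add_mset)
qed auto

end

text \<open>
  Irreducibility in the monoid of zero-sum sequences, without divisibility: the units of that monoid are
  trivial, and a quotient of zero-sum sequences in the free monoid is again zero-sum.
\<close>

definition atom :: "('a, 'b) monoid_scheme \<Rightarrow> 'a multiset \<Rightarrow> bool" where
  "atom G U \<longleftrightarrow> set_mset U \<subseteq> carrier G \<and> U \<noteq> {#} \<and> seq_sum G U = \<one>\<^bsub>G\<^esub> \<and>
     (\<forall>V. V \<subseteq># U \<and> seq_sum G V = \<one>\<^bsub>G\<^esub> \<longrightarrow> V = {#} \<or> V = U)"

lemma (in comm_group) minimal_zero_sum_seqs_iff_atom:
  "U \<in> minimal_zero_sum_seqs G \<longleftrightarrow> atom G U"
proof -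
  let ?B = "zero_sum_monoid G"
  have carr: "V \<in> carrier ?B \<longleftrightarrow> set_mset V \<subseteq> carrier G \<and> seq_sum G V = \<one>" for V
    by (simp add: zero_sum_monoid_def free_abelian_monoid_def)
  have mult: "V \<otimes>\<^bsub>?B\<^esub> W = V + W" and one: "\<one>\<^bsub>?B\<^esub> = {#}" for V W
    by (simp_all add: zero_sum_monoid_def free_abelian_monoid_def)
  have units: "V \<in> Units ?B \<longleftrightarrow> V = {#}" for V
    unfolding Units_def mult one using carr by auto
  have dvd: "V divides\<^bsub>?B\<^esub> W \<longleftrightarrow> V \<subseteq># W" if "V \<in> carrier ?B" "W \<in> carrier ?B" for V W
  proof
    assume "V divides\<^bsub>?B\<^esub> W"
    then show "V \<subseteq># W" unfolding factor_def mult by auto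
  next
    assume sub: "V \<subseteq># W"
    have W: "set_mset W \<subseteq> carrier G" "set_mset V \<subseteq> carrier G" using that carr by auto
    then have "set_mset (W - V) \<subseteq> carrier G" by (auto dest: in_diffD)
    moreover have "seq_sum G (W - V) = \<one>"
      using seq_sum_Diff[OF W(1) sub] that carr calculation by simp
    ultimately have "W - V \<in> carrier ?B" using carr by simp
    then show "V divides\<^bsub>?B\<^esub> W" unfolding factor_def mult using sub by (intro bexI[of _ "W - V"]) auto
  qed
  show ?thesis
  proof
    assume "U \<in> minimal_zero_sum_seqs G"
    then have U: "U \<in> carrier ?B" "Divisibility.irreducible ?B U" unfolding minimal_zero_sum_seqs_def by auto
    have "V = {#} \<or> V = U" if "V \<subseteq># U" "seq_sum G V = \<one>" for V
    proof (rule ccontr)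
      assume *: "\<not> (V = {#} \<or> V = U)"
      have V: "V \<in> carrier ?B" using that U(1) carr set_mset_mono[OF that(1)] by auto
      then have "properfactor ?B V U"
        unfolding properfactor_def using dvd that U(1) * by (auto simp: subset_mset.order_antisym)
      then show False using U(2) V units * unfolding Divisibility.irreducible_def by auto
    qed
    then show "atom G U" using U units carr unfolding atom_def Divisibility.irreducible_def by auto
  next
    assume U: "atom G U"
    then have UB: "U \<in> carrier ?B" using carr unfolding atom_def by auto
    have "V \<in> Units ?B" if "V \<in> carrier ?B" "properfactor ?B V U" for V
    proof -
      have "V \<subseteq># U" "V \<noteq> U" using that dvd UB unfolding properfactor_def by auto
      then show ?thesis using U that carr units unfolding atom_def by auto
    qed
    then show "U \<in> minimal_zero_sum_seqs G"
      using U UB units unfolding minimal_zero_sum_seqs_def Divisibility.irreducible_def atom_def by auto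
  qed
qed

lemma sequences_dividesI:
  assumes "S \<subseteq># U" "set_mset U \<subseteq> carrier G"
  shows "S divides\<^bsub>sequences G\<^esub> U"
proof -
  have "U - S \<in> carrier (sequences G)"
    using assms(2) by (auto simp: free_abelian_monoid_def dest: in_diffD)
  then show ?thesis using assms(1) unfolding factor_def
    by (intro bexI[of _ "U - S"]) (auto simp: free_abelian_monoid_def)
qed

lemma (in comm_group) atom_automorphism:
  assumes "h \<in> iso G G" "atom G U"
  shows "atom G (image_mset h U)"
proof -
  have hom: "h \<in> hom G G" and inj: "inj_on h (carrier G)" and surj: "h ` carrier G = carrier G"
    using assms(1) by (auto simp: iso_def bij_betw_def)
  have U: "set_mset U \<subseteq> carrier G" "U \<noteq> {#}" "seq_sum G U = \<one>"
    "\<And>V. V \<subseteq># U \<Longrightarrow> seq_sum G V = \<one> \<Longrightarrow> V = {#} \<or> V = U"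
    using assms(2) unfolding atom_def by auto
  have one: "h \<one> = \<one>" using hom_one[OF hom is_group is_group] .
  show ?thesis
    unfolding atom_def
  proof (intro conjI allI impI)
    show "set_mset (image_mset h U) \<subseteq> carrier G" using U(1) surj by auto
    show "image_mset h U \<noteq> {#}" using U(2) by simp
    show "seq_sum G (image_mset h U) = \<one>"
      using seq_sum_hom[OF comm_group_axioms hom U(1)] U(3) one by simp
    fix V assume V: "V \<subseteq># image_mset h U \<and> seq_sum G V = \<one>"
    then obtain V' where V': "V' \<subseteq># U" "V = image_mset h V'"
      by (metis image_mset_eq_plusD mset_subset_eq_add_left subset_mset.le_iff_add)
    have sub: "set_mset V' \<subseteq> carrier G" using set_mset_mono[OF V'(1)] U(1) by auto
    have "h (seq_sum G V') = h \<one>"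
      using V V' seq_sum_hom[OF comm_group_axioms hom sub] one by simp
    then have "seq_sum G V' = \<one>" using inj_onD[OF inj] sub by simp
    then show "V = {#} \<or> V = image_mset h U" using U(4)[OF V'(1)] V' by auto
  qed
qed

section \<open>Subset sums of zero-sum free sequences\<close>

definition (in group) sumset :: "'a set \<Rightarrow> 'a set \<Rightarrow> 'a set" where
  "sumset A B = (\<lambda>(a, b). a \<otimes> b) ` (A \<times> B)"

text \<open>
  Scherk's theorem on sumsets in which zero has only the trivial representation. The proof transfers elements
  from \<open>B\<close> to \<open>A\<close>: as long as \<open>B\<close> is not trivial, some translate
  \<open>a + B\<close> leaves \<open>A\<close>, because otherwise \<open>A\<close> contains all multiples of a
  nonzero element \<open>b \<in> B\<close> and in particular \<open>-b\<close>. The elements \<open>D\<close>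
  responsible for leaving \<open>A\<close> are removed from \<open>B\<close>, and \<open>a + D\<close> is added
  to \<open>A\<close>. This keeps the sum of the two cardinalities, and the sumset does not grow.
\<close>

lemma (in comm_group) scherk:
  assumes "finite A" "finite B" "A \<subseteq> carrier G" "B \<subseteq> carrier G" "\<one> \<in> A" "\<one> \<in> B"
    and "\<And>a b. a \<in> A \<Longrightarrow> b \<in> B \<Longrightarrow> a \<otimes> b = \<one> \<Longrightarrow> a = \<one> \<and> b = \<one>"
  shows "card A + card B \<le> card (sumset A B) + 1"
  using assms
proof (induction "card B" arbitrary: A B rule: less_induct)
  case less
  note prems = less.prems
  show ?case
  proof (cases "B = {\<one>}")
    case True
    have "A \<subseteq> sumset A B" using prems True by (force simp: sumset_def)
    moreover have "finite (sumset A B)" using prems by (simp add: sumset_def)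
    ultimately show ?thesis using True card_mono by fastforce
  next
    case False
    then obtain b where b: "b \<in> B" "b \<noteq> \<one>" using prems by auto
    have bc: "b \<in> carrier G" using b prems by auto
    have "\<exists>a\<in>A. a \<otimes> b \<notin> A"
    proof (rule ccontr)
      assume "\<not> ?thesis"
      then have cl: "\<And>a. a \<in> A \<Longrightarrow> a \<otimes> b \<in> A" by auto
      have pow: "b [^] n \<in> A" for n :: nat
        by (induction n) (use prems cl in auto)
      have "\<exists>n>0. b [^] (n::nat) = \<one>"
      proof -
        have "\<not> inj (\<lambda>n::nat. b [^] n)"
        proof
          assume "inj (\<lambda>n::nat. b [^] n)"
          moreover have "range (\<lambda>n::nat. b [^] n) \<subseteq> A" using pow by auto
          ultimately show False using prems(1) by (meson finite_imageD finite_subset infinite_UNIV_nat)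
        qed
        then obtain m n :: nat where mn: "m < n" "b [^] m = b [^] n"
          by (metis (mono_tags, lifting) injI linorder_neqE_nat)
        have "b [^] m \<otimes> b [^] (n - m) = b [^] m \<otimes> \<one>"
          using mn bc nat_pow_mult[OF bc, of m "n - m"] by simp
        then have "b [^] (n - m) = \<one>" using bc by (metis l_cancel nat_pow_closed one_closed)
        then show ?thesis using mn by (intro exI[of _ "n - m"]) auto
      qed
      then obtain n where "b [^] Suc n = \<one>" by (metis gr0_implies_Suc)
      then have "b [^] n \<otimes> b = \<one>" by simp
      then show False using prems(7)[OF pow b(1)] b(2) by auto
    qed
    then obtain a where a: "a \<in> A" "a \<otimes> b \<notin> A" by auto
    have ac: "a \<in> carrier G" using a prems by auto
    \<comment> \<open>The rest \<open>B - D\<close> satisfies \<open>a + (B - D) \<subseteq> A\<close>, which keeps the new sumset inside the old one.\<close>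
    define D where "D = {d \<in> B. a \<otimes> d \<notin> A}"
    define A' where "A' = A \<union> (\<lambda>d. a \<otimes> d) ` D"
    define B' where "B' = B - D"
    have Dc: "D \<subseteq> carrier G" "D \<subseteq> B" "finite D" "D \<noteq> {}" using prems a b unfolding D_def by auto
    have "\<one> \<notin> D" using a ac unfolding D_def by auto
    have cA: "card A' = card A + card D"
    proof -
      have "inj_on (\<lambda>d. a \<otimes> d) D" using Dc ac by (auto simp: inj_on_def subset_eq)
      moreover have "A \<inter> (\<lambda>d. a \<otimes> d) ` D = {}" unfolding D_def by auto
      ultimately show ?thesis unfolding A'_def using prems(1) Dc
        by (subst card_Un_disjoint) (auto simp: card_image)
    qed
    have "card D \<le> card B" "0 < card D" using Dc prems(2) by (auto simp: card_mono card_gt_0_iff)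
    moreover have "card B' = card B - card D" unfolding B'_def using Dc by (simp add: card_Diff_subset)
    ultimately have cB: "card B = card B' + card D" "card B' < card B" by auto
    have sub: "sumset A' B' \<subseteq> sumset A B"
    proof
      fix x assume "x \<in> sumset A' B'"
      then obtain p q where pq: "p \<in> A'" "q \<in> B'" "x = p \<otimes> q" by (auto simp: sumset_def)
      have qc: "q \<in> B" "q \<in> carrier G" "a \<otimes> q \<in> A" using pq(2) prems unfolding B'_def D_def by auto
      show "x \<in> sumset A B"
      proof (cases "p \<in> A")
        case True then show ?thesis using pq qc by (auto simp: sumset_def)
      next
        case False
        then obtain d where d: "d \<in> D" "p = a \<otimes> d" using pq unfolding A'_def by auto
        then have "x = (a \<otimes> q) \<otimes> d" using pq qc ac Dc by (auto simp: m_ac subset_eq)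
        then show ?thesis using qc d Dc by (auto simp: sumset_def)
      qed
    qed
    have "card A' + card B' \<le> card (sumset A' B') + 1"
    proof (rule less.hyps[OF cB(2)])
      show "finite A'" "finite B'" unfolding A'_def B'_def using prems Dc by auto
      show "A' \<subseteq> carrier G" "B' \<subseteq> carrier G" unfolding A'_def B'_def using prems Dc ac by auto
      show "\<one> \<in> A'" "\<one> \<in> B'" unfolding A'_def B'_def using prems \<open>\<one> \<notin> D\<close> by auto
      fix p q assume pq: "p \<in> A'" "q \<in> B'" "p \<otimes> q = \<one>"
      have qc: "q \<in> B" "q \<in> carrier G" "a \<otimes> q \<in> A" using pq(2) prems unfolding B'_def D_def by auto
      show "p = \<one> \<and> q = \<one>"
      proof (cases "p \<in> A")
        case True then show ?thesis using pq qc prems by auto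
      next
        case False
        then obtain d where d: "d \<in> D" "p = a \<otimes> d" using pq unfolding A'_def by auto
        then have "(a \<otimes> q) \<otimes> d = \<one>" using pq qc ac Dc by (auto simp: m_ac subset_eq)
        then have "d = \<one>" using prems(7)[OF qc(3), of d] d Dc by auto
        then show ?thesis using d \<open>\<one> \<notin> D\<close> by auto
      qed
    qed
    also have "card (sumset A' B') \<le> card (sumset A B)"
      using sub prems by (intro card_mono) (auto simp: sumset_def)
    finally show ?thesis using cA cB by simp
  qed
qed

definition (in group) subsums :: "'a multiset \<Rightarrow> 'a set" where
  "subsums S = seq_sum G ` {T. T \<subseteq># S}"

definition zero_sum_free :: "('a, 'b) monoid_scheme \<Rightarrow> 'a multiset \<Rightarrow> bool" where
  "zero_sum_free G S \<longleftrightarrow> set_mset S \<subseteq> carrier G \<and> (\<forall>T. T \<subseteq># S \<and> seq_sum G T = \<one>\<^bsub>G\<^esub> \<longrightarrow> T = {#})"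

lemma zero_sum_freeD: "zero_sum_free G S \<Longrightarrow> T \<subseteq># S \<Longrightarrow> seq_sum G T = \<one>\<^bsub>G\<^esub> \<Longrightarrow> T = {#}"
  unfolding zero_sum_free_def by simp

lemma finite_submultisets: "finite {T. T \<subseteq># S}"
proof (induction S)
  case (add x S)
  have "{T. T \<subseteq># add_mset x S} \<subseteq> {T. T \<subseteq># S} \<union> add_mset x ` {T. T \<subseteq># S}"
  proof
    fix T assume T: "T \<in> {T. T \<subseteq># add_mset x S}"
    show "T \<in> {T. T \<subseteq># S} \<union> add_mset x ` {T. T \<subseteq># S}"
    proof (cases "x \<in># T")
      case True
      then have "T = add_mset x (T - {#x#})" "T - {#x#} \<subseteq># S" using T
        by (auto simp: insert_subset_eq_iff subset_eq_diff_conv)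
      then show ?thesis by blast
    next
      case False
      have "T \<subseteq># S"
      proof (rule mset_subset_eqI)
        fix a
        have "T \<subseteq># add_mset x S" using T by simp
        then have "count T a \<le> count (add_mset x S) a" by (rule mset_subset_eq_count)
        then show "count T a \<le> count S a" using False by (cases "a = x") (auto simp: not_in_iff)
      qed
      then show ?thesis by simp
    qed
  qed
  moreover have "finite ({T. T \<subseteq># S} \<union> add_mset x ` {T. T \<subseteq># S})" using add by simp
  ultimately show ?case by (rule finite_subset)
qed (simp add: Collect_conv_if)

context comm_group
begin

lemma seq_sum_in_subgroup:
  assumes "subgroup H G" "set_mset S \<subseteq> H"
  shows "seq_sum G S \<in> H"
  using assms(2)
proof (induction S)
  case (add x S)
  have c: "x \<in> carrier G" "set_mset S \<subseteq> carrier G" using add.prems subgroup.subset[OF assms(1)] by auto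
  then show ?case using add subgroup.m_closed[OF assms(1)] by (simp add: seq_sum_add_mset)
qed (simp add: subgroup.one_closed[OF assms(1)])

lemma finite_subsums: "finite (subsums S)"
  unfolding subsums_def by (intro finite_imageI finite_submultisets)

lemma subsums_in_carrier: "set_mset S \<subseteq> carrier G \<Longrightarrow> subsums S \<subseteq> carrier G"
  unfolding subsums_def by (auto dest!: set_mset_mono)

lemma subsums_union:
  assumes "set_mset S \<subseteq> carrier G" "set_mset T \<subseteq> carrier G"
  shows "sumset (subsums S) (subsums T) = subsums (S + T)"
proof (intro equalityI subsetI)
  fix x assume "x \<in> sumset (subsums S) (subsums T)"
  then obtain S' T' where *: "S' \<subseteq># S" "T' \<subseteq># T" "x = seq_sum G S' \<otimes> seq_sum G T'"
    by (auto simp: sumset_def subsums_def)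
  then have "x = seq_sum G (S' + T')" "S' + T' \<subseteq># S + T"
    using assms set_mset_mono[OF *(1)] set_mset_mono[OF *(2)] seq_sum_union[of S' T']
    by (auto intro: subset_mset.add_mono)
  then show "x \<in> subsums (S + T)" unfolding subsums_def by blast
next
  fix x assume "x \<in> subsums (S + T)"
  then obtain R where R: "R \<subseteq># S + T" "x = seq_sum G R" by (auto simp: subsums_def)
  have sub: "R \<inter># S \<subseteq># S" "R - S \<subseteq># T" using R(1) by (simp_all add: subset_eq_diff_conv add.commute)
  have eq: "R = R \<inter># S + (R - S)" by (rule multiset_eqI) (simp add: min_def)
  have "x = seq_sum G (R \<inter># S) \<otimes> seq_sum G (R - S)"
    using eq R(2) seq_sum_union[of "R \<inter># S" "R - S"] assms set_mset_mono[OF sub(1)] set_mset_mono[OF sub(2)] by auto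
  then show "x \<in> sumset (subsums S) (subsums T)" using sub unfolding sumset_def subsums_def by blast
qed

lemma zero_sum_free_mono: "zero_sum_free G S \<Longrightarrow> T \<subseteq># S \<Longrightarrow> zero_sum_free G T"
  unfolding zero_sum_free_def using set_mset_mono subset_mset.order_trans by blast

text \<open>
  Scherk's theorem applies to subset sums: a trivial sum of a subset sum of \<open>S\<close> and one of
  \<open>T\<close> would be a zero-sum subsequence of \<open>S + T\<close>.
\<close>

lemma card_subsums_union:
  assumes "zero_sum_free G (S + T)"
  shows "card (subsums S) + card (subsums T) \<le> card (subsums (S + T)) + 1"
proof -
  have c: "set_mset S \<subseteq> carrier G" "set_mset T \<subseteq> carrier G" using assms unfolding zero_sum_free_def by auto
  have "card (subsums S) + card (subsums T) \<le> card (sumset (subsums S) (subsums T)) + 1"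
  proof (rule scherk)
    show "finite (subsums S)" "finite (subsums T)" by (rule finite_subsums)+
    show "subsums S \<subseteq> carrier G" "subsums T \<subseteq> carrier G" using subsums_in_carrier c by auto
    show "\<one> \<in> subsums S" "\<one> \<in> subsums T" unfolding subsums_def by (auto intro!: image_eqI[of _ _ "{#}"])
    fix a b assume "a \<in> subsums S" "b \<in> subsums T" and ab: "a \<otimes> b = \<one>"
    then obtain S' T' where *: "S' \<subseteq># S" "T' \<subseteq># T" "a = seq_sum G S'" "b = seq_sum G T'"
      by (auto simp: subsums_def)
    have "seq_sum G (S' + T') = \<one>" "S' + T' \<subseteq># S + T"
      using c set_mset_mono[OF *(1)] set_mset_mono[OF *(2)] seq_sum_union[of S' T'] ab * 
      by (auto intro: subset_mset.add_mono)
    then have "S' + T' = {#}" using assms unfolding zero_sum_free_def by blast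
    then show "a = \<one> \<and> b = \<one>" using * by simp
  qed
  then show ?thesis using subsums_union[OF c] by simp
qed

lemma card_subsums_ge: "zero_sum_free G S \<Longrightarrow> size S + 1 \<le> card (subsums S)"
proof (induction S)
  case empty
  have "subsums {#} = {\<one>}" unfolding subsums_def by (simp add: Collect_conv_if)
  then show ?case by simp
next
  case (add x S)
  have x: "x \<in> carrier G" using add.prems unfolding zero_sum_free_def by simp
  have "x \<noteq> \<one>"
  proof
    assume "x = \<one>"
    then have "seq_sum G {#x#} = \<one>" by simp
    moreover have "{#x#} \<subseteq># add_mset x S" by simp
    ultimately show False using zero_sum_freeD[OF add.prems, of "{#x#}"] by simp
  qed
  note x = x this
  have "seq_sum G {#} \<in> subsums {#x#}" "seq_sum G {#x#} \<in> subsums {#x#}"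
    unfolding subsums_def by (intro imageI; simp)+
  then have "{\<one>, x} \<subseteq> subsums {#x#}" using x by simp
  then have "card {\<one>, x} \<le> card (subsums {#x#})" by (intro card_mono finite_subsums)
  then have "2 \<le> card (subsums {#x#})" using x by (simp add: eq_commute[of x])
  moreover have "size S + 1 \<le> card (subsums S)" using add zero_sum_free_mono[OF add.prems, of S] by auto
  ultimately show ?case using card_subsums_union[of "{#x#}" S] add.prems by simp
qed

text \<open>
  A zero-sum free sequence with few subset sums is nearly constant. A pair of distinct terms contributes at
  least 3 new subset sums, a single term at least 1; so the number \<open>x\<close> of disjoint pairs of
  distinct terms is bounded, and the \<open>m\<close> terms that remain after removing these pairs are all
  equal. The inequality eliminates \<open>x\<close> from \<open>|S| = 2 x + m\<close> and
  \<open>|\<Sigma>(S)| \<ge> 1 + 3 x + m\<close>.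
\<close>

lemma frequent_term:
  assumes "zero_sum_free G S"
  shows "\<exists>c m. 3 * size S + 2 \<le> m + 2 * card (subsums S) \<and> m \<le> count S c"
  using assms
proof (induction "size S" arbitrary: S rule: less_induct)
  case less
  show ?case
  proof (cases "\<exists>a b. {#a, b#} \<subseteq># S \<and> a \<noteq> b")
    case True
    then obtain a b where ab: "{#a, b#} \<subseteq># S" "a \<noteq> b" by blast
    define T where "T = S - {#a, b#}"
    have S: "S = {#a, b#} + T" unfolding T_def by (rule subset_mset.add_diff_inverse[OF ab(1), symmetric])
    have zf: "zero_sum_free G T" using zero_sum_free_mono[OF less.prems, of T] S by simp
    obtain c m where cm: "3 * size T + 2 \<le> m + 2 * card (subsums T)" "m \<le> count T c"
      using less.hyps[OF _ zf] S by auto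
    have "set_mset S \<subseteq> carrier G" using less.prems unfolding zero_sum_free_def by blast
    then have c: "a \<in> carrier G" "b \<in> carrier G" using S by auto
    have nz: "seq_sum G R \<noteq> \<one>" if "R \<subseteq># {#a, b#}" "R \<noteq> {#}" for R
    proof -
      have "R \<subseteq># S" using subset_mset.order_trans[OF that(1) ab(1)] .
      then show ?thesis using less.prems that(2) unfolding zero_sum_free_def by blast
    qed
    have "a \<noteq> \<one>" "b \<noteq> \<one>" "a \<otimes> b \<noteq> \<one>"
      using nz[of "{#a#}"] nz[of "{#b#}"] nz[of "{#a, b#}"] c by (auto simp: seq_sum_add_mset)
    then have "card {\<one>, a, b, a \<otimes> b} = 4" using ab(2) c by (auto simp: card_insert_if)
    moreover have "{\<one>, a, b, a \<otimes> b} \<subseteq> subsums {#a, b#}"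
    proof -
      have "seq_sum G {#a#} = a" "seq_sum G {#b#} = b" "seq_sum G {#a, b#} = a \<otimes> b" "seq_sum G {#} = \<one>"
        using c by (auto simp: seq_sum_add_mset)
      moreover have "seq_sum G {#} \<in> subsums {#a,b#}" "seq_sum G {#a#} \<in> subsums {#a,b#}"
        "seq_sum G {#b#} \<in> subsums {#a,b#}" "seq_sum G {#a,b#} \<in> subsums {#a,b#}"
        unfolding subsums_def by (intro imageI; simp)+
      ultimately show ?thesis by simp
    qed
    ultimately have "4 \<le> card (subsums {#a, b#})" using card_mono[OF finite_subsums] by metis
    then have "card (subsums T) + 3 \<le> card (subsums S)"
      using card_subsums_union[of "{#a, b#}" T] less.prems S by simp
    then have "3 * size S + 2 \<le> m + 2 * card (subsums S)" using cm S by simp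
    moreover have "m \<le> count S c" using cm S by simp
    ultimately show ?thesis by blast
  next
    case False
    have "\<exists>c. S = replicate_mset (size S) c"
    proof (cases S)
      case (add a R)
      have "b = a" if "b \<in># R" for b
      proof (rule ccontr)
        assume "b \<noteq> a"
        moreover have "{#a, b#} \<subseteq># S" using that add by simp
        ultimately show False using False by blast
      qed
      then have "set_mset S \<subseteq> {a}" using add by auto
      then have "S = replicate_mset (size S) a" by (simp add: set_mset_subset_singletonD)
      then show ?thesis by blast
    qed simp
    then obtain c where c: "S = replicate_mset (size S) c" by blast
    have "count S c = size S" by (subst c) simp
    moreover have "size S + 1 \<le> card (subsums S)" by (rule card_subsums_ge[OF less.prems])
    ultimately show ?thesis by (intro exI[of _ c] exI[of _ "size S"]) simp
  qed
qed

lemma atom_zero_sum_free: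
  assumes "atom G (add_mset u S)"
  shows "zero_sum_free G S"
proof -
  have "T = {#}" if "T \<subseteq># S" "seq_sum G T = \<one>" for T
  proof -
    have "S \<subseteq># add_mset u S" by simp
    then have "T \<subseteq># add_mset u S" using that(1) by (rule subset_mset.order_trans[rotated])
    moreover have "T \<noteq> add_mset u S" using size_mset_mono[OF that(1)] by auto
    ultimately show ?thesis using assms that(2) unfolding atom_def by blast
  qed
  then show ?thesis using assms unfolding atom_def zero_sum_free_def by auto
qed

lemma subsums_subgroup:
  assumes "subgroup H G" "set_mset S \<subseteq> H"
  shows "subsums S \<subseteq> H"
  unfolding subsums_def using assms(2) by (auto dest!: set_mset_mono intro!: seq_sum_in_subgroup[OF assms(1)])

lemma atom_size_le:
  assumes "subgroup H G" "finite H" "atom G U" "set_mset U \<subseteq> H"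
  shows "size U \<le> card H"
proof -
  obtain u S where U: "U = add_mset u S" using assms(3) unfolding atom_def by (metis multiset_cases)
  then have "size S + 1 \<le> card (subsums S)" using card_subsums_ge atom_zero_sum_free assms(3) by auto
  also have "\<dots> \<le> card H" using subsums_subgroup[OF assms(1)] assms U by (intro card_mono) auto
  finally show ?thesis using U by simp
qed

lemma frequent_term_atom:
  assumes "subgroup H G" "finite H" "atom G U" "set_mset U \<subseteq> H"
  shows "\<exists>c. 3 * size U \<le> count U c + 2 * card H + 1"
proof -
  obtain u S where U: "U = add_mset u S" using assms(3) unfolding atom_def by (metis multiset_cases)
  obtain c m where cm: "3 * size S + 2 \<le> m + 2 * card (subsums S)" "m \<le> count S c"
    using frequent_term[OF atom_zero_sum_free] assms(3) U by blast
  have "card (subsums S) \<le> card H" using subsums_subgroup[OF assms(1)] assms U by (intro card_mono) auto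
  then have "3 * size U \<le> count U c + 2 * card H + 1" using cm U by simp
  then show ?thesis by blast
qed

lemma atom_one: "atom G {#\<one>#}"
proof -
  have "V = {#} \<or> V = {#\<one>#}" if "V \<subseteq># {#\<one>#}" for V
  proof (cases "V = {#}")
    case False
    then have "1 \<le> size V" by (simp add: Suc_le_eq nonempty_has_size)
    moreover have "size V \<le> 1" using size_mset_mono[OF that] by simp
    ultimately have "size V = 1" by simp
    then obtain v where "V = {#v#}" using size_1_singleton_mset by metis
    then show ?thesis using that by simp
  qed simp
  then show ?thesis unfolding atom_def by simp
qed

lemma davenport_props:
  assumes "finite (carrier G)"
  shows "atom G U \<Longrightarrow> size U \<le> davenport G" and "\<exists>U. atom G U \<and> size U = davenport G"
proof -
  let ?S = "size ` minimal_zero_sum_seqs G"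
  have "?S \<subseteq> {..card (carrier G)}"
    using atom_size_le[OF subgroup_self assms] minimal_zero_sum_seqs_iff_atom unfolding atom_def by fastforce
  then have fin: "finite ?S" using finite_subset by blast
  moreover have "?S \<noteq> {}" using atom_one minimal_zero_sum_seqs_iff_atom by blast
  ultimately have "davenport G \<in> ?S" unfolding davenport_def by (rule Max_in)
  then show "\<exists>U. atom G U \<and> size U = davenport G" using minimal_zero_sum_seqs_iff_atom by force
  show "size U \<le> davenport G" if "atom G U"
    unfolding davenport_def using fin that minimal_zero_sum_seqs_iff_atom by (intro Max_ge) auto
qed

end

section \<open>Independent families\<close>

text \<open>
  The numbers \<open>n i\<close> are then the orders of the \<open>e i\<close>, and a basis is an independent
  family that generates the group.
\<close>

definition independent_family :: "('a, 'b) monoid_scheme \<Rightarrow> nat \<Rightarrow> (nat \<Rightarrow> nat) \<Rightarrow> (nat \<Rightarrow> 'a) \<Rightarrow> bool" where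
  "independent_family G r n e \<longleftrightarrow>
     (\<forall>i<r. e i \<in> carrier G \<and> e i [^]\<^bsub>G\<^esub> n i = \<one>\<^bsub>G\<^esub>) \<and>
     (\<forall>a :: nat \<Rightarrow> nat. (\<Otimes>\<^bsub>G\<^esub>i\<in>{..<r}. e i [^]\<^bsub>G\<^esub> a i) = \<one>\<^bsub>G\<^esub> \<longrightarrow> (\<forall>i<r. n i dvd a i))"

text \<open>
  The conclusion of the theorem in terms of atoms and inclusion of multisets.
\<close>

definition sum_linked :: "('a, 'b) monoid_scheme \<Rightarrow> bool" where
  "sum_linked G \<longleftrightarrow> (\<exists>g1 g2 U1 U2. atom G U1 \<and> atom G U2 \<and> size U1 = davenport G \<and> size U2 = davenport G \<and>
     {#g1, g2#} \<subseteq># U1 \<and> g1 \<otimes>\<^bsub>G\<^esub> g2 \<in># U2)"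

lemma submultiset_of_sum_replicate:
  "V \<subseteq># (\<Sum>i<r. replicate_mset (n i) (e i)) \<Longrightarrow>
     \<exists>m. (\<forall>i<r. m i \<le> n i) \<and> V = (\<Sum>i<(r::nat). replicate_mset (m i) (e i))"
proof (induction r arbitrary: V)
  case (Suc r)
  let ?S = "\<Sum>i<r. replicate_mset (n i) (e i)"
  have sub: "V \<subseteq># ?S + replicate_mset (n r) (e r)" using Suc.prems by simp
  have "V - ?S \<subseteq># replicate_mset (n r) (e r)" using sub by (simp add: subset_eq_diff_conv add.commute)
  then obtain k where k: "k \<le> n r" "V - ?S = replicate_mset k (e r)" by (rule msubseteq_replicate_msetE)
  obtain m where m: "\<forall>i<r. m i \<le> n i" "V \<inter># ?S = (\<Sum>i<r. replicate_mset (m i) (e i))"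
    using Suc.IH[of "V \<inter># ?S"] by auto
  have "V = V \<inter># ?S + (V - ?S)" by (rule multiset_eqI) (simp add: min_def)
  also have "\<dots> = (\<Sum>i<Suc r. replicate_mset ((m(r := k)) i) (e i))" using m k by simp
  finally show ?case using m k by (intro exI[of _ "m(r := k)"]) (auto simp: less_Suc_eq)
qed simp

context comm_group
begin

lemma independent_familyD:
  assumes "independent_family G r n e"
  shows "i < r \<Longrightarrow> e i \<in> carrier G" "i < r \<Longrightarrow> e i [^] n i = \<one>"
    "(\<Otimes>i\<in>{..<r}. e i [^] (a i :: nat)) = \<one> \<Longrightarrow> i < r \<Longrightarrow> n i dvd a i"
  using assms unfolding independent_family_def by simp_all

lemma independent_familyI:
  assumes "\<And>i. i < r \<Longrightarrow> e i \<in> carrier G" "\<And>i. i < r \<Longrightarrow> e i [^] n i = \<one>"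
    "\<And>a i. (\<Otimes>i\<in>{..<r}. e i [^] (a i :: nat)) = \<one> \<Longrightarrow> i < r \<Longrightarrow> n i dvd a i"
  shows "independent_family G r n e"
  using assms unfolding independent_family_def by simp

lemma seq_sum_sum_replicate:
  assumes "\<And>i. i < r \<Longrightarrow> e i \<in> carrier G"
  shows "seq_sum G (\<Sum>i<(r::nat). replicate_mset (m i) (e i)) = (\<Otimes>i\<in>{..<r}. e i [^] m i)"
    and "set_mset (\<Sum>i<r. replicate_mset (m i) (e i)) \<subseteq> carrier G"
proof -
  have "seq_sum G (\<Sum>i<r. replicate_mset (m i) (e i)) = (\<Otimes>i\<in>{..<r}. e i [^] m i) \<and>
     set_mset (\<Sum>i<r. replicate_mset (m i) (e i)) \<subseteq> carrier G"
    using assms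
  proof (induction r)
    case (Suc r)
    have IH: "seq_sum G (\<Sum>i<r. replicate_mset (m i) (e i)) = (\<Otimes>i\<in>{..<r}. e i [^] m i)"
     "set_mset (\<Sum>i<r. replicate_mset (m i) (e i)) \<subseteq> carrier G" using Suc by auto
    have er: "e r \<in> carrier G" using Suc.prems by simp
    have fp: "(\<Otimes>i\<in>{..<Suc r}. e i [^] m i) = e r [^] m r \<otimes> (\<Otimes>i\<in>{..<r}. e i [^] m i)"
      unfolding lessThan_Suc by (rule finprod_insert) (use Suc.prems in auto)
    have cl: "(\<Otimes>i\<in>{..<r}. e i [^] m i) \<in> carrier G" by (rule finprod_closed) (use Suc.prems in auto)
    have rc: "set_mset (replicate_mset (m r) (e r)) \<subseteq> carrier G" using er by simp
    show ?case
      using IH er rc cl seq_sum_union[OF IH(2) rc] seq_sum_replicate[OF er] fp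
      by (auto simp: m_comm)
  qed simp
  then show "seq_sum G (\<Sum>i<r. replicate_mset (m i) (e i)) = (\<Otimes>i\<in>{..<r}. e i [^] m i)"
    "set_mset (\<Sum>i<r. replicate_mset (m i) (e i)) \<subseteq> carrier G" by auto
qed

text \<open>
  A zero-sum subsequence contains each \<open>e i\<close> with a multiplicity \<open>m i < n i\<close> and the
  sum \<open>s\<close> of the family at most once. If \<open>s\<close> is absent, independence gives
  \<open>n i | m i\<close>, so nothing is left; if \<open>s\<close> is present, it gives
  \<open>n i | m i + 1\<close>, so everything is used.
\<close>

lemma atom_of_independent_family:
  assumes ind: "independent_family G r n e" and n2: "\<And>i. i < r \<Longrightarrow> 2 \<le> n i"
  shows "atom G (add_mset (\<Otimes>i\<in>{..<r}. e i) (\<Sum>i<r. replicate_mset (n i - 1) (e i)))"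
proof -
  let ?s = "\<Otimes>i\<in>{..<r}. e i" and ?R = "\<lambda>m. \<Sum>i<r. replicate_mset (m i) (e i)"
  have ec: "e i \<in> carrier G" if "i < r" for i using independent_familyD(1)[OF ind that] .
  have sc: "?s \<in> carrier G" by (rule finprod_closed) (use ec in auto)
  note ss = seq_sum_sum_replicate[OF ec]
  have add: "seq_sum G (add_mset ?s (?R m)) = (\<Otimes>i\<in>{..<r}. e i [^] Suc (m i))" for m
  proof -
    have "seq_sum G (add_mset ?s (?R m)) = ?s \<otimes> (\<Otimes>i\<in>{..<r}. e i [^] m i)"
      using seq_sum_add_mset[OF sc ss(2)] ss(1) by simp
    also have "\<dots> = (\<Otimes>i\<in>{..<r}. e i \<otimes> e i [^] m i)"
      by (rule finprod_multf[symmetric]) (use ec in auto)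
    also have "\<dots> = (\<Otimes>i\<in>{..<r}. e i [^] Suc (m i))"
      by (rule finprod_cong') (use ec in \<open>auto simp: m_comm\<close>)
    finally show ?thesis .
  qed
  show ?thesis
    unfolding atom_def
  proof (intro conjI allI impI)
    show "set_mset (add_mset ?s (?R (\<lambda>i. n i - 1))) \<subseteq> carrier G" using sc ss(2) by simp
    show "add_mset ?s (?R (\<lambda>i. n i - 1)) \<noteq> {#}" by simp
    have "e i [^] Suc (n i - 1) = \<one>" if "i < r" for i
      using independent_familyD(2)[OF ind that] n2[OF that] by (simp add: Suc_diff_le)
    then show "seq_sum G (add_mset ?s (?R (\<lambda>i. n i - 1))) = \<one>"
      unfolding add by (intro finprod_one_eqI) auto
    fix V assume V: "V \<subseteq># add_mset ?s (?R (\<lambda>i. n i - 1)) \<and> seq_sum G V = \<one>"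
    show "V = {#} \<or> V = add_mset ?s (?R (\<lambda>i. n i - 1))"
    proof (cases "V \<subseteq># ?R (\<lambda>i. n i - 1)")
      case True
      then obtain m where m: "\<forall>i<r. m i \<le> n i - 1" "V = ?R m"
        using submultiset_of_sum_replicate[OF True] by auto
      have "(\<Otimes>i\<in>{..<r}. e i [^] m i) = \<one>" using V ss(1) m(2) by simp
      then have "n i dvd m i" if "i < r" for i using independent_familyD(3)[OF ind _ that, of m] by simp
      moreover have "m i < n i" if "i < r" for i
      proof -
        have "m i \<le> n i - 1" using m(1) that by simp
        then show ?thesis using n2[OF that] by simp
      qed
      ultimately have "m i = 0" if "i < r" for i using that nat_dvd_not_less[of "m i" "n i"] by blast
      then show ?thesis using m(2) by simp
    next
      case False
      have sV: "?s \<in># V"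
      proof (rule ccontr)
        assume ns: "?s \<notin># V"
        have "V \<subseteq># ?R (\<lambda>i. n i - 1)"
        proof (rule mset_subset_eqI)
          fix a
          have "V \<subseteq># add_mset ?s (?R (\<lambda>i. n i - 1))" using V by simp
          then have "count V a \<le> count (add_mset ?s (?R (\<lambda>i. n i - 1))) a" by (rule mset_subset_eq_count)
          then show "count V a \<le> count (?R (\<lambda>i. n i - 1)) a"
            using ns by (cases "?s = a") (auto simp: not_in_iff)
        qed
        then show False using False by simp
      qed
      then obtain W where W: "V = add_mset ?s W" by (metis multi_member_split)
      have "W \<subseteq># ?R (\<lambda>i. n i - 1)" using V unfolding W by simp
      from submultiset_of_sum_replicate[OF this]
      obtain m where m: "\<forall>i<r. m i \<le> n i - 1" "W = ?R m" by auto
      have "(\<Otimes>i\<in>{..<r}. e i [^] Suc (m i)) = \<one>" using V add[of m] m(2) W by simp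
      then have dv: "n i dvd Suc (m i)" if "i < r" for i
        using independent_familyD(3)[OF ind _ that, of "\<lambda>i. Suc (m i)"] by simp
      have "m i = n i - 1" if "i < r" for i
      proof -
        have "n i \<le> Suc (m i)" using dvd_imp_le[OF dv[OF that]] by simp
        moreover have "m i \<le> n i - 1" using m(1) that by simp
        ultimately show ?thesis by simp
      qed
      then have "W = ?R (\<lambda>i. n i - 1)" using m(2) by simp
      then show ?thesis using W by simp
    qed
  qed
qed

lemma size_sum_replicate: "size (\<Sum>i<(r::nat). replicate_mset (m i) (e i)) = (\<Sum>i<r. m i)"
  by (induction r) auto

text \<open>
  A relation with exponents \<open>a\<close> for the new family is a relation for the old one with
  \<open>a i + a j\<close> in place of \<open>a i\<close>. Since \<open>n i\<close> divides \<open>n j\<close>,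
  which divides \<open>a j\<close>, it also divides \<open>a i\<close>.
\<close>

lemma independent_shift:
  assumes ind: "independent_family G r n e" and ij: "i < r" "j < r" "i \<noteq> j" "n i dvd n j"
  shows "independent_family G r n (e(j := e i \<otimes> e j))"
proof -
  let ?e = "e(j := e i \<otimes> e j)"
  have ec: "e l \<in> carrier G" if "l < r" for l using independent_familyD(1)[OF ind that] .
  have ok: "?e l \<in> carrier G \<and> ?e l [^] n l = \<one>" if "l < r" for l
  proof (cases "l = j")
    case True
    obtain q where "n j = n i * q" using ij(4) by (auto elim: dvdE)
    then have "e i [^] n j = \<one>"
      using independent_familyD(2)[OF ind ij(1)] ec[OF ij(1)] by (simp flip: nat_pow_pow)
    then show ?thesis using True independent_familyD(2)[OF ind ij(2)] ec ij by (simp add: nat_pow_distrib)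
  next
    case False
    then show ?thesis using that independent_familyD[OF ind] by auto
  qed
  have dv: "n l dvd a l" if a: "(\<Otimes>l\<in>{..<r}. ?e l [^] (a l :: nat)) = \<one>" and l: "l < r" for a l
  proof -
    let ?a = "a(i := a i + a j)"
    have one: "(\<Otimes>l\<in>{..<r}. if l = k then e i [^] a j else \<one>) = e i [^] a j" if "k < r" for k
      using finprod_singleton[of k "{..<r}" "\<lambda>_. e i [^] a j"] that ec ij
      by (simp add: eq_commute)
    have "(\<Otimes>l\<in>{..<r}. ?e l [^] a l) = (\<Otimes>l\<in>{..<r}. e l [^] a l \<otimes> (if l = j then e i [^] a j else \<one>))"
      by (rule finprod_cong') (use ec ij in \<open>auto simp: nat_pow_distrib m_comm\<close>)
    also have "\<dots> = (\<Otimes>l\<in>{..<r}. e l [^] a l) \<otimes> e i [^] a j"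
      using one[OF ij(2)] ec ij by (subst finprod_multf) auto
    also have "\<dots> = (\<Otimes>l\<in>{..<r}. e l [^] a l \<otimes> (if l = i then e i [^] a j else \<one>))"
      using one[OF ij(1)] ec ij by (subst finprod_multf) auto
    also have "\<dots> = (\<Otimes>l\<in>{..<r}. e l [^] ?a l)"
      by (rule finprod_cong') (use ec ij in \<open>auto simp: nat_pow_mult\<close>)
    finally have "(\<Otimes>l\<in>{..<r}. e l [^] ?a l) = \<one>" using a by simp
    from independent_familyD(3)[OF ind this]
    have d: "n l dvd ?a l" if "l < r" for l using that .
    have "n j dvd a j" using d[OF ij(2)] ij(3) by simp
    then have "n i dvd a j" using ij(4) dvd_trans by blast
    moreover have "n i dvd a i + a j" using d[OF ij(1)] by simp
    ultimately have "n i dvd a i" by (simp add: dvd_add_left_iff)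
    then show ?thesis using d[OF l] by (cases "l = i") auto
  qed
  show ?thesis by (rule independent_familyI) (use ok dv in auto)
qed

lemma davenport_ge_independent:
  assumes "finite (carrier G)" "independent_family G r n e" "\<And>i. i < r \<Longrightarrow> 2 \<le> n i"
  shows "1 + (\<Sum>i<r. n i - 1) \<le> davenport G"
  using davenport_props(1)[OF assms(1) atom_of_independent_family[OF assms(2,3)]]
  by (simp add: size_sum_replicate)

text \<open>
  The atoms of a family and of its shift have the same length; the first one contains \<open>e i\<close> and
  \<open>e j\<close>, the second one their sum.
\<close>

lemma sum_linked_independent:
  assumes ind: "independent_family G r n e" and n2: "\<And>i. i < r \<Longrightarrow> 2 \<le> n i"
    and ij: "i < r" "j < r" "i \<noteq> j" "n i dvd n j"
    and D: "davenport G = 1 + (\<Sum>i<r. n i - 1)"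
  shows "sum_linked G"
proof -
  let ?U = "\<lambda>e. add_mset (\<Otimes>i\<in>{..<r}. e i) (\<Sum>i<r. replicate_mset (n i - 1) (e i))"
  let ?e = "e(j := e i \<otimes> e j)"
  have "atom G (?U e)" by (rule atom_of_independent_family[OF ind n2])
  moreover have "atom G (?U ?e)"
    by (rule atom_of_independent_family[OF independent_shift[OF ind ij] n2])
  moreover have "size (?U f) = davenport G" for f :: "nat \<Rightarrow> 'a" using D by (simp add: size_sum_replicate)
  moreover have "{#e i, e j#} \<subseteq># ?U e"
  proof -
    have "{#e i, e j#} \<subseteq># replicate_mset (n i - 1) (e i) + replicate_mset (n j - 1) (e j)"
      using n2[OF ij(1)] n2[OF ij(2)] 
      subset_mset.add_mono[of "{#e i#}" "replicate_mset (n i - 1) (e i)" "{#e j#}" "replicate_mset (n j - 1) (e j)"]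
      by (simp add: add_mset_commute)
    also have "\<dots> = (\<Sum>l\<in>{i, j}. replicate_mset (n l - 1) (e l))" using ij by simp
    also have "\<dots> \<subseteq># (\<Sum>l<r. replicate_mset (n l - 1) (e l))"
    proof -
      have "(\<Sum>l<r. replicate_mset (n l - 1) (e l)) = (\<Sum>l\<in>{..<r} - {i,j}. replicate_mset (n l - 1) (e l)) + (\<Sum>l\<in>{i, j}. replicate_mset (n l - 1) (e l))"
        by (rule sum.subset_diff) (use ij in auto)
      then show ?thesis by simp
    qed
    also have "\<dots> \<subseteq># ?U e" by simp
    finally show ?thesis .
  qed
  moreover have "e i \<otimes> e j \<in># ?U ?e"
  proof -
    have "?e j \<in># replicate_mset (n j - 1) (?e j)" using n2[OF ij(2)] by simp
    then have "?e j \<in># (\<Sum>l<r. replicate_mset (n l - 1) (?e l))" using ij(2) by (subst set_mset_sum) auto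
    then show ?thesis by simp
  qed
  ultimately show ?thesis unfolding sum_linked_def by blast
qed

lemma hom_finprod_integer_mod_group:
  assumes h: "h \<in> hom G (integer_mod_group m)" and ec: "\<And>l. l < r \<Longrightarrow> e l \<in> carrier G"
  shows "h (\<Otimes>l\<in>{..<(r::nat)}. e l [^] (a l :: nat)) = (\<Sum>l<r. int (a l) * h (e l)) mod int m"
  using ec
proof (induction r)
  case 0
  have "h \<one> = 0" using hom_one[OF h is_group] by simp
  then show ?case by simp
next
  case (Suc r)
  have cl: "(\<Otimes>i\<in>{..<r}. e i [^] a i) \<in> carrier G" by (rule finprod_closed) (use Suc.prems in auto)
  have er: "e r \<in> carrier G" using Suc.prems by simp
  have "h (\<Otimes>l\<in>{..<Suc r}. e l [^] a l) = h (e r [^] a r \<otimes> (\<Otimes>l\<in>{..<r}. e l [^] a l))"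
    unfolding lessThan_Suc by (subst finprod_insert) (use Suc.prems in auto)
  also have "\<dots> = (h (e r [^] a r) + h (\<Otimes>l\<in>{..<r}. e l [^] a l)) mod int m"
    using hom_mult[OF h _ cl] er by simp
  also have "h (e r [^] a r) = (int (a r) * h (e r)) mod int m"
    using hom_nat_pow[OF h er is_group group_integer_mod_group] by simp
  also have "h (\<Otimes>l\<in>{..<r}. e l [^] a l) = (\<Sum>l<r. int (a l) * h (e l)) mod int m"
    using Suc by simp
  finally show ?case by (simp add: mod_add_eq add.commute)
qed

text \<open>
  Coordinate homomorphisms \<open>\<chi> i\<close> that are dual to the elements \<open>u i\<close> detect
  divisibility of the exponents.
\<close>

lemma independent_family_of_iso:
  assumes \<phi>: "\<phi> \<in> iso G H" and H: "group H"
    and u: "\<And>i. i < r \<Longrightarrow> u i \<in> carrier H \<and> u i [^]\<^bsub>H\<^esub> n i = \<one>\<^bsub>H\<^esub>"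
    and \<chi>: "\<And>i. i < r \<Longrightarrow> \<chi> i \<in> hom H (integer_mod_group (n i))"
    and delta: "\<And>i l. i < r \<Longrightarrow> l < r \<Longrightarrow> \<chi> i (u l) = (if l = i then 1 else 0)"
  shows "\<exists>e. independent_family G r n e"
proof -
  have hom: "\<phi> \<in> hom G H" and inj: "inj_on \<phi> (carrier G)" and surj: "\<phi> ` carrier G = carrier H"
    using \<phi> by (auto simp: iso_def bij_betw_def)
  have "\<exists>x\<in>carrier G. \<phi> x = u i" if "i < r" for i using u[OF that] surj by (metis imageE)
  then obtain e where e: "\<And>i. i < r \<Longrightarrow> e i \<in> carrier G" "\<And>i. i < r \<Longrightarrow> \<phi> (e i) = u i" by metis
  have en: "e i [^] n i = \<one>" if "i < r" for i
  proof -
    have "\<phi> (e i [^] n i) = \<phi> \<one>"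
      using hom_nat_pow[OF hom e(1)[OF that] is_group H] e(2)[OF that] u[OF that] hom_one[OF hom is_group H] by simp
    then show ?thesis using inj_onD[OF inj] e(1)[OF that] by simp
  qed
  have dv: "n i dvd a i" if a: "(\<Otimes>l\<in>{..<r}. e l [^] (a l :: nat)) = \<one>" and i: "i < r" for a i
  proof -
    have h: "\<chi> i \<circ> \<phi> \<in> hom G (integer_mod_group (n i))" using hom \<chi>[OF i] by (auto simp: hom_def Pi_def)
    have "(\<Sum>l<r. int (a l) * (\<chi> i \<circ> \<phi>) (e l)) = (\<Sum>l<r. if l = i then int (a l) else 0)"
      by (rule sum.cong) (use e(2) delta i in auto)
    then have "(\<chi> i \<circ> \<phi>) (\<Otimes>l\<in>{..<r}. e l [^] a l) = int (a i) mod int (n i)"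
      using hom_finprod_integer_mod_group[OF h, of r e a] e(1) i by simp
    moreover have "(\<chi> i \<circ> \<phi>) \<one> = 0" using hom_one[OF h is_group] by simp
    ultimately have "int (a i) mod int (n i) = 0" using a by simp
    then show ?thesis by presburger
  qed
  have "independent_family G r n e" by (rule independent_familyI) (use e(1) en dv in auto)
  then show ?thesis by blast
qed

lemma independent_family_of_product_group:
  assumes "G \<cong> product_group {..<r} (\<lambda>i. integer_mod_group (n i))" and n2: "\<And>i. i < r \<Longrightarrow> 2 \<le> n i"
  shows "\<exists>e. independent_family G r n e"
proof -
  let ?P = "product_group {..<r} (\<lambda>i. integer_mod_group (n i))"
  define u where "u i = (\<lambda>l\<in>{..<r}. if l = i then 1 else 0 :: int)" for i
  obtain \<phi> where \<phi>: "\<phi> \<in> iso G ?P" using assms(1) by (auto simp: is_iso_def)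
  have P: "group ?P" by (rule product_group) simp
  have hom: "(\<lambda>x. x i) \<in> hom ?P (integer_mod_group (n i))" if "i < r" for i
    using that by (auto simp: hom_def)
  have uc: "u i \<in> carrier ?P" if "i < r" for i
  proof -
    have "(if l = i then 1 else 0) \<in> carrier (integer_mod_group (n l))" if "l < r" for l
      using n2[OF that] by (auto simp: carrier_integer_mod_group)
    then show ?thesis unfolding u_def carrier_product_group by (simp only: restrict_PiE_iff) simp
  qed
  show ?thesis
  proof (rule independent_family_of_iso[OF \<phi> P, where u = u and \<chi> = "\<lambda>i x. x i"])
    fix i assume i: "i < r"
    have "(u i [^]\<^bsub>?P\<^esub> n i) l = \<one>\<^bsub>?P\<^esub> l" for l
    proof (cases "l < r")
      case True
      have "(u i [^]\<^bsub>?P\<^esub> n i) l = u i l [^]\<^bsub>integer_mod_group (n l)\<^esub> n i"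
        using hom_nat_pow[OF hom[OF True] uc[OF i] P group_integer_mod_group] .
      then show ?thesis using True by (auto simp: u_def)
    next
      case False
      have "u i [^]\<^bsub>?P\<^esub> n i \<in> carrier ?P" using group.is_monoid[OF P] uc[OF i] by (simp add: monoid.nat_pow_closed del: carrier_product_group)
      then show ?thesis using False by (auto simp: PiE_def extensional_def)
    qed
    then show "u i \<in> carrier ?P \<and> u i [^]\<^bsub>?P\<^esub> n i = \<one>\<^bsub>?P\<^esub>" using uc[OF i] by blast
    show "(\<lambda>x. x i) \<in> hom ?P (integer_mod_group (n i))" by (rule hom[OF i])
  next
    fix i l assume "i < r" "l < r"
    then show "u l i = (if l = i then 1 else 0)" by (auto simp: u_def)
  qed
qed

end

section \<open>Bases of finite abelian groups\<close>

context comm_group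
begin

lemma finite_subgroupI:
  assumes fin: "finite (carrier G)" and H: "H \<subseteq> carrier G" "\<one> \<in> H" "\<And>x y. x \<in> H \<Longrightarrow> y \<in> H \<Longrightarrow> x \<otimes> y \<in> H"
  shows "subgroup H G"
proof (rule subgroupI)
  show "H \<subseteq> carrier G" "H \<noteq> {}" using H by auto
  show "x \<otimes> y \<in> H" if "x \<in> H" "y \<in> H" for x y using H(3) that .
  show "inv x \<in> H" if x: "x \<in> H" for x
  proof -
    have xc: "x \<in> carrier G" using x H by auto
    have pow: "x [^] n \<in> H" for n :: nat by (induction n) (use H x in auto)
    have "0 < order G" using fin order_gt_0_iff_finite by blast
    then have "x [^] (order G - 1) \<otimes> x = x [^] order G" by (metis Suc_pred' nat_pow_Suc)
    then have "inv x = x [^] (order G - 1)" using xc by (intro inv_equality) (auto simp: pow_order_eq_1)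
    then show ?thesis using pow by simp
  qed
qed

lemma subgroup_nat_pow: "subgroup H G \<Longrightarrow> x \<in> H \<Longrightarrow> x [^] (n::nat) \<in> H"
  by (induction n) (auto simp: subgroup.one_closed subgroup.m_closed)

text \<open>
  In a finite abelian group, the subgroup generated by a subgroup \<open>K\<close> and \<open>z\<close>.
\<close>

definition adjoin :: "'a set \<Rightarrow> 'a \<Rightarrow> 'a set" where
  "adjoin K z = {k \<otimes> z [^] (i::nat) | k i. k \<in> K}"

lemma adjoinI: "k \<in> K \<Longrightarrow> k \<otimes> z [^] (i::nat) \<in> adjoin K z"
  unfolding adjoin_def by blast

lemma adjoinE: assumes "x \<in> adjoin K z" obtains k i where "k \<in> K" "x = k \<otimes> z [^] (i::nat)"
  using assms unfolding adjoin_def by blast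

lemma adjoin_subset:
  assumes "subgroup H G" "K \<subseteq> H" "z \<in> H"
  shows "adjoin K z \<subseteq> H"
  using assms subgroup_nat_pow[OF assms(1,3)] subgroup.m_closed[OF assms(1)] by (auto elim!: adjoinE)

lemma adjoin_subgroup:
  assumes fin: "finite (carrier G)" and K: "subgroup K G" and z: "z \<in> carrier G"
  shows "subgroup (adjoin K z) G" "K \<subseteq> adjoin K z" "z \<in> adjoin K z"
proof -
  have Kc: "K \<subseteq> carrier G" by (rule subgroup.subset[OF K])
  have "k = k \<otimes> z [^] (0::nat)" if "k \<in> K" for k using that Kc by auto
  then show sub: "K \<subseteq> adjoin K z" using adjoinI[of _ K z 0] by auto
  have "z = \<one> \<otimes> z [^] (1::nat)" using z by simp
  then show "z \<in> adjoin K z" using adjoinI[OF subgroup.one_closed[OF K], of z 1] by simp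
  show "subgroup (adjoin K z) G"
  proof (rule finite_subgroupI[OF fin])
    show "adjoin K z \<subseteq> carrier G" by (rule adjoin_subset[OF subgroup_self Kc z])
    show "\<one> \<in> adjoin K z" using sub subgroup.one_closed[OF K] by auto
    fix x y assume "x \<in> adjoin K z" "y \<in> adjoin K z"
    then obtain k i l j where *: "k \<in> K" "x = k \<otimes> z [^] (i::nat)" "l \<in> K" "y = l \<otimes> z [^] (j::nat)"
      by (auto elim!: adjoinE)
    have kl: "k \<in> carrier G" "l \<in> carrier G" using * Kc by auto
    have "x \<otimes> y = (k \<otimes> l) \<otimes> (z [^] i \<otimes> z [^] j)" using * kl z by (simp add: m_ac)
    also have "\<dots> = (k \<otimes> l) \<otimes> z [^] (i + j)" using z by (simp add: nat_pow_mult)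
    finally show "x \<otimes> y \<in> adjoin K z" using adjoinI[OF subgroup.m_closed[OF K *(1,3)]] by simp
  qed
qed

text \<open>
  Stripping prime factors from \<open>n\<close> one at a time, some multiple of \<open>z\<close> is the last one
  outside \<open>L\<close>.
\<close>

lemma prime_multiple_into_subgroup:
  assumes "subgroup L G" "z \<in> carrier G" "z \<notin> L" "z [^] (n::nat) \<in> L" "0 < n"
  shows "\<exists>p m. Factorial_Ring.prime p \<and> p dvd n \<and> z [^] (m::nat) \<notin> L \<and> (z [^] m) [^] (p::nat) \<in> L"
  using assms(4,5)
proof (induction n rule: less_induct)
  case (less n)
  have "n \<noteq> 1" using less.prems assms(2,3) by auto
  then obtain p where p: "Factorial_Ring.prime p" "p dvd n" using prime_factor_nat by blast
  then obtain n' where n': "n = n' * p" by (metis dvdE mult.commute)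
  show ?case
  proof (cases "z [^] n' \<in> L")
    case False
    then show ?thesis using p n' less.prems assms(2) by (auto simp: nat_pow_pow)
  next
    case True
    have "n' < n" "0 < n'" using n' less.prems(2) prime_gt_1_nat[OF p(1)] by auto
    then obtain q m where "Factorial_Ring.prime q" "q dvd n'" "z [^] (m::nat) \<notin> L" "(z [^] m) [^] (q::nat) \<in> L"
      using less.IH[of n'] True by blast
    then show ?thesis using n' by (metis dvd_mult2)
  qed
qed

text \<open>
  An element \<open>g\<close> whose order is the exponent of \<open>H\<close> generates a direct summand. Take
  \<open>K\<close> maximal with trivial intersection with \<open>\<langle>g\<rangle>\<close>. If
  \<open>K + \<langle>g\<rangle>\<close> were not all of \<open>H\<close>, there would be \<open>z\<close>
  outside with \<open>p z = h + l g\<close> for a prime \<open>p\<close> and some \<open>h \<in> K\<close>.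
  Multiplying by \<open>ord g / p\<close> shows \<open>p | l\<close>, so \<open>w = z - (l / p) g\<close>
  satisfies \<open>p w = h\<close>, and adjoining \<open>w\<close> to \<open>K\<close> contradicts maximality.
\<close>

lemma cyclic_complement:
  assumes fin: "finite (carrier G)" and H: "subgroup H G" and g: "g \<in> H"
    and exp: "\<And>x. x \<in> H \<Longrightarrow> x [^] ord g = \<one>"
  shows "\<exists>K. subgroup K G \<and> K \<subseteq> H \<and> (\<forall>i::nat. g [^] i \<in> K \<longrightarrow> g [^] i = \<one>) \<and> adjoin K g = H"
proof -
  have Hc: "H \<subseteq> carrier G" by (rule subgroup.subset[OF H])
  have gc: "g \<in> carrier G" using g Hc by auto
  have n0: "0 < ord g" using ord_ge_1[OF fin gc] by simp
  define \<K> where "\<K> = {K. subgroup K G \<and> K \<subseteq> H \<and> (\<forall>i::nat. g [^] i \<in> K \<longrightarrow> g [^] i = \<one>)}"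
  have "{\<one>} \<in> \<K>" unfolding \<K>_def using triv_subgroup subgroup.one_closed[OF H] by auto
  moreover have finK: "finite \<K>"
    by (rule finite_subset[of _ "Pow (carrier G)"]) (use fin Hc in \<open>auto simp: \<K>_def\<close>)
  ultimately have "Max (card ` \<K>) \<in> card ` \<K>" by (intro Max_in) auto
  then obtain K where K: "K \<in> \<K>" "card K = Max (card ` \<K>)" by auto
  have maxK: "card K' \<le> card K" if "K' \<in> \<K>" for K' unfolding K(2) using that finK by simp
  have Ks: "subgroup K G" "K \<subseteq> H" "\<And>i::nat. g [^] i \<in> K \<Longrightarrow> g [^] i = \<one>" using K unfolding \<K>_def by auto
  have Kc: "K \<subseteq> carrier G" using Ks(2) Hc by auto
  let ?L = "adjoin K g"
  note L = adjoin_subgroup[OF fin Ks(1) gc]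
  have LH: "?L \<subseteq> H" by (rule adjoin_subset[OF H Ks(2) g])
  have "H \<subseteq> ?L"
  proof (rule ccontr)
    assume "\<not> H \<subseteq> ?L"
    then obtain z0 where z0: "z0 \<in> H" "z0 \<notin> ?L" by auto
    have z0c: "z0 \<in> carrier G" using z0 Hc by auto
    have "z0 [^] ord g \<in> ?L" using exp[OF z0(1)] subgroup.one_closed[OF L(1)] by simp
    then obtain p m where pm: "Factorial_Ring.prime p" "p dvd ord g" "z0 [^] (m::nat) \<notin> ?L" "(z0 [^] m) [^] p \<in> ?L"
      using prime_multiple_into_subgroup[OF L(1) z0c z0(2) _ n0] by blast
    define z where "z = z0 [^] m"
    have z: "z \<in> H" "z \<notin> ?L" "z [^] p \<in> ?L" "z \<in> carrier G"
      using pm subgroup_nat_pow[OF H z0(1)] Hc unfolding z_def by auto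
    obtain h l where hl: "h \<in> K" "z [^] p = h \<otimes> g [^] (l::nat)" using z(3) by (rule adjoinE)
    have hc: "h \<in> carrier G" using hl Kc by auto
    obtain q where q: "ord g = p * q" using pm(2) by (auto elim: dvdE)
    have q0: "0 < q" using q n0 by (cases q) auto
    have "\<one> = (z [^] p) [^] q" using exp[OF z(1)] q z(4) by (simp add: nat_pow_pow)
    also have "\<dots> = h [^] q \<otimes> g [^] (l * q)" using hl hc gc by (simp add: nat_pow_distrib nat_pow_pow)
    finally have eq: "h [^] q \<otimes> g [^] (l * q) = \<one>" by simp
    then have "g [^] (l * q) = inv (h [^] q)" using hc gc by (metis inv_equality inv_inv m_comm nat_pow_closed)
    then have "g [^] (l * q) \<in> K" using subgroup_nat_pow[OF Ks(1) hl(1)] subgroup.m_inv_closed[OF Ks(1)] by simp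
    then have "g [^] (l * q) = \<one>" by (rule Ks(3))
    then have "p * q dvd l * q" using pow_eq_id[OF gc] q by simp
    then have "p dvd l" using q0 by simp
    then obtain l' where l': "l = p * l'" by (auto elim: dvdE)
    define w where "w = z \<otimes> inv (g [^] l')"
    have wc: "w \<in> carrier G" using z gc unfolding w_def by simp
    have wH: "w \<in> H" unfolding w_def
      using subgroup.m_closed[OF H z(1)] subgroup.m_inv_closed[OF H subgroup_nat_pow[OF H g]] by simp
    have zw: "z = w \<otimes> g [^] l'" unfolding w_def using z gc by (simp add: m_assoc)
    have wL: "w \<notin> ?L"
    proof
      assume "w \<in> ?L"
      then have "w \<otimes> g [^] l' \<in> ?L" using subgroup.m_closed[OF L(1)] subgroup_nat_pow[OF L(1,3)] by simp
      then show False using zw z(2) by simp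
    qed
    have "w [^] p \<otimes> g [^] l = h \<otimes> g [^] l"
    proof -
      have "z [^] p = w [^] p \<otimes> (g [^] l') [^] p" using zw wc gc by (simp add: nat_pow_distrib)
      then show ?thesis using hl(2) l' gc by (simp add: nat_pow_pow mult.commute)
    qed
    then have wp: "w [^] p = h" using wc gc hc by simp
    have "adjoin K w \<in> \<K>"
    proof -
      have "g [^] i = \<one>" if i: "g [^] i \<in> adjoin K w" for i :: nat
      proof -
        obtain k j where kj: "k \<in> K" "g [^] i = k \<otimes> w [^] (j::nat)" using i by (rule adjoinE)
        have kc: "k \<in> carrier G" using kj Kc by auto
        have wjL: "w [^] j \<in> ?L"
        proof -
          have "w [^] j = inv k \<otimes> g [^] i" using kj kc wc by (simp add: m_assoc[symmetric])
          moreover have "inv k \<in> ?L" using subgroup.m_inv_closed[OF Ks(1) kj(1)] L(2) by auto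
          ultimately show ?thesis using subgroup.m_closed[OF L(1)] subgroup_nat_pow[OF L(1,3)] by simp
        qed
        have wpL: "w [^] p \<in> ?L" using wp hl(1) L(2) by auto
        \<comment> \<open>Otherwise a Bezout identity for \<open>j\<close> and \<open>p\<close> puts \<open>w\<close> itself into \<open>K + \<langle>g\<rangle>\<close>.\<close>
        have "p dvd j"
        proof (rule ccontr)
          assume "\<not> p dvd j"
          then have "coprime j p" using pm(1) by (metis coprime_commute prime_imp_coprime)
          then have "\<exists>x y. j * x = p * y + 1" using bezout_nat[of j p] pm(1)
            by (cases "j = 0") (auto simp: coprime_iff_gcd_eq_1)
          then obtain x y where xy: "j * x = p * y + 1" by blast
          have "(w [^] j) [^] x = (w [^] p) [^] y \<otimes> w" using xy wc by (simp add: nat_pow_pow)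
          moreover have "(w [^] j) [^] x \<in> ?L" "(w [^] p) [^] y \<in> ?L" using subgroup_nat_pow[OF L(1)] wjL wpL by auto
          ultimately have "w = inv ((w [^] p) [^] y) \<otimes> (w [^] j) [^] x" using wc by (simp add: m_assoc[symmetric])
          then have "w \<in> ?L" using subgroup.m_closed[OF L(1)] subgroup.m_inv_closed[OF L(1)]
              \<open>(w [^] j) [^] x \<in> ?L\<close> \<open>(w [^] p) [^] y \<in> ?L\<close> by metis
          then show False using wL by simp
        qed
        then obtain t where "j = p * t" by (auto elim: dvdE)
        then have "w [^] j = h [^] t" using wp wc by (metis nat_pow_pow)
        then have "w [^] j \<in> K" using subgroup_nat_pow[OF Ks(1) hl(1)] by simp
        then have "g [^] i \<in> K" using kj subgroup.m_closed[OF Ks(1)] by simp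
        then show ?thesis by (rule Ks(3))
      qed
      then show ?thesis
        unfolding \<K>_def using adjoin_subgroup(1)[OF fin Ks(1) wc] adjoin_subset[OF H Ks(2) wH] by blast
    qed
    then have le: "card (adjoin K w) \<le> card K" by (rule maxK)
    have psub: "K \<subset> adjoin K w" using adjoin_subgroup(2,3)[OF fin Ks(1) wc] wL L(2) by auto
    have "finite (adjoin K w)"
      using subgroup.subset[OF adjoin_subgroup(1)[OF fin Ks(1) wc]] fin finite_subset by blast
    from psubset_card_mono[OF this psub] show False using le by simp
  qed
  then have "adjoin K g = H" using LH by auto
  then show ?thesis using Ks by blast
qed

lemma ord_mult_coprime_ge:
  assumes fin: "finite (carrier G)" and a: "a \<in> carrier G" and b: "b \<in> carrier G" and co: "coprime (ord a) (ord b)"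
  shows "ord a * ord b \<le> ord (a \<otimes> b)"
proof -
  let ?k = "ord (a \<otimes> b)"
  have ab: "a \<otimes> b \<in> carrier G" using a b by simp
  have one: "(a \<otimes> b) [^] (?k * t) = \<one>" for t :: nat using ab by (simp flip: nat_pow_pow)
  have "a [^] (?k * ord b) = \<one>"
  proof -
    have "b [^] (?k * ord b) = \<one>" using b by (simp add: pow_eq_id)
    then show ?thesis using one[of "ord b"] a b by (simp add: nat_pow_distrib)
  qed
  then have "ord a dvd ?k * ord b" using pow_eq_id[OF a] by simp
  then have 1: "ord a dvd ?k" using co by (simp add: coprime_dvd_mult_left_iff)
  have "b [^] (?k * ord a) = \<one>"
  proof -
    have "a [^] (?k * ord a) = \<one>" using a by (simp add: pow_eq_id)
    then show ?thesis using one[of "ord a"] a b by (simp add: nat_pow_distrib)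
  qed
  then have "ord b dvd ?k * ord a" using pow_eq_id[OF b] by simp
  then have 2: "ord b dvd ?k" using co by (simp add: coprime_dvd_mult_left_iff coprime_commute)
  have "ord a * ord b dvd ?k" by (rule divides_mult[OF 1 2 co])
  then show ?thesis using dvd_imp_le ord_ge_1[OF fin ab] by simp
qed

text \<open>
  An element \<open>g\<close> of maximal order works. If the order of \<open>x\<close> contained a higher power
  of a prime \<open>p\<close> than the order of \<open>g\<close>, then trading the \<open>p\<close>-part of
  \<open>g\<close> for that of \<open>x\<close> would give an element of larger order.
\<close>

lemma exponent_attained:
  assumes fin: "finite (carrier G)" and H: "subgroup H G"
  shows "\<exists>g\<in>H. \<forall>x\<in>H. x [^] ord g = \<one>"
proof -
  have Hc: "H \<subseteq> carrier G" by (rule subgroup.subset[OF H])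
  have finH: "finite H" using Hc fin finite_subset by blast
  have "H \<noteq> {}" using subgroup.one_closed[OF H] by auto
  then have "Max (ord ` H) \<in> ord ` H" using finH by (intro Max_in) auto
  then obtain g where g: "g \<in> H" "ord g = Max (ord ` H)" by auto
  have max: "ord x \<le> ord g" if "x \<in> H" for x unfolding g(2) using that finH by simp
  have gc: "g \<in> carrier G" using g Hc by auto
  have "x [^] ord g = \<one>" if x: "x \<in> H" for x
  proof (rule ccontr)
    assume neq: "x [^] ord g \<noteq> \<one>"
    have xc: "x \<in> carrier G" using x Hc by auto
    have pos: "0 < ord x" "0 < ord g" using ord_ge_1[OF fin xc] ord_ge_1[OF fin gc] by auto
    have "\<not> ord x dvd ord g" using neq pow_eq_id[OF xc] by simp
    have "\<exists>p. Factorial_Ring.prime p \<and> multiplicity p (ord g) < multiplicity p (ord x)"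
    proof (rule ccontr)
      assume "\<not> ?thesis"
      then have "multiplicity p (ord x) \<le> multiplicity p (ord g)" if "Factorial_Ring.prime p" for p
        using that by (auto simp: not_less)
      then have "ord x dvd ord g" using pos by (intro multiplicity_le_imp_dvd) auto
      then show False using \<open>\<not> ord x dvd ord g\<close> by simp
    qed
    then obtain p where p: "Factorial_Ring.prime p" "multiplicity p (ord g) < multiplicity p (ord x)" by blast
    define a where "a = multiplicity p (ord x)"
    define b where "b = multiplicity p (ord g)"
    have ba: "b < a" using p unfolding a_def b_def by simp
    have pu: "\<not> is_unit p" "p \<noteq> 0" using p(1) by auto
    obtain s where s: "ord x = p ^ a * s" using multiplicity_dvd[of p "ord x"] unfolding a_def by (auto elim: dvdE)
    obtain t where t: "ord g = p ^ b * t" using multiplicity_dvd[of p "ord g"] unfolding b_def by (auto elim: dvdE)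
    have nt: "\<not> p dvd t" using multiplicity_decompose'[of "ord g" p] pos pu t unfolding b_def
      by (metis mult_left_cancel not_gr0 power_not_zero)
    have s0: "s \<noteq> 0" and t0: "t \<noteq> 0" using s t pos by auto
    have "ord (x [^] s) = p ^ a" using ord_pow[OF xc, of s] s s0 by simp
    moreover have "ord (g [^] (p ^ b)) = t" using ord_pow[OF gc, of "p ^ b"] t pu by simp
    moreover have "coprime (p ^ a) t" using nt p(1) by (simp add: prime_imp_coprime)
    ultimately have "p ^ a * t \<le> ord (x [^] s \<otimes> g [^] (p ^ b))"
      using ord_mult_coprime_ge[OF fin, of "x [^] s" "g [^] (p ^ b)"] xc gc by simp
    also have "\<dots> \<le> ord g"
      using max subgroup.m_closed[OF H] subgroup_nat_pow[OF H] x g by simp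
    finally have "p ^ a * t \<le> p ^ b * t" using t by simp
    then have "p ^ a \<le> p ^ b" using t0 by simp
    moreover have "p ^ b < p ^ a" using ba prime_gt_1_nat[OF p(1)] by simp
    ultimately show False by simp
  qed
  then show ?thesis using g by blast
qed

text \<open>
  The existence part of the fundamental theorem of finite abelian groups, by splitting off a cyclic summand of
  maximal order. This summand comes last, so each \<open>n i\<close> divides the next one.
\<close>

lemma basis_of_subgroup:
  assumes fin: "finite (carrier G)" and H: "subgroup H G"
  shows "\<exists>r n e. independent_family G r n e \<and> (\<forall>i<r. 1 < n i) \<and> (\<forall>i. Suc i < r \<longrightarrow> n i dvd n (Suc i)) \<and>
    (\<forall>i<r. e i \<in> H) \<and> (\<forall>x\<in>H. \<exists>a::nat \<Rightarrow> nat. x = (\<Otimes>i\<in>{..<r}. e i [^] a i))"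
  using H
proof (induction "card H" arbitrary: H rule: less_induct)
  case less
  note H = less.prems
  have Hc: "H \<subseteq> carrier G" by (rule subgroup.subset[OF H])
  have finH: "finite H" using Hc fin finite_subset by blast
  show ?case
  proof (cases "H = {\<one>}")
    case True
    have "independent_family G 0 (\<lambda>_. 0) (\<lambda>_. \<one>)" by (rule independent_familyI) auto
    then show ?thesis using True by (intro exI[of _ 0] exI[of _ "\<lambda>_. 0"] exI[of _ "\<lambda>_. \<one>"]) auto
  next
    case False
    obtain g where g: "g \<in> H" "\<And>x. x \<in> H \<Longrightarrow> x [^] ord g = \<one>"
      using exponent_attained[OF fin H] by blast
    have gc: "g \<in> carrier G" using g Hc by auto
    have g1: "1 < ord g"
    proof (rule ccontr)
      assume "\<not> 1 < ord g"
      then have o1: "ord g = 1" using ord_ge_1[OF fin gc] by simp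
      have "x = \<one>" if "x \<in> H" for x
      proof -
        have "x [^] (1::nat) = \<one>" using g(2)[OF that] unfolding o1 .
        then show ?thesis using that Hc by (simp add: subset_eq)
      qed
      then have "H \<subseteq> {\<one>}" by (intro subsetI) simp
      then show False using False subgroup.one_closed[OF H] by auto
    qed
    have "\<exists>K. subgroup K G \<and> K \<subseteq> H \<and> (\<forall>i::nat. g [^] i \<in> K \<longrightarrow> g [^] i = \<one>) \<and> adjoin K g = H"
      by (rule cyclic_complement[OF fin H g(1)]) (rule g(2))
    then obtain K where K0: "subgroup K G \<and> K \<subseteq> H \<and>
      (\<forall>i::nat. g [^] i \<in> K \<longrightarrow> g [^] i = \<one>) \<and> adjoin K g = H"
      by (elim exE) (rule that)
    have K: "subgroup K G" "K \<subseteq> H" "g [^] i \<in> K \<Longrightarrow> g [^] i = \<one>" "adjoin K g = H" for i :: nat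
      using K0 by simp_all
    have Kc: "K \<subseteq> carrier G" using K(2) Hc by simp
    have "g \<notin> K" 
    proof
      assume "g \<in> K"
      then have "g = \<one>" using K(3)[of 1] gc by simp
      then show False using g1 by simp
    qed
    then have "K \<subset> H" using K(2) g(1) by auto
    then have "card K < card H" by (rule psubset_card_mono[OF finH])
    from less.hyps[OF this K(1)] obtain r n e where ex: "independent_family G r n e \<and> (\<forall>i<r. 1 < n i) \<and>
      (\<forall>i. Suc i < r \<longrightarrow> n i dvd n (Suc i)) \<and>
      (\<forall>i<r. e i \<in> K) \<and> (\<forall>x\<in>K. \<exists>a::nat \<Rightarrow> nat. x = (\<Otimes>i\<in>{..<r}. e i [^] a i))"
      by (elim exE) (rule that)
    have ind: "independent_family G r n e" and n1: "\<forall>i<r. 1 < n i" and dv: "\<forall>i. Suc i < r \<longrightarrow> n i dvd n (Suc i)"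
      and eK: "\<forall>i<r. e i \<in> K" and gen: "\<forall>x\<in>K. \<exists>a::nat \<Rightarrow> nat. x = (\<Otimes>i\<in>{..<r}. e i [^] a i)"
      using ex by simp_all
    have ec: "e i \<in> carrier G" if "i < r" for i using eK Kc that by auto
    let ?n = "n(r := ord g)" and ?e = "e(r := g)"
    have prodK: "(\<Otimes>i\<in>{..<r}. e i [^] (a i :: nat)) \<in> K" for a
      using seq_sum_in_subgroup[OF K(1), of "\<Sum>i<r. replicate_mset (a i) (e i)"]
        seq_sum_sum_replicate(1)[of r e a, OF ec] eK by (auto simp: set_mset_sum split: if_splits)
    have prod: "(\<Otimes>i\<in>{..<Suc r}. ?e i [^] (a i :: nat)) = (\<Otimes>i\<in>{..<r}. e i [^] a i) \<otimes> g [^] a r" for a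
    proof -
      have "(\<Otimes>i\<in>{..<Suc r}. ?e i [^] a i) = g [^] a r \<otimes> (\<Otimes>i\<in>{..<r}. ?e i [^] a i)"
        unfolding lessThan_Suc by (subst finprod_insert) (use ec gc in auto)
      also have "(\<Otimes>i\<in>{..<r}. ?e i [^] a i) = (\<Otimes>i\<in>{..<r}. e i [^] a i)"
        by (rule finprod_cong') (use ec in auto)
      finally show ?thesis using prodK Kc gc by (simp add: m_comm subset_eq)
    qed
    have indep: "independent_family G (Suc r) ?n ?e"
    proof (rule independent_familyI)
      fix i assume i: "i < Suc r"
      show "?e i \<in> carrier G" using i ec gc by auto
      show "?e i [^] ?n i = \<one>" using i independent_familyD(2)[OF ind] gc by (auto simp: less_Suc_eq)
    next
      fix a :: "nat \<Rightarrow> nat" and i assume a: "(\<Otimes>i\<in>{..<Suc r}. ?e i [^] a i) = \<one>" and i: "i < Suc r"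
      let ?x = "\<Otimes>i\<in>{..<r}. e i [^] a i"
      have xc: "?x \<in> carrier G" using prodK Kc by auto
      have "g [^] a r \<otimes> ?x = \<one>" using a prod xc gc by (simp add: m_comm)
      then have "g [^] a r = inv ?x" using xc gc by (metis inv_equality inv_inv nat_pow_closed)
      then have "g [^] a r \<in> K" using subgroup.m_inv_closed[OF K(1) prodK] by simp
      then have ga: "g [^] a r = \<one>" by (rule K(3))
      then have "?x = \<one>" using \<open>g [^] a r \<otimes> ?x = \<one>\<close> xc by simp
      then have "n i dvd a i" if "i < r" using independent_familyD(3)[OF ind _ that] by simp
      moreover have "ord g dvd a r" using ga pow_eq_id[OF gc] by simp
      ultimately show "?n i dvd a i" using i by (auto simp: less_Suc_eq)
    qed
    moreover have "\<forall>i<Suc r. 1 < ?n i" using n1 g1 by (auto simp: less_Suc_eq)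
    moreover have "\<forall>i. Suc i < Suc r \<longrightarrow> ?n i dvd ?n (Suc i)"
    proof (intro allI impI)
      fix i assume i: "Suc i < Suc r"
      show "?n i dvd ?n (Suc i)"
      proof (cases "Suc i = r")
        case False then show ?thesis using i dv by auto
      next
        case True
        then have ir: "i < r" by simp
        have "e i [^] ord g = \<one>" using g(2) eK K(2) ir by auto
        moreover have "(\<Otimes>l\<in>{..<r}. e l [^] (if l = i then ord g else 0)) = (\<Otimes>l\<in>{..<r}. \<one>)"
          by (rule finprod_cong') (use calculation in auto)
        ultimately have "(\<Otimes>l\<in>{..<r}. e l [^] (if l = i then ord g else 0)) = \<one>" by simp
        from independent_familyD(3)[OF ind this ir] show ?thesis using True by auto
      qed
    qed
    moreover have "\<forall>i<Suc r. ?e i \<in> H" using eK K(2) g(1) by (auto simp: less_Suc_eq)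
    moreover have "\<forall>x\<in>H. \<exists>a::nat \<Rightarrow> nat. x = (\<Otimes>i\<in>{..<Suc r}. ?e i [^] a i)"
    proof
      fix x assume "x \<in> H"
      then have "x \<in> adjoin K g" using K(4) by simp
      then obtain k i where ki: "k \<in> K" "x = k \<otimes> g [^] (i::nat)" by (rule adjoinE)
      obtain a where a: "k = (\<Otimes>i\<in>{..<r}. e i [^] (a i :: nat))" using gen ki(1) by blast
      have "(\<Otimes>l\<in>{..<r}. e l [^] ((a(r := i)) l)) = k" unfolding a
        by (rule finprod_cong') (use ec in auto)
      then have "x = (\<Otimes>l\<in>{..<Suc r}. ?e l [^] ((a(r := i)) l))" unfolding prod using ki(2) by simp
      then show "\<exists>a::nat \<Rightarrow> nat. x = (\<Otimes>i\<in>{..<Suc r}. ?e i [^] a i)" by blast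
    qed
    ultimately show ?thesis by blast
  qed
qed

lemma product_group_iso_of_basis:
  assumes fin: "finite (carrier G)" and ind: "independent_family G r n e" and n1: "\<And>i. i < r \<Longrightarrow> 1 < n i"
    and gen: "\<And>x. x \<in> carrier G \<Longrightarrow> \<exists>a::nat \<Rightarrow> nat. x = (\<Otimes>i\<in>{..<r}. e i [^] a i)"
  shows "G \<cong> product_group {..<r} (\<lambda>i. integer_mod_group (n i))"
proof -
  let ?P = "product_group {..<r} (\<lambda>i. integer_mod_group (n i))"
  define f where "f x = (\<Otimes>i\<in>{..<r}. e i [^] nat (x i))" for x :: "nat \<Rightarrow> int"
  have ec: "e i \<in> carrier G" if "i < r" for i using independent_familyD(1)[OF ind that] .
  have pm: "e i [^] (m mod n i) = e i [^] m" if "i < r" for i and m :: nat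
  proof -
    have "e i [^] m = e i [^] (n i * (m div n i)) \<otimes> e i [^] (m mod n i)"
      using ec[OF that] by (simp add: nat_pow_mult)
    also have "e i [^] (n i * (m div n i)) = \<one>"
      using ec[OF that] independent_familyD(2)[OF ind that] by (simp flip: nat_pow_pow)
    finally show ?thesis using ec[OF that] by simp
  qed
  have range: "0 \<le> x i \<and> x i < int (n i)" if "x \<in> carrier ?P" "i < r" for x i
  proof -
    have "x i \<in> carrier (integer_mod_group (n i))" using that by (auto simp: PiE_def)
    then show ?thesis using n1[OF that(2)] by (auto simp: carrier_integer_mod_group split: if_splits)
  qed
  have fc: "f x \<in> carrier G" for x unfolding f_def by (rule finprod_closed) (use ec in auto)
  have hom: "f \<in> hom ?P G"
  proof (rule homI)
    show "f x \<in> carrier G" for x by (rule fc)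
    fix x y assume xy: "x \<in> carrier ?P" "y \<in> carrier ?P"
    have "f (x \<otimes>\<^bsub>?P\<^esub> y) = (\<Otimes>i\<in>{..<r}. e i [^] nat (x i) \<otimes> e i [^] nat (y i))"
      unfolding f_def
    proof (rule finprod_cong')
      fix i assume "i \<in> {..<r}"
      then have i: "i < r" by simp
      have "nat ((x i + y i) mod int (n i)) = (nat (x i) + nat (y i)) mod n i"
        using range[OF xy(1) i] range[OF xy(2) i] by (simp add: nat_mod_distrib nat_add_distrib)
      then show "e i [^] nat ((x \<otimes>\<^bsub>?P\<^esub> y) i) = e i [^] nat (x i) \<otimes> e i [^] nat (y i)"
        using i ec[OF i] pm[OF i] by (simp add: nat_pow_mult)
    qed (use ec in auto)
    also have "\<dots> = f x \<otimes> f y" unfolding f_def by (rule finprod_multf) (use ec in auto)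
    finally show "f (x \<otimes>\<^bsub>?P\<^esub> y) = f x \<otimes> f y" .
  qed
  have inj: "inj_on f (carrier ?P)"
  proof (rule inj_onI)
    fix x y assume xy: "x \<in> carrier ?P" "y \<in> carrier ?P" "f x = f y"
    \<comment> \<open>Exponents are natural numbers, so \<open>n i - y i\<close> stands for the opposite of \<open>y i\<close>.\<close>
    let ?c = "\<Otimes>i\<in>{..<r}. e i [^] (n i - nat (y i))"
    have cc: "?c \<in> carrier G" by (rule finprod_closed) (use ec in auto)
    have "(\<Otimes>i\<in>{..<r}. e i [^] (nat (x i) + (n i - nat (y i)))) = (\<Otimes>i\<in>{..<r}. e i [^] nat (x i) \<otimes> e i [^] (n i - nat (y i)))"
      by (rule finprod_cong') (use ec in \<open>auto simp: nat_pow_mult\<close>)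
    also have "\<dots> = f x \<otimes> ?c" unfolding f_def by (rule finprod_multf) (use ec in auto)
    also have "\<dots> = f y \<otimes> ?c" using xy(3) by simp
    also have "\<dots> = (\<Otimes>i\<in>{..<r}. e i [^] nat (y i) \<otimes> e i [^] (n i - nat (y i)))"
      unfolding f_def by (rule finprod_multf[symmetric]) (use ec in auto)
    also have "\<dots> = \<one>"
    proof (rule finprod_one_eqI)
      fix i assume "i \<in> {..<r}"
      then have i: "i < r" by simp
      have "nat (y i) + (n i - nat (y i)) = n i" using range[OF xy(2) i] by linarith
      then show "e i [^] nat (y i) \<otimes> e i [^] (n i - nat (y i)) = \<one>"
        using ec[OF i] independent_familyD(2)[OF ind i] by (simp add: nat_pow_mult)
    qed
    finally have one: "(\<Otimes>i\<in>{..<r}. e i [^] (nat (x i) + (n i - nat (y i)))) = \<one>" .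
    have "x i = y i" if i: "i < r" for i
    proof -
      have d: "n i dvd nat (x i) + (n i - nat (y i))" using independent_familyD(3)[OF ind one i] .
      have xr: "nat (x i) < n i" and yr: "nat (y i) < n i" and p: "0 \<le> x i" "0 \<le> y i"
        using range[OF xy(1) i] range[OF xy(2) i] by auto
      obtain q where q: "nat (x i) + (n i - nat (y i)) = n i * q" using d by (auto elim: dvdE)
      have "n i * q < n i * 2" "n i * 0 < n i * q" using q xr yr by linarith+
      then have "q = 1" by (metis One_nat_def Suc_1 less_2_cases mult_less_cancel1 nat_neq_iff less_nat_zero_code)
      then show ?thesis using q xr yr p by simp
    qed
    then show "x = y" using xy(1,2) by (intro PiE_ext[of x "{..<r}"]) auto
  qed
  have surj: "f ` carrier ?P = carrier G"
  proof (intro equalityI subsetI)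
    fix x assume "x \<in> f ` carrier ?P" then show "x \<in> carrier G" using fc by auto
  next
    fix x assume "x \<in> carrier G"
    then obtain a where a: "x = (\<Otimes>i\<in>{..<r}. e i [^] (a i :: nat))" using gen by blast
    let ?y = "\<lambda>i\<in>{..<r}. int (a i mod n i)"
    have "f ?y = x" unfolding f_def a
      by (rule finprod_cong') (use ec pm in auto)
    moreover have "?y \<in> carrier ?P"
    proof -
      have "int (a i mod n i) \<in> carrier (integer_mod_group (n i))" if "i < r" for i
      proof -
        have "a i mod n i < n i" using n1[OF that] by simp
        then show ?thesis by (simp add: carrier_integer_mod_group)
      qed
      then show ?thesis unfolding carrier_product_group by (simp only: restrict_PiE_iff) simp
    qed
    ultimately show "x \<in> f ` carrier ?P" by blast
  qed
  have "f \<in> iso ?P G" unfolding iso_def bij_betw_def using hom inj surj by simp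
  moreover have "group ?P" by (rule product_group) simp
  ultimately show ?thesis using group.iso_sym is_isoI by blast
qed

lemma ex_invariant_factors:
  assumes fin: "finite (carrier G)"
  shows "\<exists>ns. invariant_factors G ns"
proof -
  obtain r n e where b: "independent_family G r n e" "\<forall>i<r. 1 < n i" "\<forall>i. Suc i < r \<longrightarrow> n i dvd n (Suc i)"
    "\<forall>x\<in>carrier G. \<exists>a::nat \<Rightarrow> nat. x = (\<Otimes>i\<in>{..<r}. e i [^] a i)"
    using basis_of_subgroup[OF fin subgroup_self] by blast
  define ns where "ns = map n [0..<r]"
  have ns: "length ns = r" "\<And>i. i < r \<Longrightarrow> ns ! i = n i" unfolding ns_def by auto
  have "G \<cong> product_group {..<r} (\<lambda>i. integer_mod_group (n i))"
    by (rule product_group_iso_of_basis[OF fin b(1)]) (use b in auto)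
  moreover have "product_group {..<r} (\<lambda>i. integer_mod_group (n i)) = product_group {..<length ns} (\<lambda>i. integer_mod_group (ns ! i))"
    unfolding product_group_def using ns by (auto simp: restrict_def fun_eq_iff intro!: PiE_cong)
  ultimately have "G \<cong> product_group {..<length ns} (\<lambda>i. integer_mod_group (ns ! i))" by simp
  then have "invariant_factors G ns"
    unfolding invariant_factors_def using ns b(2,3) by (auto simp: in_set_conv_nth)
  then show ?thesis by blast
qed

text \<open>
  A group that is not cyclic has at least two invariant factors, and the first divides the second.
\<close>

lemma sum_linked_of_davenport_star:
  assumes fin: "finite (carrier G)" and nc: "\<not> cyclic_group G" and D: "davenport G = davenport_star G"
  shows "sum_linked G"
proof -
  define ns where "ns = (SOME ns. invariant_factors G ns)"
  have inv: "invariant_factors G ns" unfolding ns_def using ex_invariant_factors[OF fin] by (rule someI_ex)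
  let ?P = "product_group {..<length ns} (\<lambda>i. integer_mod_group (ns ! i))"
  have iso: "G \<cong> ?P" using inv unfolding invariant_factors_def by simp
  have n1: "\<forall>n\<in>set ns. 1 < n" and dvs: "\<forall>i. Suc i < length ns \<longrightarrow> ns ! i dvd ns ! Suc i"
    using inv unfolding invariant_factors_def by simp_all
  have n2: "2 \<le> ns ! i" if "i < length ns" for i
    using bspec[OF n1 nth_mem[OF that]] by linarith
  have dv: "ns ! i dvd ns ! Suc i" if "Suc i < length ns" for i
    using dvs that by blast
  have P: "group ?P" by (rule product_group) simp
  have "2 \<le> length ns"
  proof (rule ccontr)
    assume "\<not> 2 \<le> length ns"
    then consider "length ns = 0" | "length ns = 1" by linarith
    then have "cyclic_group ?P"
    proof cases
      case 1
      then have "carrier ?P = {\<one>\<^bsub>?P\<^esub>}" by (simp add: restrict_def)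
      then have "trivial_group ?P" using P unfolding trivial_group_def by simp
      then show ?thesis by (rule trivial_imp_cyclic_group)
    next
      case 2
      let ?u = "\<lambda>i\<in>{..<length ns}. (1::int)"
      have l: "{..<length ns} = {0}" using 2 by auto
      have n2': "2 \<le> ns ! 0" using n2[of 0] 2 by simp
      have uc: "?u \<in> carrier ?P"
        unfolding carrier_product_group restrict_PiE_iff using n2' l by (simp add: carrier_integer_mod_group)
      have "x \<in> range (\<lambda>k::int. ?u [^]\<^bsub>?P\<^esub> k)" if x: "x \<in> carrier ?P" for x
      proof -
        have "x 0 \<in> carrier (integer_mod_group (ns ! 0))"
          using x l unfolding carrier_product_group by (intro PiE_mem[of x "{..<length ns}"]) simp_all
        then have x0: "0 \<le> x 0" "x 0 < int (ns ! 0)" using n2' by (simp_all add: carrier_integer_mod_group)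
        have h: "(\<lambda>x. x 0) \<in> hom ?P (integer_mod_group (ns ! 0))" using l by (auto simp: hom_def)
        have "(?u [^]\<^bsub>?P\<^esub> nat (x 0)) 0 = x 0"
          using hom_nat_pow[OF h uc P group_integer_mod_group, of "nat (x 0)"] x0 l by simp
        moreover have "?u [^]\<^bsub>?P\<^esub> nat (x 0) \<in> carrier ?P"
          using monoid.nat_pow_closed[OF group.is_monoid[OF P] uc] .
        ultimately have ux: "?u [^]\<^bsub>?P\<^esub> nat (x 0) = x" using x unfolding carrier_product_group l
          by (intro PiE_ext[of _ "{0}"]) auto
        have "?u [^]\<^bsub>?P\<^esub> int (nat (x 0)) = ?u [^]\<^bsub>?P\<^esub> nat (x 0)" by (rule int_pow_int)
        then have "x = ?u [^]\<^bsub>?P\<^esub> int (nat (x 0))" unfolding ux by (rule sym)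
        then show ?thesis by (rule range_eqI)
      qed
      moreover have "?u [^]\<^bsub>?P\<^esub> (k::int) \<in> carrier ?P" for k
        using group.int_pow_closed[OF P uc] .
      ultimately have "carrier ?P = range (\<lambda>k::int. ?u [^]\<^bsub>?P\<^esub> k)" by blast
      then show ?thesis using group.cyclic_group[OF P] uc by blast
    qed
    then show False using nc isomorphic_group_cyclicity[OF iso is_group P] by simp
  qed
  obtain e where e: "independent_family G (length ns) (\<lambda>i. ns ! i) e"
    using independent_family_of_product_group[OF iso n2] by blast
  have "davenport G = 1 + (\<Sum>i<length ns. ns ! i - 1)"
    using D unfolding davenport_star_def ns_def[symmetric]
    by (simp add: sum_list_sum_nth atLeast0LessThan)
  moreover have "0 < length ns" "1 < length ns" using \<open>2 \<le> length ns\<close> by linarith+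
  ultimately show ?thesis using sum_linked_independent[OF e n2, of 0 1] dv[of 0] by simp
qed

end

section \<open>Automorphisms\<close>

context comm_group
begin

text \<open>
  Put \<open>e = g - f\<close>, so \<open>2 e = 0\<close>. As \<open>f\<close> and \<open>g\<close> are outside
  \<open>H\<close>, also \<open>f\<close> is outside the subgroup generated by \<open>H\<close> and
  \<open>e\<close>. A subgroup \<open>M\<close> that is maximal among those that contain \<open>H\<close> and
  \<open>e\<close> but not \<open>f\<close> has index two, because doubles lie in \<open>H\<close>. The map that
  fixes \<open>M\<close> and adds \<open>e\<close> outside \<open>M\<close> is an involution since
  \<open>e \<in> M\<close>.
\<close>

lemma automorphism_of_equal_squares:
  assumes fin: "finite (carrier G)" and H: "subgroup H G"
    and sq: "\<And>x. x \<in> carrier G \<Longrightarrow> x \<otimes> x \<in> H"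
    and f: "f \<in> carrier G" "f \<notin> H" and g: "g \<in> carrier G" "g \<notin> H" and eq: "f \<otimes> f = g \<otimes> g"
  shows "\<exists>\<phi>\<in>iso G G. \<phi> f = g"
proof -
  have Hc: "H \<subseteq> carrier G" by (rule subgroup.subset[OF H])
  define e where "e = inv f \<otimes> g"
  have ec: "e \<in> carrier G" using f g unfolding e_def by simp
  have fe: "f \<otimes> e = g" unfolding e_def using f g by (simp add: m_assoc[symmetric])
  have ee: "e \<otimes> e = \<one>"
  proof -
    have "e \<otimes> e = inv (f \<otimes> f) \<otimes> (g \<otimes> g)" unfolding e_def using f g by (simp add: m_ac inv_mult)
    then show ?thesis using eq g by simp
  qed
  define \<M> where "\<M> = {M. subgroup M G \<and> H \<subseteq> M \<and> e \<in> M \<and> f \<notin> M}"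
  have "adjoin H e \<in> \<M>"
  proof -
    note ad = adjoin_subgroup[OF fin H ec]
    have "f \<notin> adjoin H e"
    proof
      assume "f \<in> adjoin H e"
      then obtain h i where hi: "h \<in> H" "f = h \<otimes> e [^] (i::nat)" by (rule adjoinE)
      have hc: "h \<in> carrier G" using hi Hc by auto
      have "e [^] i = \<one> \<or> e [^] i = e" by (induction i) (use ec ee in auto)
      then show False
      proof
        assume "e [^] i = \<one>"
        then show False using hi hc f by simp
      next
        assume "e [^] i = e"
        then have "h \<otimes> e = f" using hi by simp
        have "g = (h \<otimes> e) \<otimes> e" using fe \<open>h \<otimes> e = f\<close> by simp
        then have "g = h" using hc ec ee by (simp add: m_assoc)
        then show False using g hi by simp
      qed
    qed
    then show ?thesis unfolding \<M>_def using ad by simp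
  qed
  moreover have finM: "finite \<M>"
  proof (rule finite_subset)
    show "\<M> \<subseteq> Pow (carrier G)" unfolding \<M>_def using subgroup.subset by auto
    show "finite (Pow (carrier G))" using fin by simp
  qed
  ultimately have "Max (card ` \<M>) \<in> card ` \<M>" by (intro Max_in) auto
  then obtain M where M: "M \<in> \<M>" "card M = Max (card ` \<M>)" by auto
  have maxM: "card M' \<le> card M" if "M' \<in> \<M>" for M' unfolding M(2) using that finM by simp
  have Ms: "subgroup M G" "H \<subseteq> M" "e \<in> M" "f \<notin> M" using M(1) unfolding \<M>_def by auto
  have Mc: "M \<subseteq> carrier G" by (rule subgroup.subset[OF Ms(1)])
  have coset: "\<exists>m\<in>M. z = m \<otimes> f" if z: "z \<in> carrier G" "z \<notin> M" for z
  proof -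
    note ad = adjoin_subgroup[OF fin Ms(1) z(1)]
    have "M \<subset> adjoin M z" using ad(2,3) z(2) by auto
    moreover have "finite (adjoin M z)" using subgroup.subset[OF ad(1)] fin finite_subset by auto
    ultimately have "card M < card (adjoin M z)" by (intro psubset_card_mono)
    then have "adjoin M z \<notin> \<M>" using maxM[of "adjoin M z"] by auto
    then have "f \<in> adjoin M z" using ad Ms unfolding \<M>_def by auto
    then obtain m i where mi: "m \<in> M" "f = m \<otimes> z [^] (i::nat)" by (rule adjoinE)
    have mc: "m \<in> carrier G" using mi Mc by auto
    have zz: "z \<otimes> z \<in> M" using sq[OF z(1)] Ms(2) by auto
    have "\<exists>m'\<in>M. z [^] i = m' \<or> z [^] i \<otimes> z = m'"
    proof (induction i)
      case 0 then show ?case using subgroup.one_closed[OF Ms(1)] by (intro bexI[of _ \<one>]) auto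
    next
      case (Suc i)
      then obtain m' where m': "m' \<in> M" "z [^] i = m' \<or> z [^] i \<otimes> z = m'" by blast
      show ?case
      proof (cases "z [^] i = m'")
        case True
        then have "z [^] Suc i \<otimes> z = m' \<otimes> (z \<otimes> z)" using z(1) by (simp add: m_assoc flip: True)
        then show ?thesis using subgroup.m_closed[OF Ms(1) m'(1) zz] by blast
      next
        case False
        then have "z [^] Suc i = m'" using m'(2) by simp
        then show ?thesis using m'(1) by blast
      qed
    qed
    then obtain m' where m': "m' \<in> M" "z [^] i = m' \<or> z [^] i \<otimes> z = m'" by blast
    have m'c: "m' \<in> carrier G" using m' Mc by auto
    have "z [^] i \<noteq> m'" using mi Ms(4) subgroup.m_closed[OF Ms(1) mi(1) m'(1)] by auto
    then have "z [^] i \<otimes> z = m'" using m'(2) by simp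
    then have "f \<otimes> z = m \<otimes> m'" using mi(2) mc z(1) by (simp add: m_assoc)
    then have fz: "f \<otimes> z \<in> M" using subgroup.m_closed[OF Ms(1) mi(1) m'(1)] by simp
    let ?q = "f \<otimes> f"
    have qc: "?q \<in> carrier G" using f(1) by simp
    have "inv ?q \<in> M" using subgroup.m_inv_closed[OF Ms(1)] sq[OF f(1)] Ms(2) by auto
    then have qM: "inv ?q \<otimes> (f \<otimes> z) \<in> M" using subgroup.m_closed[OF Ms(1)] fz by simp
    have "inv ?q \<otimes> (f \<otimes> z) \<otimes> f = inv ?q \<otimes> ((f \<otimes> z) \<otimes> f)"
      by (rule m_assoc) (use qc f(1) z(1) in auto)
    also have "(f \<otimes> z) \<otimes> f = ?q \<otimes> z" using f(1) z(1) by (simp add: m_ac)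
    also have "inv ?q \<otimes> (?q \<otimes> z) = inv ?q \<otimes> ?q \<otimes> z"
      by (rule m_assoc[symmetric]) (use qc z(1) in auto)
    also have "\<dots> = z" unfolding l_inv[OF qc] using z(1) by simp
    finally have "z = inv ?q \<otimes> (f \<otimes> z) \<otimes> f" by (rule sym)
    then show ?thesis using qM by (rule bexI)
  qed
  define \<phi> where "\<phi> z = (if z \<in> M then z else z \<otimes> e)" for z
  have mm: "a \<otimes> b \<in> M \<longleftrightarrow> b \<in> M" if "a \<in> M" "b \<in> carrier G" for a b
  proof
    assume "a \<otimes> b \<in> M"
    then have "inv a \<otimes> (a \<otimes> b) \<in> M" using subgroup.m_closed[OF Ms(1)] subgroup.m_inv_closed[OF Ms(1) that(1)] by simp
    moreover have "inv a \<otimes> (a \<otimes> b) = b" using that Mc by (simp add: m_assoc[symmetric] subset_eq)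
    ultimately show "b \<in> M" by simp
  next
    assume "b \<in> M" then show "a \<otimes> b \<in> M" using subgroup.m_closed[OF Ms(1) that(1)] by simp
  qed
  have nn: "a \<otimes> b \<in> M" if a: "a \<in> carrier G" "a \<notin> M" and b: "b \<in> carrier G" "b \<notin> M" for a b
  proof -
    obtain m m' where m: "m \<in> M" "a = m \<otimes> f" "m' \<in> M" "b = m' \<otimes> f" using coset[OF a] coset[OF b] by blast
    have "m \<in> carrier G" "m' \<in> carrier G" using m Mc by auto
    then have "a \<otimes> b = (m \<otimes> m') \<otimes> (f \<otimes> f)" using m f(1) by (simp add: m_ac)
    moreover have "f \<otimes> f \<in> M" using sq[OF f(1)] Ms(2) by auto
    ultimately show ?thesis using subgroup.m_closed[OF Ms(1)] m by simp
  qed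
  have \<phi>c: "\<phi> z \<in> carrier G" if "z \<in> carrier G" for z using that ec unfolding \<phi>_def by simp
  have ze: "z \<otimes> e \<in> M \<longleftrightarrow> z \<in> M" if "z \<in> carrier G" for z using mm[OF Ms(3) that] that ec by (simp add: m_comm)
  have inv: "\<phi> (\<phi> z) = z" if "z \<in> carrier G" for z
    using that ze[OF that] ec ee unfolding \<phi>_def by (simp add: m_assoc)
  have "\<phi> (a \<otimes> b) = \<phi> a \<otimes> \<phi> b" if ab: "a \<in> carrier G" "b \<in> carrier G" for a b
  proof (cases "a \<in> M"; cases "b \<in> M")
    assume "a \<in> M" "b \<in> M" then show ?thesis using mm[of a b] ab unfolding \<phi>_def by simp
  next
    assume "a \<in> M" "b \<notin> M" then show ?thesis using mm[of a b] ab ec unfolding \<phi>_def by (simp add: m_assoc)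
  next
    assume "a \<notin> M" "b \<in> M" then show ?thesis using mm[of b a] ab ec unfolding \<phi>_def by (simp add: m_ac)
  next
    assume n: "a \<notin> M" "b \<notin> M"
    have "(a \<otimes> e) \<otimes> (b \<otimes> e) = (a \<otimes> b) \<otimes> (e \<otimes> e)" using ab ec by (simp add: m_ac)
    then show ?thesis using nn[of a b] n ab ee unfolding \<phi>_def by simp
  qed
  then have hom: "\<phi> \<in> hom G G" using \<phi>c by (intro homI) auto
  have "bij_betw \<phi> (carrier G) (carrier G)"
    by (rule bij_betw_byWitness[of _ \<phi>]) (use inv \<phi>c in auto)
  then have "\<phi> \<in> iso G G" using hom unfolding iso_def by simp
  moreover have "\<phi> f = g" unfolding \<phi>_def using Ms(4) fe by simp
  ultimately show ?thesis by blast
qed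

text \<open>
  The inverse is multiplication by \<open>t + 1\<close> if the order is \<open>2 t + 1\<close>.
\<close>

lemma automorphism_doubling:
  assumes fin: "finite (carrier G)" and odd: "odd (order G)"
  shows "(\<lambda>x. x \<otimes> x) \<in> iso G G"
proof -
  have hom: "(\<lambda>x. x \<otimes> x) \<in> hom G G" by (intro homI) (auto simp: m_ac)
  obtain t where t: "order G = 2 * t + 1" using odd by (auto elim: oddE)
  have undo: "(x \<otimes> x) [^] (t + 1) = x" if "x \<in> carrier G" for x
  proof -
    have "(x \<otimes> x) [^] (t + 1) = (x [^] (2::nat)) [^] (t + 1)" using that by (simp add: numeral_2_eq_2)
    also have "\<dots> = x [^] (2 * (t + 1))" using that by (rule nat_pow_pow)
    also have "\<dots> = x [^] (order G + 1)" using t by simp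
    also have "\<dots> = x" using that pow_order_eq_1[OF that] by simp
    finally show ?thesis .
  qed
  have inj: "inj_on (\<lambda>x. x \<otimes> x) (carrier G)" by (rule inj_on_inverseI[where g = "\<lambda>y. y [^] (t + 1)"]) (rule undo)
  moreover have "(\<lambda>x. x \<otimes> x) ` carrier G = carrier G"
    by (rule endo_inj_surj[OF fin _ inj]) (intro image_subsetI m_closed)
  ultimately show ?thesis using hom unfolding iso_def bij_betw_def by simp
qed

lemma sum_linked_of_repeated_term:
  assumes fin: "finite (carrier G)" and odd: "odd (order G)"
    and U: "atom G U" "size U = davenport G" and rep: "\<not> squarefree_seq U"
  shows "sum_linked G"
proof -
  have "\<exists>g. 2 \<le> count U g"
  proof (rule ccontr)
    assume *: "\<not> ?thesis"
    have "count U g = 1" if "g \<in># U" for g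
    proof -
      have "\<not> 2 \<le> count U g" using * by blast
      moreover have "0 < count U g" using that by simp
      ultimately show ?thesis by linarith
    qed
    then have "size U = card (set_mset U)" unfolding size_multiset_overloaded_eq by simp
    then show False using rep unfolding squarefree_seq_def by simp
  qed
  then obtain g where g: "2 \<le> count U g" by blast
  have "replicate_mset 2 g \<subseteq># U" by (rule iffD1[OF count_le_replicate_mset_subset_eq g])
  then have gg: "{#g, g#} \<subseteq># U" by (simp add: numeral_2_eq_2)
  have "0 < count U g" using g by linarith
  then have "g \<in># U" by simp
  let ?d = "\<lambda>x. x \<otimes> x"
  have "atom G (image_mset ?d U)" by (rule atom_automorphism[OF automorphism_doubling[OF fin odd] U(1)])
  moreover have "g \<otimes> g \<in># image_mset ?d U" using \<open>g \<in># U\<close> by simp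
  moreover have "size (image_mset ?d U) = davenport G" using U(2) by simp
  ultimately show ?thesis unfolding sum_linked_def using U gg
    by (intro exI[of _ g] exI[of _ U] exI[of _ "image_mset ?d U"]) simp
qed

lemma sum_linked_of_odd_cyclic:
  assumes fin: "finite (carrier G)" and odd: "odd (order G)" and cyc: "cyclic_group G" and o3: "3 \<le> order G"
  shows "sum_linked G"
proof -
  obtain g where g: "g \<in> carrier G" "carrier G = range (\<lambda>n::int. g [^] n)" using cyc cyclic_group by auto
  have ord: "ord g = order G"
  proof -
    have "generate G {g} = carrier G" using g generate_pow[OF g(1)] by auto
    then show ?thesis using generate_pow_card[OF g(1)] unfolding order_def by simp
  qed
  let ?U = "replicate_mset (order G) g"
  have U: "atom G ?U"
    unfolding atom_def
  proof (intro conjI allI impI)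
    show "set_mset ?U \<subseteq> carrier G" using g by simp
    show "?U \<noteq> {#}" using o3 by auto
    show "seq_sum G ?U = \<one>" using seq_sum_replicate[OF g(1)] pow_order_eq_1[OF g(1)] by simp
    fix V assume V: "V \<subseteq># ?U \<and> seq_sum G V = \<one>"
    then obtain m where m: "m \<le> order G" "V = replicate_mset m g" by (metis msubseteq_replicate_msetE)
    then have "order G dvd m" using V seq_sum_replicate[OF g(1)] pow_eq_id[OF g(1)] ord by simp
    then have "m = 0 \<or> m = order G" using m(1) by (metis dvd_imp_le le_antisym not_gr0)
    then show "V = {#} \<or> V = ?U" using m by auto
  qed
  have "davenport G \<le> order G"
    using davenport_props(2)[OF fin] atom_size_le[OF subgroup_self fin] unfolding order_def atom_def by metis
  then have D: "size ?U = davenport G" using davenport_props(1)[OF fin U] by simp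
  have "\<not> squarefree_seq ?U" unfolding squarefree_seq_def using o3 by simp
  then show ?thesis by (rule sum_linked_of_repeated_term[OF fin odd U D])
qed

end

section \<open>Weighted binary codes of redundancy five\<close>

text \<open>
  The model is a set \<open>A\<close> of elements of a group, with \<open>x X\<close> the class of the sum over
  \<open>X\<close> in a quotient \<open>F\<close> of exponent two with at most \<open>2\<^sup>5\<close>
  elements; a codeword is a subset whose sum is trivial in \<open>F\<close>. The absence of codewords of size
  one and two says that the classes of the elements of \<open>A\<close> are nonzero and distinct.
\<close>

locale binary_code =
  fixes A :: "'a set" and C :: "'a set set" and x :: "'a set \<Rightarrow> 'b" and F :: "'b set"
  assumes finite_A: "finite A"
    and C_sub: "X \<in> C \<Longrightarrow> X \<subseteq> A"
    and A_in: "A \<in> C"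
    and finite_F: "finite F" and card_F: "card F \<le> 32"
    and x_in: "X \<subseteq> A \<Longrightarrow> x X \<in> F"
    and sym_diff_x: "X \<subseteq> A \<Longrightarrow> Y \<subseteq> A \<Longrightarrow> x X = x Y \<Longrightarrow> sym_diff X Y \<in> C"
    and sym_diff_in: "X \<in> C \<Longrightarrow> Y \<in> C \<Longrightarrow> sym_diff X Y \<in> C"
    and card_ge_3: "X \<in> C \<Longrightarrow> X \<noteq> {} \<Longrightarrow> 3 \<le> card X"
begin

lemma finite_in_C: "X \<in> C \<Longrightarrow> finite X"
  using C_sub finite_A finite_subset by blast

lemma empty_in: "{} \<in> C"
  using sym_diff_in[OF A_in A_in] by simp

lemma Un_in: assumes "X \<in> C" "Y \<in> C" "X \<inter> Y = {}" shows "X \<union> Y \<in> C"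
proof -
  have "sym_diff X Y = X \<union> Y" using assms(3) by blast
  then show ?thesis using sym_diff_in[OF assms(1,2)] by simp
qed

lemma Diff_in: assumes "X \<in> C" "Y \<in> C" "Y \<subseteq> X" shows "X - Y \<in> C"
proof -
  have "sym_diff X Y = X - Y" using assms(3) by blast
  then show ?thesis using sym_diff_in[OF assms(1,2)] by simp
qed

lemma pigeonhole:
  assumes "finite \<F>" "\<And>X. X \<in> \<F> \<Longrightarrow> X \<subseteq> A" "32 < card \<F>"
  obtains X Y where "X \<in> \<F>" "Y \<in> \<F>" "X \<noteq> Y" "sym_diff X Y \<in> C"
proof -
  have "x ` \<F> \<subseteq> F" using x_in assms(2) by auto
  then have "card (x ` \<F>) \<le> card F" by (rule card_mono[OF finite_F])
  then have "card (x ` \<F>) \<noteq> card \<F>" using card_F assms(3) by linarith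
  then have "\<not> inj_on x \<F>" using card_image by blast
  then obtain X Y where "X \<in> \<F>" "Y \<in> \<F>" "X \<noteq> Y" "x X = x Y" by (auto simp: inj_on_def)
  then show thesis using that[of X Y] sym_diff_x[of X Y] assms(2) by simp
qed

text \<open>
  The Davenport constant of \<open>C\<^sub>2\<^sup>5\<close> is 6: a set of size 6 has
  \<open>2\<^sup>6 > 32\<close> subsets, and two subsets with the same value differ by a codeword.
\<close>

lemma codeword_in_6:
  assumes "S \<subseteq> A" "6 \<le> card S"
  obtains X where "X \<in> C" "X \<noteq> {}" "X \<subseteq> S"
proof -
  have fS: "finite S" using assms(1) finite_A finite_subset by blast
  have "(2::nat) ^ 6 \<le> 2 ^ card S" using assms(2) by (rule power_increasing) simp
  also have "\<dots> = card (Pow S)" using fS by (simp add: card_Pow)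
  finally have 32: "32 < card (Pow S)" by simp
  have 1: "finite (Pow S)" using fS by simp
  have 2: "X \<subseteq> A" if "X \<in> Pow S" for X using that assms(1) by auto
  obtain X Y where XY: "X \<in> Pow S" "Y \<in> Pow S" "X \<noteq> Y" "sym_diff X Y \<in> C"
    by (rule pigeonhole[OF 1 2 32])
  have 1: "sym_diff X Y \<noteq> {}" using XY(3) by auto
  have 2: "sym_diff X Y \<subseteq> S" using XY(1,2) by auto
  show thesis by (rule that[OF XY(4) 1 2])
qed

text \<open>
  A set of size 8 has \<open>8 + 28 > 32\<close> subsets of size one or two, and two of them with the same value
  differ by a codeword of size at most 4.
\<close>

lemma short_codeword_in_8:
  assumes "S \<subseteq> A" "8 \<le> card S"
  obtains X where "X \<in> C" "X \<noteq> {}" "X \<subseteq> S" "card X \<le> 4"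
proof -
  have "finite S" using assms(1) finite_A finite_subset by blast
  obtain S' where S': "S' \<subseteq> S" "card S' = 8" "finite S'"
    using obtain_subset_with_card_n[OF assms(2)] by blast
  define \<F> where "\<F> n = {K. K \<subseteq> S' \<and> card K = n}" for n
  have fin: "finite (\<F> n)" for n unfolding \<F>_def using S'(3) by simp
  have "card (\<F> 1 \<union> \<F> 2) = card (\<F> 1) + card (\<F> 2)"
    by (rule card_Un_disjoint) (use fin in \<open>auto simp: \<F>_def\<close>)
  also have "\<dots> = 36" unfolding \<F>_def using S' by (simp add: n_subsets choose_two)
  finally have 36: "32 < card (\<F> 1 \<union> \<F> 2)" by simp
  have 1: "finite (\<F> 1 \<union> \<F> 2)" using fin by simp
  have 2: "X \<subseteq> A" if "X \<in> \<F> 1 \<union> \<F> 2" for X using that S'(1) assms(1) by (auto simp: \<F>_def)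
  obtain X Y where XY: "X \<in> \<F> 1 \<union> \<F> 2" "Y \<in> \<F> 1 \<union> \<F> 2" "X \<noteq> Y" "sym_diff X Y \<in> C"
    by (rule pigeonhole[OF 1 2 36])
  have sub: "X \<subseteq> S'" "Y \<subseteq> S'" and le2: "card X \<le> 2" "card Y \<le> 2"
    using XY(1,2) unfolding \<F>_def by auto
  have fXY: "finite X" "finite Y" using sub S'(3) by (simp_all add: finite_subset)
  have "card (sym_diff X Y) \<le> card (X - Y) + card (Y - X)" by (rule card_Un_le)
  also have "\<dots> \<le> card X + card Y"
    using fXY by (intro add_mono card_mono) auto
  also have "\<dots> \<le> 4" using le2 by simp
  finally have 4: "card (sym_diff X Y) \<le> 4" .
  have 1: "sym_diff X Y \<noteq> {}" using XY(3) by auto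
  have 2: "sym_diff X Y \<subseteq> S" using sub S'(1) by auto
  show thesis by (rule that[OF XY(4) 1 2 4])
qed

lemma card_minimal_le_6:
  assumes "B \<in> C" "\<And>X. X \<in> C \<Longrightarrow> X \<subset> B \<Longrightarrow> X = {}"
  shows "card B \<le> 6"
proof (rule ccontr)
  assume "\<not> card B \<le> 6"
  then have "7 \<le> card B" by simp
  then obtain S where S: "S \<subseteq> B" "card S = 6" 
    using obtain_subset_with_card_n[of 6 B] by auto
  have "S \<subseteq> A" using S(1) C_sub[OF assms(1)] by simp
  then obtain X where X: "X \<in> C" "X \<noteq> {}" "X \<subseteq> S"
    by (rule codeword_in_6) (use S in auto)
  have "S \<noteq> B" using S \<open>7 \<le> card B\<close> by auto
  then have "X \<subset> B" using X(3) S(1) by auto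
  then show False using assms(2)[OF X(1)] X(2) by simp
qed

definition partitions :: "'a set \<Rightarrow> 'a set set set" where
  "partitions V = {P. P \<subseteq> C \<and> {} \<notin> P \<and> disjoint P \<and> \<Union>P = V}"

lemma partitions_finite: assumes "P \<in> partitions V" "finite V" shows "finite P"
  using assms unfolding partitions_def by (auto intro: finite_UnionD)

lemma partitions_insert:
  assumes "P \<in> partitions V" "X \<in> C" "X \<noteq> {}" "X \<inter> V = {}"
  shows "insert X P \<in> partitions (X \<union> V)" "X \<notin> P"
proof -
  show "X \<notin> P" using assms unfolding partitions_def by auto
  show "insert X P \<in> partitions (X \<union> V)" using assms unfolding partitions_def disjoint_def by auto
qed

text \<open>
  A codeword of size at least 7 contains a proper one by \<open>codeword_in_6\<close>; a longer codeword first
  loses codewords of size at most 4.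
\<close>

lemma split_many:
  "V \<in> C \<Longrightarrow> 4 * m + 3 \<le> card V \<Longrightarrow> \<exists>R \<in> partitions V. card R = m + 1"
proof (induction m arbitrary: V)
  case 0
  then have "V \<noteq> {}" by auto
  then have "{V} \<in> partitions V" using 0 by (auto simp: partitions_def disjoint_def)
  then show ?case by (intro bexI[of _ "{V}"]) auto
next
  case (Suc m)
  have fV: "finite V" and VA: "V \<subseteq> A" using finite_in_C C_sub Suc.prems by auto
  have "\<exists>X\<in>C. X \<noteq> {} \<and> X \<subseteq> V \<and> 4 * m + 3 \<le> card (V - X)"
  proof (cases "m = 0")
    case True
    then have "7 \<le> card V" using Suc.prems by simp
    then obtain S where S: "S \<subseteq> V" "card S = 6" using obtain_subset_with_card_n[of 6 V] by auto
    then have "S \<subseteq> A" using VA by simp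
    then obtain X where X: "X \<in> C" "X \<noteq> {}" "X \<subseteq> S" by (rule codeword_in_6) (use S in auto)
    have XV: "X \<subseteq> V" using X S by simp
    have "card X \<le> 6" using X(3) S card_mono[of S X] fV finite_subset[of S V] by auto
    then have "X \<noteq> V" using \<open>7 \<le> card V\<close> by auto
    then have "V - X \<noteq> {}" using XV by auto
    then have "3 \<le> card (V - X)" using card_ge_3 Diff_in[OF Suc.prems(1) X(1) XV] by simp
    then show ?thesis using X XV True by (intro bexI[of _ X]) auto
  next
    case False
    then have "8 \<le> card V" using Suc.prems by simp
    then obtain X where X: "X \<in> C" "X \<noteq> {}" "X \<subseteq> V" "card X \<le> 4"
      by (rule short_codeword_in_8[OF VA])
    then have "4 * m + 3 \<le> card (V - X)"
      using Suc.prems finite_in_C[OF X(1)] by (simp add: card_Diff_subset)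
    then show ?thesis using X by blast
  qed
  then obtain X where X: "X \<in> C" "X \<noteq> {}" "X \<subseteq> V" "4 * m + 3 \<le> card (V - X)" by blast
  obtain R where R: "R \<in> partitions (V - X)" "card R = m + 1"
    using Suc.IH[OF Diff_in[OF Suc.prems(1) X(1,3)] X(4)] by blast
  have "finite R" using partitions_finite[OF R(1)] fV by simp
  moreover have "X \<union> (V - X) = V" using X(3) by auto
  ultimately show ?case using partitions_insert[OF R(1) X(1,2)] R(2)
    by (intro bexI[of _ "insert X R"]) auto
qed

end

text \<open>
  In the model, the sum over a codeword \<open>X\<close> is \<open>j X\<close> times a fixed element
  \<open>c\<close>. By the last assumption, \<open>j X + j Y - j (sym_diff X Y)\<close> depends on
  \<open>X \<inter> Y\<close> only; in the model, this number times \<open>c\<close> is twice the sum over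
  \<open>X \<inter> Y\<close>. Additivity on disjoint codewords is the special case of an empty intersection.
\<close>

locale weighted_code = binary_code A C x F
  for A :: "'a set" and C :: "'a set set" and x :: "'a set \<Rightarrow> 'b" and F :: "'b set" +
  fixes j :: "'a set \<Rightarrow> nat"
  assumes j_pos: "X \<in> C \<Longrightarrow> X \<noteq> {} \<Longrightarrow> 1 \<le> j X"
    and j_empty: "j {} = 0"
    and j_inter: "\<lbrakk>X \<in> C; Y \<in> C; X' \<in> C; Y' \<in> C; X \<inter> Y = X' \<inter> Y'\<rbrakk> \<Longrightarrow>
          j X + j Y + j (sym_diff X' Y') = j X' + j Y' + j (sym_diff X Y)"
begin

lemma j_Un: assumes "X \<in> C" "Y \<in> C" "X \<inter> Y = {}" shows "j (X \<union> Y) = j X + j Y"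
proof -
  have "sym_diff X Y = X \<union> Y" using assms(3) by blast
  then show ?thesis using j_inter[OF assms(1,2) empty_in empty_in] assms(3) j_empty by simp
qed

lemma j_Diff: assumes "X \<in> C" "Y \<in> C" "Y \<subseteq> X" shows "j Y + j (X - Y) = j X"
proof -
  have "X = Y \<union> (X - Y)" using assms(3) by blast
  then show ?thesis using j_Un[OF assms(2) Diff_in[OF assms]] by auto
qed

lemma j_mono_strict: assumes "X \<in> C" "Y \<in> C" "Y \<subset> X" shows "j Y < j X"
proof -
  have "X - Y \<noteq> {}" using assms(3) by blast
  then have "1 \<le> j (X - Y)" using j_pos Diff_in[OF assms(1,2)] assms(3) by blast
  then show ?thesis using j_Diff[OF assms(1,2)] assms(3) by force
qed

lemma unit_minimal:
  assumes "B \<in> C" "j B = 1" "X \<in> C" "X \<subset> B"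
  shows "X = {}"
proof (rule ccontr)
  assume "X \<noteq> {}"
  then show False using j_mono_strict[OF assms(1,3,4)] j_pos[OF assms(3)] assms(2) by linarith
qed

text \<open>
  In the model, the two elements \<open>p\<close>, \<open>q\<close> of \<open>X \<inter> Y\<close> satisfy
  \<open>2 (p + q) = c\<close>. The lemmas below show that codewords of weight one (units) that are too long or
  too many produce such a pair.
\<close>

definition unit_pair :: bool where
  "unit_pair \<longleftrightarrow> (\<exists>X \<in> C. \<exists>Y \<in> C. card (X \<inter> Y) = 2 \<and> j X + j Y = j (sym_diff X Y) + 1)"

text \<open>
  If adding \<open>B\<close> does not change the weight of \<open>K\<close>, then the doubled weight of
  \<open>K \<inter> B\<close> is the weight of \<open>B\<close>, and likewise for \<open>B - K\<close>.
\<close>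

lemma unit_pairI:
  assumes "B \<in> C" "j B = 1" "K \<in> C" "j (sym_diff B K) = j K"
    and "card (K \<inter> B) = 2 \<or> card (B - K) = 2"
  shows unit_pair
  using assms(5)
proof
  assume "card (K \<inter> B) = 2"
  then have "card (B \<inter> K) = 2" by (simp add: Int_commute)
  then show ?thesis using assms unfolding unit_pair_def by (intro bexI[of _ B] bexI[of _ K]) auto
next
  assume *: "card (B - K) = 2"
  have "B \<inter> sym_diff B K = B - K" by auto
  moreover have "sym_diff B (sym_diff B K) = K" by auto
  ultimately show ?thesis using assms * unfolding unit_pair_def
    by (intro bexI[of _ B] bexI[of _ "sym_diff B K"]) (auto simp: sym_diff_in)
qed

text \<open>
  Let two disjoint units be linked by a codeword \<open>K\<close> in their union. As the union has weight two,
  every proper nonempty codeword in it has weight one. So each part into which \<open>K\<close> cuts the two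
  units has doubled weight one, and it remains to find such a part of size two.
\<close>

lemma linked_units:
  assumes B: "B1 \<in> C" "j B1 = 1" "B2 \<in> C" "j B2 = 1" "B1 \<inter> B2 = {}"
    and K: "K \<in> C" "K \<subseteq> B1 \<union> B2" "K \<noteq> {}" "\<not> B1 \<subseteq> K" "\<not> B2 \<subseteq> K"
  shows "j K = 1" "K \<inter> B1 \<noteq> {}" "K \<inter> B2 \<noteq> {}"
    "j (sym_diff B1 K) = 1" "j (sym_diff B2 K) = 1" 
proof -
  have one: "j L = 1" if L: "L \<in> C" "L \<subset> B1 \<union> B2" "L \<noteq> {}" for L
  proof -
    have "j L < 2" using j_mono_strict[OF Un_in L(1,2)] j_Un B by simp
    then show ?thesis using j_pos[OF L(1,3)] by simp
  qed
  have "K \<subset> B1 \<union> B2" using K(2,4) by auto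
  then show "j K = 1" using one[OF K(1)] K(3) by simp
  show 1: "K \<inter> B1 \<noteq> {}"
  proof
    assume "K \<inter> B1 = {}"
    then have "K \<subset> B2" using K(2,5) by auto
    then show False using unit_minimal[OF B(3,4) K(1)] K(3) by simp
  qed
  show 2: "K \<inter> B2 \<noteq> {}"
  proof
    assume "K \<inter> B2 = {}"
    then have "K \<subset> B1" using K(2,4) by auto
    then show False using unit_minimal[OF B(1,2) K(1)] K(3) by simp
  qed
  have "sym_diff B1 K \<subset> B1 \<union> B2" "sym_diff B1 K \<noteq> {}" "sym_diff B2 K \<subset> B1 \<union> B2" "sym_diff B2 K \<noteq> {}"
    using 1 2 K(2,4,5) B(5) by auto
  then show "j (sym_diff B1 K) = 1" "j (sym_diff B2 K) = 1"
    using one[OF sym_diff_in[OF B(1) K(1)]] one[OF sym_diff_in[OF B(3) K(1)]] by simp_all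
qed

lemma linked_units_good:
  assumes B: "B1 \<in> C" "j B1 = 1" "B2 \<in> C" "j B2 = 1" "B1 \<inter> B2 = {}"
    and K: "K \<in> C" "K \<subseteq> B1 \<union> B2" "K \<noteq> {}" "\<not> B1 \<subseteq> K" "\<not> B2 \<subseteq> K"
    and two: "card (K \<inter> B1) = 2 \<or> card (B1 - K) = 2 \<or> card (K \<inter> B2) = 2 \<or> card (B2 - K) = 2"
  shows unit_pair
proof -
  note L = linked_units[OF B K]
  show ?thesis using two unit_pairI[OF B(1,2) K(1)] unit_pairI[OF B(3,4) K(1)] L by auto
qed

lemma unit_card: assumes "B \<in> C" "j B = 1" shows "3 \<le> card B" "card B \<le> 6" "finite B" "B \<noteq> {}"
proof -
  show "B \<noteq> {}" using assms j_empty by auto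
  then show "3 \<le> card B" using card_ge_3 assms by blast
  show "card B \<le> 6" using card_minimal_le_6 unit_minimal assms by blast
  show "finite B" using finite_in_C assms by blast
qed

text \<open>
  A minimal codeword of size 6 spans the whole space, so every element \<open>q\<close> of the other unit lies
  in a link that meets \<open>B2\<close> in \<open>q\<close> only. The symmetric difference of two such links
  meets \<open>B2\<close> in a pair.
\<close>

lemma two_units_6:
  assumes B: "B1 \<in> C" "j B1 = 1" "B2 \<in> C" "j B2 = 1" "B1 \<inter> B2 = {}" and c: "card B1 = 6"
  shows unit_pair
proof -
  note u1 = unit_card[OF B(1,2)] and u2 = unit_card[OF B(3,4)]
  obtain b where b: "b \<in> B1" using u1 by blast
  have sub: "B1 \<subseteq> A" "B2 \<subseteq> A" using C_sub B by auto
  have ex: "\<exists>K\<in>C. q \<in> K \<and> K \<subseteq> insert q (B1 - {b})" if q: "q \<in> B2" for q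
  proof -
    have "card (insert q (B1 - {b})) = 6" using q b c u1 B(5) by (subst card_insert_disjoint) auto
    then obtain K where K: "K \<in> C" "K \<noteq> {}" "K \<subseteq> insert q (B1 - {b})"
      using codeword_in_6[of "insert q (B1 - {b})"] sub q by auto
    have "q \<in> K"
    proof (rule ccontr)
      assume "q \<notin> K"
      then have "K \<subset> B1" using K b by blast
      then show False using unit_minimal[OF B(1,2) K(1)] K by blast
    qed
    then show ?thesis using K by blast
  qed
  obtain S where S: "S \<subseteq> B2" "card S = 2" using obtain_subset_with_card_n[of 2 B2] u2(1) by auto
  then obtain q1 q2 where q: "S = {q1,q2}" "q1 \<noteq> q2" by (auto simp: card_2_iff)
  obtain K1 K2 where K1: "K1 \<in> C" "q1 \<in> K1" "K1 \<subseteq> insert q1 (B1 - {b})"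
    and K2: "K2 \<in> C" "q2 \<in> K2" "K2 \<subseteq> insert q2 (B1 - {b})" using ex[of q1] ex[of q2] q S by blast
  define K where "K = sym_diff K1 K2"
  have KB2: "K \<inter> B2 = {q1,q2}" using K1(2,3) K2(2,3) q S(1) B(5) unfolding K_def by auto
  have nB2: "\<not> B2 \<subseteq> K"
  proof
    assume "B2 \<subseteq> K"
    then have "B2 = {q1,q2}" using KB2 by auto
    then show False using u2(1) q S by simp
  qed
  have "b \<notin> K1" "b \<notin> K2" using b K1(3) K2(3) S q(1) B(5) by auto
  then have nB1: "\<not> B1 \<subseteq> K" using b unfolding K_def by auto
  have KU: "K \<subseteq> B1 \<union> B2" using K1(3) K2(3) q(1) S(1) unfolding K_def by auto
  have KC: "K \<in> C" unfolding K_def by (rule sym_diff_in[OF K1(1) K2(1)])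
  have K0: "K \<noteq> {}" using KB2 by auto
  have "card (K \<inter> B2) = 2" using KB2 S q by simp
  then show ?thesis using linked_units_good[OF B KC KU K0 nB1 nB2] by simp
qed

text \<open>
  Two disjoint units of total size at least 8 are linked by \<open>codeword_in_6\<close>. For sizes up to 5, a
  cut without a part of size two isolates a single element in both units; these two elements would form a
  codeword of size two.
\<close>

lemma two_units:
  assumes B: "B1 \<in> C" "j B1 = 1" "B2 \<in> C" "j B2 = 1" "B1 \<inter> B2 = {}" and c: "8 \<le> card B1 + card B2"
  shows unit_pair
proof (cases "card B1 = 6 \<or> card B2 = 6")
  case True
  moreover have "B2 \<inter> B1 = {}" using B(5) by auto
  ultimately show ?thesis using two_units_6[OF B] two_units_6[OF B(3,4,1,2)] by auto
next
  case False
  note u1 = unit_card[OF B(1,2)] and u2 = unit_card[OF B(3,4)]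
  obtain b1 where b1: "b1 \<in> B1" using u1 by blast
  obtain b2 where b2: "b2 \<in> B2" using u2 by blast
  let ?S = "(B1 - {b1}) \<union> (B2 - {b2})"
  have "card ?S = card (B1 - {b1}) + card (B2 - {b2})"
    by (rule card_Un_disjoint) (use u1 u2 B(5) in auto)
  then have 6: "6 \<le> card ?S" using c b1 b2 u1 u2 by simp
  have "?S \<subseteq> A" using C_sub[OF B(1)] C_sub[OF B(3)] by auto
  then obtain K where K: "K \<in> C" "K \<noteq> {}" "K \<subseteq> ?S" by (rule codeword_in_6[OF _ 6])
  have K': "K \<subseteq> B1 \<union> B2" "\<not> B1 \<subseteq> K" "\<not> B2 \<subseteq> K" using K(3) b1 b2 B(5) by auto
  note L = linked_units[OF B K(1) K'(1) K(2) K'(2,3)]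
  have s1: "card B1 = card (K \<inter> B1) + card (B1 - K)"
    using card_Int_Diff[OF u1(3), of K] by (simp add: Int_commute)
  have s2: "card B2 = card (K \<inter> B2) + card (B2 - K)"
    using card_Int_Diff[OF u2(3), of K] by (simp add: Int_commute)
  have pos: "1 \<le> card (K \<inter> B1)" "1 \<le> card (B1 - K)" "1 \<le> card (K \<inter> B2)" "1 \<le> card (B2 - K)"
    using L(2,3) K'(2,3) u1(3) u2(3) by (auto simp: Suc_le_eq card_gt_0_iff)
  show ?thesis
  proof (rule ccontr)
    assume ng: "\<not> unit_pair"
    then have no2: "card (K \<inter> B1) \<noteq> 2" "card (B1 - K) \<noteq> 2" "card (K \<inter> B2) \<noteq> 2" "card (B2 - K) \<noteq> 2"
      using linked_units_good[OF B K(1) K'(1) K(2) K'(2,3)] by blast+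
    have le: "card B1 \<le> 5" "card B2 \<le> 5" using u1 u2 False by auto
    have d1: "card (K \<inter> B1) = 1 \<or> card (B1 - K) = 1"  using le no2 pos s1 by linarith
    have d2: "card (K \<inter> B2) = 1 \<or> card (B2 - K) = 1"  using le no2 pos s2 by linarith
    have ex: "\<exists>L\<in>C. card L = 2 \<and> L \<noteq> {}"
      if "card I = 1" "card J = 1" "I \<union> J \<in> C" "I \<inter> J = {}" for I J
      using that by (intro bexI[of _ "I \<union> J"]) (auto simp: card_1_singleton_iff)
    have KC: "sym_diff B1 K \<in> C" "sym_diff B2 K \<in> C" "sym_diff B1 (sym_diff B2 K) \<in> C"
    using sym_diff_in[OF B(1) K(1)] sym_diff_in[OF B(3) K(1)] sym_diff_in[OF B(1) sym_diff_in[OF B(3) K(1)]]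
    by simp_all
    have e: "(K \<inter> B1) \<union> (K \<inter> B2) = K" "(B1 - K) \<union> (K \<inter> B2) = sym_diff B1 K"
       "(K \<inter> B1) \<union> (B2 - K) = sym_diff B2 K" "(B1 - K) \<union> (B2 - K) = sym_diff B1 (sym_diff B2 K)"
      using K'(1) B(5) by auto
    have dj: "(K \<inter> B1) \<inter> (K \<inter> B2) = {}" "(B1 - K) \<inter> (K \<inter> B2) = {}" "(K \<inter> B1) \<inter> (B2 - K) = {}"
      "(B1 - K) \<inter> (B2 - K) = {}" using B(5) by auto
    have "\<exists>L\<in>C. card L = 2 \<and> L \<noteq> {}"
      using d1 d2 ex[of "K \<inter> B1" "K \<inter> B2", OF _ _ _ dj(1)] ex[of "B1 - K" "K \<inter> B2", OF _ _ _ dj(2)]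
        ex[of "K \<inter> B1" "B2 - K", OF _ _ _ dj(3)] ex[of "B1 - K" "B2 - K", OF _ _ _ dj(4)]
      unfolding e using KC K(1) by satx
    then obtain L where "L \<in> C" "card L = 2" "L \<noteq> {}" by blast
    then show False using card_ge_3[of L] by simp
  qed
qed

lemma two_units_linked_triple:
  assumes B: "B1 \<in> C" "j B1 = 1" "B2 \<in> C" "j B2 = 1" "B1 \<inter> B2 = {}" and c: "card B1 = 3"
    and K: "K \<in> C" "K \<subseteq> B1 \<union> B2" "K \<noteq> {}" "\<not> B1 \<subseteq> K" "\<not> B2 \<subseteq> K"
  shows unit_pair
proof -
  note L = linked_units[OF B K] and u1 = unit_card[OF B(1,2)]
  have s1: "card B1 = card (K \<inter> B1) + card (B1 - K)"
    using card_Int_Diff[OF u1(3), of K] by (simp add: Int_commute)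
  have "1 \<le> card (K \<inter> B1)" "1 \<le> card (B1 - K)" 
    using L(2) K(4) u1(3) by (auto simp: Suc_le_eq card_gt_0_iff)
  then have "card (K \<inter> B1) = 2 \<or> card (B1 - K) = 2" using s1 c by linarith
  then show ?thesis using linked_units_good[OF B K] by blast
qed

text \<open>
  Two triples need not be linked, but three units are. In the model, their spans have dimensions 2, 2 and at
  least 2 in a space of dimension 5. If a link \<open>K\<close> of the three meets only two of them, it cuts a
  triple into parts of size one and two. If \<open>K\<close> meets all three, every codeword obtained from
  \<open>K\<close> by adding some of the units has weight one or two. Without a unit pair, adding
  \<open>B1\<close> must change the weight of \<open>K\<close>, and likewise for \<open>B2\<close>. But adding
  \<open>B1\<close> changes the weights of \<open>K\<close> and of \<open>sym_diff B2 K\<close> by the same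
  amount, although these weights differ and are both one or two; so one of the two changes leads out of this
  range.
\<close>

lemma three_units:
  assumes B: "B1 \<in> C" "j B1 = 1" "B2 \<in> C" "j B2 = 1" "B3 \<in> C" "j B3 = 1"
    and d: "B1 \<inter> B2 = {}" "B1 \<inter> B3 = {}" "B2 \<inter> B3 = {}"
    and c: "card B1 = 3" "card B2 = 3"
  shows unit_pair
proof (rule ccontr)
  assume ng: "\<not> unit_pair"
  note u1 = unit_card[OF B(1,2)] and u2 = unit_card[OF B(3,4)] and u3 = unit_card[OF B(5,6)]
  obtain b1 b2 b3 where b: "b1 \<in> B1" "b2 \<in> B2" "b3 \<in> B3" using u1 u2 u3 by blast
  let ?S = "(B1 - {b1}) \<union> (B2 - {b2}) \<union> (B3 - {b3})"
  have "card ?S = card (B1 - {b1}) + card (B2 - {b2}) + card (B3 - {b3})"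
    by (subst card_Un_disjoint, (use u1 u2 u3 d in auto)[3], subst card_Un_disjoint) (use u1 u2 u3 d in auto)
  then have 6: "6 \<le> card ?S" using c b u1 u2 u3 by simp
  have "?S \<subseteq> A" using C_sub[OF B(1)] C_sub[OF B(3)] C_sub[OF B(5)] by auto
  then obtain K where K: "K \<in> C" "K \<noteq> {}" "K \<subseteq> ?S" by (rule codeword_in_6[OF _ 6])
  have K': "K \<subseteq> B1 \<union> B2 \<union> B3" using K(3) by auto
  have "b1 \<notin> K" "b2 \<notin> K" "b3 \<notin> K" using K(3) b d by auto
  then have K': "K \<subseteq> B1 \<union> B2 \<union> B3" "\<not> B1 \<subseteq> K" "\<not> B2 \<subseteq> K" "\<not> B3 \<subseteq> K" using K' b by auto
  have n1: "K \<inter> B1 \<noteq> {}"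
    using two_units_linked_triple[OF B(3,4,5,6) d(3) c(2) K(1) _ K(2) K'(3,4)] ng K'(1) by auto
  have n2: "K \<inter> B2 \<noteq> {}"
    using two_units_linked_triple[OF B(1,2,5,6) d(2) c(1) K(1) _ K(2) K'(2,4)] ng K'(1) by auto
  have n3: "K \<inter> B3 \<noteq> {}"
    using two_units_linked_triple[OF B(1-4) d(1) c(1) K(1) _ K(2) K'(2,3)] ng K'(1) by auto
  let ?V = "B1 \<union> B2 \<union> B3"
  have d3: "(B1 \<union> B2) \<inter> B3 = {}" using d by auto
  have VC: "?V \<in> C" and jV: "j ?V = 3"
    using Un_in[OF Un_in[OF B(1,3) d(1)] B(5) d3] j_Un[OF Un_in[OF B(1,3) d(1)] B(5) d3] j_Un[OF B(1,3) d(1)] B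
    by simp_all
  have val: "j L = 1 \<or> j L = 2" if "L \<in> C" "L \<subset> ?V" "L \<noteq> {}" for L
    using j_mono_strict[OF VC that(1,2)] j_pos[OF that(1,3)] jV by linarith
  have KC: "sym_diff B1 K \<in> C" "sym_diff B2 K \<in> C" "sym_diff B1 (sym_diff B2 K) \<in> C"
    using sym_diff_in[OF B(1) K(1)] sym_diff_in[OF B(3) K(1)] sym_diff_in[OF B(1) sym_diff_in[OF B(3) K(1)]]
    by simp_all
  have flip: "j (sym_diff Bi L) \<noteq> j L" 
    if Bi: "Bi \<in> C" "j Bi = 1" "card Bi = 3" "L \<in> C" "\<not> Bi \<subseteq> L" "L \<inter> Bi \<noteq> {}" for Bi L
  proof
    assume eq: "j (sym_diff Bi L) = j L"
    have f: "finite Bi" using finite_in_C Bi by blast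
    have "card Bi = card (L \<inter> Bi) + card (Bi - L)"
      using card_Int_Diff[OF f, of L] by (simp add: Int_commute)
    moreover have "1 \<le> card (L \<inter> Bi)" "1 \<le> card (Bi - L)" 
      using Bi(5,6) f by (auto simp: Suc_le_eq card_gt_0_iff)
    ultimately have "card (L \<inter> Bi) = 2 \<or> card (Bi - L) = 2" using Bi(3) by linarith
    then show False using unit_pairI[OF Bi(1,2,4) eq] ng by blast
  qed
  have f1: "j (sym_diff B1 K) \<noteq> j K" using flip[OF B(1,2) c(1) K(1) K'(2) n1] .
  have f2: "j (sym_diff B2 K) \<noteq> j K" using flip[OF B(3,4) c(2) K(1) K'(3) n2] .
  have "B1 \<inter> K = B1 \<inter> sym_diff B2 K" using d(1) by auto
  from j_inter[OF B(1) K(1) B(1) KC(2) this]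
  have e: "j K + j (sym_diff B1 (sym_diff B2 K)) = j (sym_diff B2 K) + j (sym_diff B1 K)" by simp
  have psub: "K \<subset> ?V" "sym_diff B1 K \<subset> ?V" "sym_diff B2 K \<subset> ?V" "sym_diff B1 (sym_diff B2 K) \<subset> ?V"
    "K \<noteq> {}" "sym_diff B1 K \<noteq> {}" "sym_diff B2 K \<noteq> {}" "sym_diff B1 (sym_diff B2 K) \<noteq> {}"
    using K' n1 n2 n3 d by auto
  have "j K = 1 \<or> j K = 2" "j (sym_diff B1 K) = 1 \<or> j (sym_diff B1 K) = 2"
    "j (sym_diff B2 K) = 1 \<or> j (sym_diff B2 K) = 2"
    "j (sym_diff B1 (sym_diff B2 K)) = 1 \<or> j (sym_diff B1 (sym_diff B2 K)) = 2"
    using val[OF K(1)] val[OF KC(1)] val[OF KC(2)] val[OF KC(3)] psub by auto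
  then show False using e f1 f2 by auto
qed

text \<open>
  A minimal codeword \<open>D\<close> of weight two and size at least 5 is linked with a triple \<open>B\<close>
  of weight one. Their union has weight three, and it can be divided in another way into two codewords of size
  at least 4. One of these has weight one, and together with \<open>E\<close> it is a pair of disjoint units of
  total size at least 8.
\<close>

lemma relink:
  assumes C: "D \<in> C" "j D = 2" "5 \<le> card D" "\<And>X. X \<in> C \<Longrightarrow> X \<subset> D \<Longrightarrow> X = {}"
    and B: "B \<in> C" "j B = 1" "card B = 3" and E: "E \<in> C" "j E = 1" "4 \<le> card E"
    and d: "D \<inter> B = {}" "D \<inter> E = {}" "B \<inter> E = {}"
  shows unit_pair
proof -
  note uB = unit_card[OF B(1,2)]
  have fD: "finite D" using finite_in_C C by blast
  have D0: "D \<noteq> {}" using C by auto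
  obtain c0 b0 where b: "c0 \<in> D" "b0 \<in> B" using uB D0 by blast
  let ?S = "(D - {c0}) \<union> (B - {b0})"
  have "card ?S = card (D - {c0}) + card (B - {b0})"
    by (rule card_Un_disjoint) (use uB fD d in auto)
  then have 6: "6 \<le> card ?S" using C B b fD uB by simp
  have "?S \<subseteq> A" using C_sub[OF C(1)] C_sub[OF B(1)] by auto
  then obtain K where K: "K \<in> C" "K \<noteq> {}" "K \<subseteq> ?S" by (rule codeword_in_6[OF _ 6])
  have K': "K \<subseteq> D \<union> B" "\<not> D \<subseteq> K" "\<not> B \<subseteq> K" using K(3) b d(1) by auto
  have nB: "K \<inter> B \<noteq> {}"
  proof
    assume "K \<inter> B = {}"
    then have "K \<subset> D" using K' by auto
    then show False using C(4)[OF K(1)] K(2) by simp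
  qed
  have nD: "K \<inter> D \<noteq> {}"
  proof
    assume "K \<inter> D = {}"
    then have "K \<subset> B" using K' by auto
    then show False using unit_minimal[OF B(1,2) K(1)] K(2) by simp
  qed
  define V where "V = D \<union> B"
  have VC: "V \<in> C" "j V = 3" unfolding V_def using Un_in[OF C(1) B(1) d(1)] j_Un[OF C(1) B(1) d(1)] C B by auto
  have split: unit_pair if X: "X \<in> C" "X \<subset> V" "4 \<le> card X" "4 \<le> card (V - X)" for X
  proof -
    have VX: "V - X \<in> C" using Diff_in[OF VC(1) X(1)] X by blast
    have ne: "X \<noteq> {}" "V - X \<noteq> {}" using X by auto
    have "j X + j (V - X) = 3" using j_Diff[OF VC(1) X(1)] X VC by auto
    moreover have "1 \<le> j X" "1 \<le> j (V - X)" using j_pos X(1) VX ne by auto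
    ultimately have "j X = 1 \<or> j (V - X) = 1" by linarith
    moreover have XE: "X \<inter> E = {}" "(V - X) \<inter> E = {}" using X(2) d(2,3) unfolding V_def by auto
    have ge8: "8 \<le> card X + card E" "8 \<le> card (V - X) + card E" using X(3,4) E(3) by simp_all
    ultimately show ?thesis
      using two_units[OF X(1) _ E(1,2) XE(1) ge8(1)] two_units[OF VX _ E(1,2) XE(2) ge8(2)] by blast
  qed
  have s1: "card B = card (K \<inter> B) + card (B - K)"
    using card_Int_Diff[OF uB(3), of K] by (simp add: Int_commute)
  have s2: "card D = card (K \<inter> D) + card (D - K)"
    using card_Int_Diff[OF fD, of K] by (simp add: Int_commute)
  have pos: "1 \<le> card (K \<inter> B)" "1 \<le> card (B - K)" "1 \<le> card (K \<inter> D)" "1 \<le> card (D - K)"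
    using nB nD K' uB(3) fD by (auto simp: Suc_le_eq card_gt_0_iff)
  have KC: "sym_diff D K \<in> C" "sym_diff B K \<in> C" "sym_diff D (sym_diff B K) \<in> C"
    using sym_diff_in[OF C(1) K(1)] sym_diff_in[OF B(1) K(1)] sym_diff_in[OF C(1) sym_diff_in[OF B(1) K(1)]]
    by simp_all
  have e: "(K \<inter> D) \<union> (K \<inter> B) = K" "(D - K) \<union> (K \<inter> B) = sym_diff D K"
    "(K \<inter> D) \<union> (B - K) = sym_diff B K" "(D - K) \<union> (B - K) = sym_diff D (sym_diff B K)"
    using K'(1) d(1) by auto
  \<comment> \<open>The part of \<open>D\<close> is chosen so that the codeword with a single element of \<open>B\<close> gets at least 3 elements of \<open>D\<close>.\<close>
  have go: unit_pair if IJ: "I \<union> J \<in> C" "(D - I) \<union> J \<in> C" "I \<subseteq> D" "J \<subseteq> B" "card J = 1" 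
      "1 \<le> card I" "1 \<le> card (D - I)" for I J
  proof -
    have fin: "finite I" "finite J" using IJ(3,4) fD uB(3) by (simp_all add: finite_subset)
    have dj: "I \<inter> J = {}" "(D - I) \<inter> J = {}" "(D - I) \<inter> (B - J) = {}" "I \<inter> (B - J) = {}"
      using IJ(3,4) d(1) by auto
    have u: "card (I \<union> J) = card I + 1" "card ((D - I) \<union> J) = card (D - I) + 1"
      using IJ(5) dj fin fD by (simp_all add: card_Un_disjoint)
    have "I \<union> J \<noteq> {}" "(D - I) \<union> J \<noteq> {}" using IJ by auto
    then have ge: "2 \<le> card I" "2 \<le> card (D - I)"
      using card_ge_3[OF IJ(1)] card_ge_3[OF IJ(2)] u by auto
    have sD: "card D = card I + card (D - I)" using IJ(3) fD fin
      by (simp add: card_Diff_subset card_mono)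
    have BJ: "card (B - J) = 2" using IJ(4,5) fin(2) B(3) by (simp add: card_Diff_subset)
    have v1: "V - (I \<union> J) = (D - I) \<union> (B - J)" "V - ((D - I) \<union> J) = I \<union> (B - J)"
      unfolding V_def using IJ(3,4) d(1) by auto
    have w: "card ((D - I) \<union> (B - J)) = card (D - I) + 2" "card (I \<union> (B - J)) = card I + 2"
      using dj fin fD uB(3) BJ by (simp_all add: card_Un_disjoint)
    have "I \<noteq> {}" "D - I \<noteq> {}" using ge by (metis card.empty not_numeral_le_zero)+
    then have "V - (I \<union> J) \<noteq> {}" "V - ((D - I) \<union> J) \<noteq> {}" unfolding v1 by simp_all
    then have p: "I \<union> J \<subset> V" "(D - I) \<union> J \<subset> V" using IJ(3,4) unfolding V_def by auto
    show ?thesis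
    proof (cases "3 \<le> card I")
      case True then show ?thesis using split[OF IJ(1) p(1)] u v1 w ge by simp
    next
      case False then have "3 \<le> card (D - I)" using sD C(3) by linarith
      then show ?thesis using split[OF IJ(2) p(2)] unfolding v1 u w using ge by linarith
    qed
  qed
  have DD: "D - (K \<inter> D) = D - K" by blast
  have "card (K \<inter> B) = 1 \<or> card (B - K) = 1" using s1 pos B(3) by linarith
  then show ?thesis
  proof
    assume "card (K \<inter> B) = 1"
    then show ?thesis using go[of "K \<inter> D" "K \<inter> B"] pos(3,4) K(1) KC(1) unfolding DD e by simp
  next
    assume "card (B - K) = 1"
    then show ?thesis using go[of "K \<inter> D" "B - K"] pos(3,4) KC(2,3) unfolding DD e by simp
  qed
qed

lemma sum_partition:
  assumes "P \<in> partitions V" "finite V"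
  shows "sum card P = card V" "sum j P = j V" "V \<in> C"
proof -
  have fP: "finite P" by (rule partitions_finite[OF assms])
  show "sum card P = card V"
    using assms fP unfolding partitions_def disjoint_def
    by (subst card_Union_disjoint[symmetric]) (auto simp: pairwise_def disjnt_def intro: finite_subset)
  have "sum j Q = j (\<Union>Q) \<and> \<Union>Q \<in> C" if "Q \<subseteq> P" for Q
    using finite_subset[OF that fP] that
  proof (induction Q rule: finite_induct)
    case empty then show ?case using j_empty empty_in by simp
  next
    case (insert X Q)
    have XC: "X \<in> C" using insert.prems assms unfolding partitions_def by auto
    have "X \<inter> Y = {}" if "Y \<in> Q" for Y
    proof -
      have "X \<noteq> Y" "X \<in> P" "Y \<in> P" using that insert.prems insert.hyps(2) by auto
      then show ?thesis using assms(1) unfolding partitions_def disjoint_def by blast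
    qed
    then have d: "X \<inter> \<Union>Q = {}" by auto
    have IH: "sum j Q = j (\<Union>Q)" "\<Union>Q \<in> C" using insert by auto
    show ?case using insert.hyps IH j_Un[OF XC IH(2) d] Un_in[OF XC IH(2) d] by simp
  qed
  then show "sum j P = j V" "V \<in> C" using assms unfolding partitions_def by auto
qed

text \<open>
  Take a partition \<open>P\<close> of \<open>A\<close> into as many codewords as possible and let
  \<open>d B = |B| - 2 j B\<close>; these numbers add up to at least 5. By maximality, a block has size at most
  6, two blocks have total size at most 10 and three blocks at most 14. Positive contributions come from the
  units \<open>P1\<close> and from the blocks \<open>P2\<close> of weight two and size 5 or 6, which contribute
  at most 2 together. If there is no unit pair, there are at most two units, and two units have total size at
  most 7. A single unit of size at most 4 contributes at most 2; a single unit of size 5 or 6 contributes at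
  most 4 together with \<open>P2\<close>. Two triples contribute 2. So the only way to reach 5 is a triple, a
  unit of size 4 and a block in \<open>P2\<close>, which \<open>relink\<close> excludes.
\<close>

theorem unit_pair_of_long_code:
  assumes long: "2 * j A + 5 \<le> card A"
  shows unit_pair
proof (rule ccontr)
  assume ng: "\<not> unit_pair"
  have "A \<noteq> {}" using long by auto
  then have "{A} \<in> partitions A" using A_in by (auto simp: partitions_def disjoint_def)
  moreover have "finite (partitions A)"
    by (rule finite_subset[of _ "Pow (Pow A)"]) (use finite_A in \<open>auto simp: partitions_def\<close>)
  ultimately have "Max (card ` partitions A) \<in> card ` partitions A"
    by (intro Max_in) auto
  then obtain P where P: "P \<in> partitions A" "card P = Max (card ` partitions A)" by auto
  have maxP: "card R \<le> card P" if "R \<in> partitions A" for R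
    unfolding P(2) using that \<open>finite (partitions A)\<close> by simp
  have fP: "finite P" by (rule partitions_finite[OF P(1) finite_A])
  have PC: "B \<in> C" "B \<noteq> {}" "finite B" if "B \<in> P" for B
    using P(1) that finite_in_C unfolding partitions_def by auto
  have dP: "B \<inter> B' = {}" if "B \<in> P" "B' \<in> P" "B \<noteq> B'" for B B'
    using P(1) that unfolding partitions_def disjoint_def by auto
  \<comment> \<open>Maximality, for replacing a subfamily \<open>Q\<close> by another partition of its union.\<close>
  have repl: "card R \<le> card Q" if Q: "Q \<subseteq> P" and R: "R \<in> partitions (\<Union>Q)" for Q R
  proof -
    have sep: "B \<inter> \<Union>Q = {}" if "B \<in> P - Q" for B using dP that Q by blast
    have RQ: "\<Union>R = \<Union>Q" "{} \<notin> R" "R \<subseteq> C" "disjoint R" using R unfolding partitions_def by auto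
    have subR: "X \<subseteq> \<Union>Q" if "X \<in> R" for X using that RQ(1) by auto
    have disj: "(P - Q) \<inter> R = {}"
    proof (rule ccontr)
      assume "(P - Q) \<inter> R \<noteq> {}"
      then obtain X where "X \<in> P - Q" "X \<in> R" by auto
      then show False using sep[of X] subR[of X] PC(2)[of X] by auto
    qed
    have "disjoint ((P - Q) \<union> R)"
    proof (rule disjointI)
      fix a b assume ab: "a \<in> (P - Q) \<union> R" "b \<in> (P - Q) \<union> R" "a \<noteq> b"
      have RR: "a \<inter> b = {}" if "a \<in> R" "b \<in> R" using RQ(4) that ab(3) unfolding disjoint_def by auto
      consider "a \<in> P - Q" "b \<in> P - Q" | "a \<in> P - Q" "b \<in> R" | "a \<in> R" "b \<in> P - Q" | "a \<in> R" "b \<in> R"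
        using ab by auto
      then show "a \<inter> b = {}"
      proof cases
        case 1 then show ?thesis using dP ab by auto
      next
        case 2 then show ?thesis using sep[of a] subR[of b] by auto
      next
        case 3 then show ?thesis using sep[of b] subR[of a] by auto
      next
        case 4 then show ?thesis using RR by simp
      qed
    qed
    moreover have "\<Union>((P - Q) \<union> R) = A"
    proof -
      have "\<Union>((P - Q) \<union> R) = \<Union>(P - Q) \<union> \<Union>Q" using RQ(1) by simp
      also have "\<dots> = \<Union>P" using Q by blast
      finally show ?thesis using P(1) unfolding partitions_def by simp
    qed
    moreover have "(P - Q) \<union> R \<subseteq> C" "{} \<notin> (P - Q) \<union> R" using RQ PC(1) PC(2)[of "{}"] by auto
    ultimately have "(P - Q) \<union> R \<in> partitions A" unfolding partitions_def by simp
    then have "card ((P - Q) \<union> R) \<le> card P" by (rule maxP)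
    moreover have "finite R" using partitions_finite[OF R] Q fP PC(3) finite_subset by (metis finite_Union subsetD)
    then have "card ((P - Q) \<union> R) = card (P - Q) + card R"
      using disj fP by (intro card_Un_disjoint) auto
    moreover have "card (P - Q) = card P - card Q" "card Q \<le> card P"
      using Q fP by (auto simp: card_Diff_subset finite_subset card_mono)
    ultimately show ?thesis by linarith
  qed
  have sizes: "sum card Q < 4 * card Q + 3" if Q: "Q \<subseteq> P" for Q
  proof (rule ccontr)
    assume *: "\<not> sum card Q < 4 * card Q + 3"
    have "disjoint Q" using P(1) Q unfolding partitions_def disjoint_def by blast
    then have "Q \<in> partitions (\<Union>Q)" using P(1) Q unfolding partitions_def by auto
    moreover have "finite (\<Union>Q)" using Q fP PC(3) finite_subset by (metis finite_Union subsetD)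
    ultimately have "\<Union>Q \<in> C" "card (\<Union>Q) = sum card Q" using sum_partition by auto
    then obtain R where "R \<in> partitions (\<Union>Q)" "card R = card Q + 1"
      using split_many[of "\<Union>Q" "card Q"] * by auto
    then show False using repl[OF Q] by fastforce
  qed
  have min: "X = {}" if "B \<in> P" "X \<in> C" "X \<subset> B" for B X
  proof (rule ccontr)
    assume X0: "X \<noteq> {}"
    have "B - X \<in> C" using Diff_in[OF PC(1)[OF that(1)] that(2)] that(3) by auto
    then have "{X, B - X} \<in> partitions (\<Union>{B})"
      unfolding partitions_def disjoint_def using that X0 by auto
    moreover have "card {X, B - X} = 2" using X0 that(3) by (subst card_2_iff) auto
    ultimately show False using repl[of "{B}" "{X, B - X}"] that(1) by auto
  qed
  have c3: "3 \<le> card B" and c6: "card B \<le> 6" and j1: "1 \<le> j B" if "B \<in> P" for B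
    using card_ge_3 j_pos PC[OF that] sizes[of "{B}"] that by auto
  have c10: "card B + card B' \<le> 10" if "B \<in> P" "B' \<in> P" "B \<noteq> B'" for B B'
    using sizes[of "{B,B'}"] that by auto
  have c14: "card B + card B' + card B'' \<le> 14"
    if "B \<in> P" "B' \<in> P" "B'' \<in> P" "B \<noteq> B'" "B \<noteq> B''" "B' \<noteq> B''" for B B' B''
    using sizes[of "{B,B',B''}"] that by auto
  define P1 where "P1 = {B \<in> P. j B = 1}"
  define P2 where "P2 = {B \<in> P. j B = 2 \<and> 5 \<le> card B}"
  have u7: "card B + card B' \<le> 7" if "B \<in> P1" "B' \<in> P1" "B \<noteq> B'" for B B'
  proof (rule ccontr)
    assume "\<not> ?thesis"
    then show False using two_units[of B B'] ng that PC dP unfolding P1_def by simp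
  qed
  have no3: False if "B1 \<in> P1" "B2 \<in> P1" "B3 \<in> P1" "B1 \<noteq> B2" "B1 \<noteq> B3" "B2 \<noteq> B3" for B1 B2 B3
  proof -
    have 3: False if "B1 \<in> P1" "B2 \<in> P1" "B3 \<in> P1" "B1 \<noteq> B2" "B1 \<noteq> B3" "B2 \<noteq> B3" "card B1 = 3" "card B2 = 3" for B1 B2 B3
      using three_units[of B1 B2 B3] ng that PC dP unfolding P1_def by simp
    have in_P: "B1 \<in> P" "B2 \<in> P" "B3 \<in> P" using that unfolding P1_def by auto
    have "card B1 = 3 \<and> card B2 = 3 \<or> card B1 = 3 \<and> card B3 = 3 \<or> card B2 = 3 \<and> card B3 = 3"
      using u7[OF that(1,2,4)] u7[OF that(1,3,5)] u7[OF that(2,3,6)] c3[OF in_P(1)] c3[OF in_P(2)] c3[OF in_P(3)]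
      by linarith
    then show False using 3[of B1 B2 B3] 3[of B1 B3 B2] 3[of B2 B3 B1] that by metis
  qed
  have fin12: "finite P1" "finite P2" using fP unfolding P1_def P2_def by auto
  have card_lt_3: "card T \<le> 2" if "finite T" "\<And>a b c. a \<in> T \<Longrightarrow> b \<in> T \<Longrightarrow> c \<in> T \<Longrightarrow> a \<noteq> b \<Longrightarrow> a \<noteq> c \<Longrightarrow> b \<noteq> c \<Longrightarrow> False" 
    for T :: "'a set set"
  proof (rule ccontr)
    assume "\<not> ?thesis"
    then have "3 \<le> card T" by simp
    then obtain U where "U \<subseteq> T" "card U = 3" using obtain_subset_with_card_n by blast
    then obtain a b c where "a \<in> T" "b \<in> T" "c \<in> T" "a \<noteq> b" "a \<noteq> c" "b \<noteq> c"
      unfolding card_3_iff by auto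
    then show False using that(2) by blast
  qed
  have card1: "card P1 \<le> 2" using card_lt_3[OF fin12(1)] no3 by blast
  have card2: "card P2 \<le> 2"
  proof (rule card_lt_3[OF fin12(2)])
    fix a b c assume abc: "a \<in> P2" "b \<in> P2" "c \<in> P2" "a \<noteq> b" "a \<noteq> c" "b \<noteq> c"
    then show False using c14[of a b c] unfolding P2_def by auto
  qed
  define d where "d B = int (card B) - 2 * int (j B)" for B
  have "5 \<le> int (card A) - 2 * int (j A)" using long by linarith
  also have "\<dots> = sum d P"
    using sum_partition[OF P(1) finite_A] unfolding d_def
    by (simp add: sum_subtractf sum_distrib_left[symmetric] flip: of_nat_sum)
  also have "\<dots> \<le> sum d (P1 \<union> P2)"
  proof -
    have "d B \<le> 0" if "B \<in> P - (P1 \<union> P2)" for B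
    proof -
      have "j B \<ge> 3 \<or> j B = 2 \<and> card B \<le> 4" using that j1[of B] unfolding P1_def P2_def by auto
      then show ?thesis using c6[of B] that unfolding d_def by auto
    qed
    then have "sum d (P - (P1 \<union> P2)) \<le> 0" by (intro sum_nonpos) auto
    moreover have "sum d P = sum d (P - (P1 \<union> P2)) + sum d (P1 \<union> P2)"
      using fP by (intro sum.subset_diff) (auto simp: P1_def P2_def)
    ultimately show ?thesis by simp
  qed
  also have "\<dots> = sum d P1 + sum d P2"
    by (rule sum.union_disjoint[OF fin12]) (auto simp: P1_def P2_def)
  finally have ge5: "5 \<le> sum d P1 + sum d P2" .
  have d1: "d B = int (card B) - 2" if "B \<in> P1" for B using that unfolding d_def P1_def by simp
  have d2: "d B = int (card B) - 4" if "B \<in> P2" for B using that unfolding d_def P2_def by simp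
  have P12: "B \<noteq> B'" if "B \<in> P1" "B' \<in> P2" for B B' using that unfolding P1_def P2_def by auto
  have inP: "B \<in> P" if "B \<in> P1 \<or> B \<in> P2" for B using that unfolding P1_def P2_def by auto
  consider "P2 = {}" | B where "P2 = {B}" | B B' where "P2 = {B,B'}" "B \<noteq> B'"
    using card2 fin12(2) by (metis card_0_eq card_1_singletonE card_2_iff le_neq_implies_less less_2_cases_iff One_nat_def)
  note P2_cases = this
  have s2: "sum d P2 \<le> 2"
    using P2_cases
  proof cases
    case 1 then show ?thesis by simp
  next
    case 2 then show ?thesis using d2[of B] c6[of B] inP[of B] by simp
  next
    case 3 then show ?thesis using d2[of B] d2[of B'] c10[of B B'] inP[of B] inP[of B'] by simp
  qed
  consider "P1 = {}" | B where "P1 = {B}" | B B' where "P1 = {B,B'}" "B \<noteq> B'"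
    using card1 fin12(1) by (metis card_0_eq card_1_singletonE card_2_iff le_neq_implies_less less_2_cases_iff One_nat_def)
  then show False
  proof cases
    case 1 then show ?thesis using s2 ge5 by simp
  next
    case (2 B)
    have BP: "B \<in> P" "B \<in> P1" using 2 inP by auto
    show ?thesis
    proof (cases "card B \<le> 4")
      case True then show ?thesis using d1[OF BP(2)] s2 ge5 2 by simp
    next
      case False
      from P2_cases show ?thesis
      proof cases
        case 1 then show ?thesis using d1[OF BP(2)] ge5 2 c6[OF BP(1)] by simp
      next
        case (2 E)
        then have "E \<in> P" "E \<in> P2" "B \<noteq> E" using inP P12 BP by auto
        then show ?thesis using d1[OF BP(2)] d2[of E] ge5 \<open>P1 = {B}\<close> 2 c10[OF BP(1), of E] by simp
      next
        case (3 E E')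
        then have "E \<in> P" "E' \<in> P" "B \<noteq> E" "B \<noteq> E'" using inP P12 BP by auto
        moreover have "5 \<le> card E" "5 \<le> card E'" using 3 unfolding P2_def by auto
        ultimately show ?thesis using c14[OF BP(1), of E E'] 3(2) False by simp
      qed
    qed
  next
    case (3 B B')
    have BP: "B \<in> P" "B' \<in> P" "B \<in> P1" "B' \<in> P1" using 3 inP by auto
    have s1: "sum d P1 = int (card B + card B') - 4" using 3 d1[OF BP(3)] d1[OF BP(4)] by simp
    have le7: "card B + card B' \<le> 7" using u7[OF BP(3,4) 3(2)] .
    show ?thesis
    proof (cases "P2 = {}")
      case True then show ?thesis using s1 le7 ge5 by simp
    next
      case False
      then obtain D where D: "D \<in> P2" by auto
      have DP: "D \<in> P" "j D = 2" "5 \<le> card D" using D unfolding P2_def by auto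
      have ne: "D \<inter> B = {}" "D \<inter> B' = {}" "B \<inter> B' = {}" "B' \<inter> B = {}"
        using dP DP BP D P12 3(2) by metis+
      note DC = PC(1)[OF DP(1)] DP(2,3) min[OF DP(1)]
      have BC: "B \<in> C" "j B = 1" "B' \<in> C" "j B' = 1" using BP PC unfolding P1_def by auto
      have "card B = 3 \<and> 4 \<le> card B' \<or> card B' = 3 \<and> 4 \<le> card B"
        using s1 le7 ge5 s2 c3[OF BP(1)] c3[OF BP(2)] by linarith
      then show False
      proof
        assume "card B = 3 \<and> 4 \<le> card B'"
        then show False using relink[OF DC BC(1,2) _ BC(3,4) _ ne(1,2,3)] ng by simp
      next
        assume "card B' = 3 \<and> 4 \<le> card B"
        then show False using relink[OF DC BC(3,4) _ BC(1,2) _ ne(2,1,4)] ng by simp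
      qed
    qed
  qed
qed

end

section \<open>Atoms that are longer than the order of a subgroup of index 32\<close>

lemma subset_image_msetE:
  assumes "X \<subseteq># image_mset f M"
  obtains N where "N \<subseteq># M" "X = image_mset f N"
proof -
  have "image_mset f M = X + (image_mset f M - X)" by (rule subset_mset.add_diff_inverse[OF assms, symmetric])
  from image_mset_eq_plusD[OF this] obtain B C where "M = B + C" "X = image_mset f B" by blast
  then show thesis using that[of B] by simp
qed

lemma size_filter_mset_cover:
  assumes "\<And>w. w \<in># M \<Longrightarrow> P w \<Longrightarrow> Q w \<or> R w"
  shows "size (filter_mset P M) \<le> size (filter_mset Q M) + size (filter_mset R M)"
  using assms
proof (induction M)
  case (add w M)
  have IH: "size (filter_mset P M) \<le> size (filter_mset Q M) + size (filter_mset R M)"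
    by (rule add.IH) (use add.prems in auto)
  have "P w \<Longrightarrow> Q w \<or> R w" using add.prems by simp
  then show ?case using IH by auto
qed simp

lemma size_sum_mset_le_2:
  fixes W :: "'a multiset multiset"
  assumes "\<And>w. w \<in># W \<Longrightarrow> size w = 1 \<or> size w = 2"
  shows "size (\<Sum>\<^sub># W) + size (filter_mset (\<lambda>w. size w = 1) W) = 2 * size W"
  using assms
proof (induction W)
  case (add w W)
  have "size (\<Sum>\<^sub># W) + size (filter_mset (\<lambda>w. size w = 1) W) = 2 * size W"
    by (rule add.IH) (use add.prems in auto)
  moreover have "size w = 1 \<or> size w = 2" using add.prems by simp
  ultimately show ?case by auto
qed simp

lemma sum_mset_mset_set_disjoint:
  assumes "finite P" "\<And>X. X \<in> P \<Longrightarrow> finite X" "disjoint P"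
  shows "\<Sum>\<^sub># (image_mset mset_set (mset_set P)) = mset_set (\<Union>P)"
  using assms
proof (induction P rule: finite_induct)
  case (insert X P)
  have "disjoint P" using insert.prems(2) unfolding disjoint_def by blast
  then have IH: "\<Sum>\<^sub># (image_mset mset_set (mset_set P)) = mset_set (\<Union>P)" using insert by simp
  have "X \<inter> Y = {}" if "Y \<in> P" for Y
  proof -
    have "X \<noteq> Y" using that insert.hyps(2) by auto
    then show ?thesis using insert.prems(2) that unfolding disjoint_def by blast
  qed
  then have "X \<inter> \<Union>P = {}" by auto
  moreover have "finite X" "finite (\<Union>P)" using insert by auto
  ultimately have "mset_set (X \<union> \<Union>P) = mset_set X + mset_set (\<Union>P)" by (rule mset_set_Union[rotated 2])
  then show ?case using IH insert.hyps by simp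
qed simp

lemma two_of_same_kind:
  assumes "finite F" "\<And>w. w \<in># M \<Longrightarrow> \<kappa> w \<in> F" "card F < size M"
  shows "\<exists>v w. {#v, w#} \<subseteq># M \<and> \<kappa> v = \<kappa> w"
proof (rule ccontr)
  assume *: "\<not> ?thesis"
  have "count (image_mset \<kappa> M) y \<le> 1" for y
  proof (rule ccontr)
    assume "\<not> ?thesis"
    then have "2 \<le> count (image_mset \<kappa> M) y" by simp
    then have "replicate_mset 2 y \<subseteq># image_mset \<kappa> M" by (rule iffD1[OF count_le_replicate_mset_subset_eq])
    then obtain N where N: "N \<subseteq># M" "replicate_mset 2 y = image_mset \<kappa> N" by (rule subset_image_msetE)
    then have "size N = 2" by (metis size_image_mset size_replicate_mset)
    then obtain v w where vw: "N = {#v, w#}"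
      by (metis size_eq_Suc_imp_eq_union numeral_2_eq_2 size_1_singleton_mset One_nat_def size_add_mset nat.inject)
    then have "{#\<kappa> v, \<kappa> w#} = {#y, y#}" using N(2) by (simp add: numeral_2_eq_2)
    then have "\<kappa> v = y" "\<kappa> w = y" by (auto simp: add_eq_conv_ex)
    then have "{#v, w#} \<subseteq># M \<and> \<kappa> v = \<kappa> w" using N(1) vw by simp
    then show False using * by blast
  qed
  then have "sum (count (image_mset \<kappa> M)) (set_mset (image_mset \<kappa> M)) \<le> sum (\<lambda>_. 1) (set_mset (image_mset \<kappa> M))"
    by (intro sum_mono)
  then have "size (image_mset \<kappa> M) \<le> card (set_mset (image_mset \<kappa> M))"
    unfolding size_multiset_overloaded_eq[of "image_mset \<kappa> M"] card_eq_sum .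
  also have "\<dots> \<le> card F" by (rule card_mono[OF assms(1)]) (use assms(2) in auto)
  finally show False using assms(3) by simp
qed

text \<open>
  For \<open>G = C\<^sub>2\<^sup>4 \<oplus> C\<^sub>2\<^sub>k\<close> and \<open>H = 2 G\<close>, such an atom
  exists if and only if \<open>D(G)\<close> exceeds the value \<open>D\<^sup>*(G) = 2 k + 4\<close>.
\<close>

locale long_atom = comm_group G for G (structure) +
  fixes H :: "'a set" and k :: nat and U :: "'a multiset"
  assumes fin: "finite (carrier G)" and H: "subgroup H G"
    and sq: "x \<in> carrier G \<Longrightarrow> x \<otimes> x \<in> H"
    and card_H: "card H = k" and k_ge: "70 \<le> k" and index: "card (rcosets H) = 32"
    and U: "atom G U" and long: "2 * k + 5 \<le> size U"
begin

lemma Hc: "H \<subseteq> carrier G"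
  by (rule subgroup.subset[OF H])

lemma finH: "finite H"
  using Hc fin finite_subset by auto

lemma H_cancel: "a \<in> carrier G \<Longrightarrow> b \<in> H \<Longrightarrow> a \<otimes> b \<in> H \<longleftrightarrow> a \<in> H"
proof
  assume a: "a \<in> carrier G" "b \<in> H" "a \<otimes> b \<in> H"
  have "b \<in> carrier G" using a Hc by auto
  then have "a = (a \<otimes> b) \<otimes> inv b" using a(1) by (simp add: m_assoc)
  moreover have "(a \<otimes> b) \<otimes> inv b \<in> H"
    using subgroup.m_closed[OF H a(3) subgroup.m_inv_closed[OF H a(2)]] .
  ultimately show "a \<in> H" by simp
qed (rule subgroup.m_closed[OF H])

lemma class_eq_iff:
  assumes x: "x \<in> carrier G" and y: "y \<in> carrier G"
  shows "H #> x = H #> y \<longleftrightarrow> x \<otimes> y \<in> H"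
proof
  assume "H #> x = H #> y"
  then have "x \<in> H #> y" using rcos_self[OF x H] by simp
  then obtain h where h: "h \<in> H" "x = h \<otimes> y" unfolding r_coset_def by auto
  then have "x \<otimes> y = h \<otimes> (y \<otimes> y)" using y Hc by (auto simp: m_assoc)
  then show "x \<otimes> y \<in> H" using subgroup.m_closed[OF H h(1) sq[OF y]] by simp
next
  assume xy: "x \<otimes> y \<in> H"
  let ?h = "(x \<otimes> y) \<otimes> inv (y \<otimes> y)"
  have "?h \<in> H" using subgroup.m_closed[OF H xy subgroup.m_inv_closed[OF H sq[OF y]]] .
  moreover have "x = ?h \<otimes> y" using x y by (simp add: inv_mult m_assoc)
  ultimately have "x \<in> H #> y" unfolding r_coset_def by blast
  then show "H #> x = H #> y" using repr_independence[OF _ y H] by auto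
qed

abbreviation ssum :: "'a set \<Rightarrow> 'a" where
  "ssum X \<equiv> seq_sum G (mset_set X)"

lemma finite_sub: "X \<subseteq> carrier G \<Longrightarrow> finite X"
  using fin finite_subset by blast

lemma ssum_closed: "X \<subseteq> carrier G \<Longrightarrow> ssum X \<in> carrier G"
  using finite_sub[of X] by (intro seq_sum_closed) simp

text \<open>
  The identity behind all uses of the doubled weight.
\<close>

lemma ssum_sym_diff:
  assumes "X \<subseteq> carrier G" "Y \<subseteq> carrier G"
  shows "ssum X \<otimes> ssum Y = ssum (sym_diff X Y) \<otimes> (ssum (X \<inter> Y) \<otimes> ssum (X \<inter> Y))"
proof -
  have f: "finite X" "finite Y" using assms finite_sub by auto
  have s: "set_mset (mset_set Z) \<subseteq> carrier G" if "Z \<subseteq> carrier G" for Z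
    using that finite_sub[OF that] by simp
  have i: "X \<inter> Y \<subseteq> carrier G" "sym_diff X Y \<subseteq> carrier G" using assms by auto
  have "mset_set X + mset_set Y = mset_set (sym_diff X Y) + (mset_set (X \<inter> Y) + mset_set (X \<inter> Y))"
    by (rule multiset_eqI) (use f in \<open>auto simp: count_mset_set'\<close>)
  then have "seq_sum G (mset_set X + mset_set Y) = seq_sum G (mset_set (sym_diff X Y) + (mset_set (X \<inter> Y) + mset_set (X \<inter> Y)))"
    by simp
  then show ?thesis
    using s[OF assms(1)] s[OF assms(2)] s[OF i(1)] s[OF i(2)] by (simp add: seq_sum_union)
qed

definition codewords :: "'a set \<Rightarrow> 'a set set" where
  "codewords A = {X. X \<subseteq> A \<and> ssum X \<in> H}"

lemma binary_code_of_classes: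
  assumes A: "A \<subseteq> carrier G - H" "inj_on (\<lambda>a. H #> a) A" "ssum A \<in> H"
  shows "binary_code A (codewords A) (\<lambda>X. H #> ssum X) (rcosets H)"
proof
  have Ac: "A \<subseteq> carrier G" using A(1) by auto
  show "finite A" by (rule finite_sub[OF Ac])
  show "X \<subseteq> A" if "X \<in> codewords A" for X using that unfolding codewords_def by simp
  show "A \<in> codewords A" unfolding codewords_def using A(3) by simp
  have i32: "card (rcosets H) = 32" by (rule index)
  then show "finite (rcosets H)" by (intro card_ge_0_finite) simp
  show "card (rcosets H) \<le> 32" using i32 by simp
  show "H #> ssum X \<in> rcosets H" if "X \<subseteq> A" for X
    by (rule rcosetsI[OF Hc ssum_closed]) (use that Ac in auto)
  have sd: "ssum (sym_diff X Y) \<in> H" if XY: "X \<subseteq> A" "Y \<subseteq> A" "ssum X \<otimes> ssum Y \<in> H" for X Y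
  proof -
    have c: "X \<subseteq> carrier G" "Y \<subseteq> carrier G" "X \<inter> Y \<subseteq> carrier G" "sym_diff X Y \<subseteq> carrier G" using XY Ac by auto
    have "ssum (sym_diff X Y) \<otimes> (ssum (X \<inter> Y) \<otimes> ssum (X \<inter> Y)) \<in> H"
      using XY(3) ssum_sym_diff[OF c(1,2)] by simp
    then show ?thesis using H_cancel[OF ssum_closed[OF c(4)] sq[OF ssum_closed[OF c(3)]]] by simp
  qed
  show "sym_diff X Y \<in> codewords A" if "X \<subseteq> A" "Y \<subseteq> A" "H #> ssum X = H #> ssum Y" for X Y
  proof -
    have c: "X \<subseteq> carrier G" "Y \<subseteq> carrier G" using that Ac by auto
    have "ssum X \<otimes> ssum Y \<in> H" using that(3) class_eq_iff[OF ssum_closed[OF c(1)] ssum_closed[OF c(2)]] by simp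
    then show ?thesis using sd[OF that(1,2)] that(1,2) unfolding codewords_def by auto
  qed
  show "sym_diff X Y \<in> codewords A" if "X \<in> codewords A" "Y \<in> codewords A" for X Y
  proof -
    have XY: "X \<subseteq> A" "Y \<subseteq> A" "ssum X \<in> H" "ssum Y \<in> H" using that unfolding codewords_def by auto
    then show ?thesis using sd[OF XY(1,2) subgroup.m_closed[OF H XY(3,4)]] unfolding codewords_def by auto
  qed
  show "3 \<le> card X" if X: "X \<in> codewords A" "X \<noteq> {}" for X
  proof (rule ccontr)
    assume "\<not> 3 \<le> card X"
    have XA: "X \<subseteq> A" "ssum X \<in> H" using X(1) unfolding codewords_def by auto
    then have "finite X" using finite_sub Ac by auto
    then have "0 < card X" using X(2) by (simp add: card_gt_0_iff)
    then consider "card X = 1" | "card X = 2" using \<open>\<not> 3 \<le> card X\<close> by linarith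
    then show False
    proof cases
      case 1
      then obtain a where a: "X = {a}" by (rule card_1_singletonE)
      have "a \<in> carrier G" "a \<notin> H" using a XA(1) A(1) by auto
      then show False using XA(2) a by simp
    next
      case 2
      then obtain a b where ab: "X = {a, b}" "a \<noteq> b" by (auto simp: card_2_iff)
      have c: "a \<in> carrier G" "b \<in> carrier G" "a \<in> A" "b \<in> A" using ab XA(1) A(1) by auto
      have "ssum X = a \<otimes> b" using ab c by (simp add: seq_sum_add_mset)
      then have "H #> a = H #> b" using XA(2) class_eq_iff[OF c(1,2)] by simp
      then show False using inj_onD[OF A(2) _ c(3,4)] ab(2) by simp
    qed
  qed
qed

definition small_block :: "'a multiset \<Rightarrow> bool" where
  "small_block w \<longleftrightarrow> (\<exists>a\<in>H. w = {#a#}) \<or>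
     (\<exists>a b. a \<in> carrier G \<and> b \<in> carrier G \<and> a \<notin> H \<and> H #> a = H #> b \<and> w = {#a, b#})"

lemma small_blockD:
  assumes "small_block w"
  shows "w \<noteq> {#}" "set_mset w \<subseteq> carrier G" "seq_sum G w \<in> H" "size w = 1 \<or> size w = 2"
proof -
  from assms consider a where "a \<in> H" "w = {#a#}"
    | a b where "a \<in> carrier G" "b \<in> carrier G" "H #> a = H #> b" "w = {#a, b#}"
    unfolding small_block_def by blast
  then have "w \<noteq> {#} \<and> set_mset w \<subseteq> carrier G \<and> seq_sum G w \<in> H \<and> (size w = 1 \<or> size w = 2)"
  proof cases
    case 1
    then show ?thesis using Hc by auto
  next
    case 2
    then show ?thesis using class_eq_iff[OF 2(1,2)] by (simp add: seq_sum_add_mset)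
  qed
  then show "w \<noteq> {#}" "set_mset w \<subseteq> carrier G" "seq_sum G w \<in> H" "size w = 1 \<or> size w = 2" by auto
qed

text \<open>
  Terms in \<open>H\<close> and pairs of terms in the same class are split off greedily; what remains is a set
  with distinct nonzero classes.
\<close>

lemma pairing:
  assumes "set_mset S \<subseteq> carrier G"
  shows "\<exists>A W. A \<subseteq> carrier G - H \<and> inj_on (\<lambda>a. H #> a) A \<and> S = mset_set A + \<Sum>\<^sub># W \<and> (\<forall>w\<in>#W. small_block w)"
  using assms
proof (induction S)
  case empty
  show ?case by (intro exI[of _ "{}"] exI[of _ "{#}"]) simp
next
  case (add x S)
  have xc: "x \<in> carrier G" using add.prems by simp
  have "set_mset S \<subseteq> carrier G" using add.prems by simp
  from add.IH[OF this] obtain A W where AW: "A \<subseteq> carrier G - H" "inj_on (\<lambda>a. H #> a) A" "S = mset_set A + \<Sum>\<^sub># W" "\<forall>w\<in>#W. small_block w"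
    by (elim exE conjE)
  have fA: "finite A" using AW(1) finite_sub by auto
  consider "x \<in> H" | y where "x \<notin> H" "y \<in> A" "H #> y = H #> x" | "x \<notin> H" "\<forall>y\<in>A. H #> y \<noteq> H #> x" by blast
  then show ?case
  proof cases
    case 1
    then have "small_block {#x#}" unfolding small_block_def by simp
    then show ?thesis using AW by (intro exI[of _ A] exI[of _ "add_mset {#x#} W"]) auto
  next
    case 2
    have yc: "y \<in> carrier G" using 2 AW(1) by auto
    have "small_block {#x, y#}" unfolding small_block_def using 2 xc yc by auto
    moreover have "mset_set A = add_mset y (mset_set (A - {y}))" using 2(2) fA by (simp add: mset_set.remove)
    moreover have "inj_on (\<lambda>a. H #> a) (A - {y})" using AW(2) by (rule inj_on_subset) auto
    ultimately show ?thesis using AW by (intro exI[of _ "A - {y}"] exI[of _ "add_mset {#x, y#} W"]) auto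
  next
    case 3
    have "x \<notin> A" using 3(2) by auto
    then have "mset_set (insert x A) = add_mset x (mset_set A)" using fA by simp
    moreover have "inj_on (\<lambda>a. H #> a) (insert x A)" using AW(2) 3 by (auto simp: inj_on_def) 
    ultimately show ?thesis using AW 3(1) xc by (intro exI[of _ "insert x A"] exI[of _ W]) auto
  qed
qed

definition blocks :: "'a multiset multiset \<Rightarrow> bool" where
  "blocks \<W> \<longleftrightarrow> \<Sum>\<^sub># \<W> = U \<and> (\<forall>w\<in>#\<W>. w \<noteq> {#} \<and> seq_sum G w \<in> H)"

lemma Uc: "set_mset U \<subseteq> carrier G"
  using U unfolding atom_def by simp

lemma sum_mset_nonempty:
  assumes "\<And>w. w \<in># \<W> \<Longrightarrow> w \<noteq> {#}" "\<Sum>\<^sub># \<W> = {#}"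
  shows "\<W> = {#}"
proof (cases \<W>)
  case (add w V)
  then have "w = {#}" using assms(2) by simp
  then show ?thesis using assms(1)[of w] add by simp
qed

text \<open>
  A zero-sum subsequence of the block sums is the sequence of sums of a subfamily of blocks, whose union is a
  zero-sum subsequence of \<open>U\<close>.
\<close>

lemma atom_of_blocks:
  assumes "blocks \<W>"
  shows "atom G (image_mset (seq_sum G) \<W>)" "set_mset (image_mset (seq_sum G) \<W>) \<subseteq> H"
proof -
  have W: "\<Sum>\<^sub># \<W> = U" "\<And>w. w \<in># \<W> \<Longrightarrow> w \<noteq> {#}" "\<And>w. w \<in># \<W> \<Longrightarrow> seq_sum G w \<in> H"
    using assms unfolding blocks_def by auto
  have wc: "set_mset w \<subseteq> carrier G" if "w \<in># \<W>" for w
  proof -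
    have "w \<subseteq># \<Sum>\<^sub># \<W>" using that by (metis multi_member_split sum_mset.add_mset mset_subset_eq_add_left)
    then show ?thesis using set_mset_mono Uc W(1) by fastforce
  qed
  show sub: "set_mset (image_mset (seq_sum G) \<W>) \<subseteq> H" using W(3) by auto
  have U': "U \<noteq> {#}" "seq_sum G U = \<one>" "\<And>V. V \<subseteq># U \<Longrightarrow> seq_sum G V = \<one> \<Longrightarrow> V = {#} \<or> V = U"
    using U unfolding atom_def by auto
  show "atom G (image_mset (seq_sum G) \<W>)"
    unfolding atom_def
  proof (intro conjI allI impI)
    show "set_mset (image_mset (seq_sum G) \<W>) \<subseteq> carrier G" using sub Hc by auto
    show "image_mset (seq_sum G) \<W> \<noteq> {#}" using W(1) U'(1) by auto
    show "seq_sum G (image_mset (seq_sum G) \<W>) = \<one>"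
      using seq_sum_Union[of \<W>] wc W(1) U'(2) by simp
    fix V assume V: "V \<subseteq># image_mset (seq_sum G) \<W> \<and> seq_sum G V = \<one>"
    then obtain \<V> where \<V>: "\<V> \<subseteq># \<W>" "V = image_mset (seq_sum G) \<V>" by (auto elim: subset_image_msetE)
    obtain \<R> where \<R>: "\<W> = \<V> + \<R>" using \<V>(1) by (metis subset_mset.add_diff_inverse)
    have "seq_sum G (\<Sum>\<^sub># \<V>) = \<one>" using seq_sum_Union[of \<V>] wc \<R> V \<V>(2) by simp
    moreover have Usplit: "U = \<Sum>\<^sub># \<V> + \<Sum>\<^sub># \<R>" using W(1) \<R> by simp
    ultimately have "\<Sum>\<^sub># \<V> = {#} \<or> \<Sum>\<^sub># \<V> = U" by (intro U'(3)) simp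
    then show "V = {#} \<or> V = image_mset (seq_sum G) \<W>"
    proof
      assume "\<Sum>\<^sub># \<V> = {#}"
      then have "\<V> = {#}" using sum_mset_nonempty[of \<V>] W(2) \<R> by simp
      then show ?thesis using \<V>(2) by simp
    next
      assume "\<Sum>\<^sub># \<V> = U"
      then have "\<Sum>\<^sub># \<R> = {#}" using Usplit by simp
      then have "\<R> = {#}" using sum_mset_nonempty[of \<R>] W(2) \<R> by simp
      then show ?thesis using \<V>(2) \<R> by simp
    qed
  qed
qed

lemma card_classes:
  assumes "A \<subseteq> carrier G - H" "inj_on (\<lambda>a. H #> a) A"
  shows "card A \<le> 31"
proof -
  have f: "finite (rcosets H)" using index by (intro card_ge_0_finite) simp
  have "(\<lambda>a. H #> a) ` A \<subseteq> rcosets H - {H}"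
  proof
    fix C assume "C \<in> (\<lambda>a. H #> a) ` A"
    then obtain a where a: "a \<in> A" "C = H #> a" by auto
    have ac: "a \<in> carrier G" "a \<notin> H" using a assms(1) by auto
    have "H #> a \<noteq> H" using coset_join1[OF _ ac(1) H] ac(2) by auto
    then show "C \<in> rcosets H - {H}" using a rcosetsI[OF Hc ac(1)] by simp
  qed
  then have "card ((\<lambda>a. H #> a) ` A) \<le> card (rcosets H - {H})" using f by (intro card_mono) auto
  also have "H \<in> rcosets H" using rcosetsI[OF Hc one_closed] coset_mult_one[OF Hc] by simp
  then have "card (rcosets H - {H}) = 31" using index f by simp
  finally show ?thesis using card_image[OF assms(2)] by simp
qed

text \<open>
  The multiples of \<open>c\<close> by less than its multiplicity are nonzero, so the order of \<open>c\<close>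
  exceeds \<open>k / 2\<close>, and it divides \<open>k\<close>.
\<close>

lemma ord_of_frequent_term:
  assumes Z: "atom G Z" "set_mset Z \<subseteq> H" and c: "k < 2 * count Z c"
  shows "ord c = k" "c \<in> H"
proof -
  have "0 < count Z c" using c by linarith
  then show cH: "c \<in> H" using Z(2) by auto
  then have cc: "c \<in> carrier G" using Hc by auto
  have "count Z c \<le> ord c"
  proof (rule ccontr)
    assume lt: "\<not> count Z c \<le> ord c"
    then have "replicate_mset (ord c) c \<subseteq># Z" by (intro iffD1[OF count_le_replicate_mset_subset_eq]) simp
    moreover have "seq_sum G (replicate_mset (ord c) c) = \<one>" using seq_sum_replicate[OF cc] cc by simp
    ultimately have "replicate_mset (ord c) c = {#} \<or> replicate_mset (ord c) c = Z"
      using Z(1) unfolding atom_def by blast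
    moreover have "0 < ord c" using ord_ge_1[OF fin cc] by simp
    moreover have "replicate_mset (ord c) c \<noteq> Z" using lt by auto
    ultimately show False by simp
  qed
  moreover have "ord c dvd k"
  proof -
    have g: "group (G\<lparr>carrier := H\<rparr>)" by (rule subgroup.subgroup_is_group[OF H is_group])
    have "c [^]\<^bsub>G\<lparr>carrier := H\<rparr>\<^esub> order (G\<lparr>carrier := H\<rparr>) = \<one>"
      using group.pow_order_eq_1[OF g, of c] cH by simp
    then have "c [^] k = \<one>" unfolding order_def using card_H nat_pow_consistent[of c k H] by simp
    then show ?thesis using pow_eq_id[OF cc] by simp
  qed
  then obtain q where q: "k = ord c * q" by (auto elim: dvdE)
  have "q = 1"
  proof -
    have "ord c * q < ord c * 2" using q c calculation by linarith
    then have "q < 2" by simp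
    moreover have "q \<noteq> 0"
    proof
      assume "q = 0"
      then have "k = 0" using q by simp
      then show False using k_ge by linarith
    qed
    ultimately show ?thesis by linarith
  qed
  then show "ord c = k" using q by simp
qed

end

text \<open>
  The set \<open>A\<close>, the blocks \<open>W\<close> of size one and two, and the element \<open>c\<close>
  that is the sum of at least \<open>k - 25\<close> of the pairs in \<open>W\<close>.
\<close>

locale decomposed_long_atom = long_atom +
  fixes A :: "'a set" and W :: "'a multiset multiset" and c :: 'a
  assumes A: "A \<subseteq> carrier G - H" "inj_on (\<lambda>a. H #> a) A"
    and U_eq: "U = mset_set A + \<Sum>\<^sub># W" and W: "w \<in># W \<Longrightarrow> small_block w"
    and many: "k \<le> size (filter_mset (\<lambda>w. size w = 2 \<and> seq_sum G w = c) W) + 25"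
    and c: "c \<in> H" "ord c = k"

context long_atom
begin

lemma ssum_rest_in_H:
  assumes A: "A \<subseteq> carrier G - H" and U_eq: "U = mset_set A + \<Sum>\<^sub># W" and W: "\<And>w. w \<in># W \<Longrightarrow> small_block w"
  shows "ssum A \<in> H"
proof -
  have Ac: "A \<subseteq> carrier G" using A by auto
  have Ws: "set_mset (\<Sum>\<^sub># W) \<subseteq> carrier G" using U_eq Uc by auto
  have "seq_sum G (\<Sum>\<^sub># W) = seq_sum G (image_mset (seq_sum G) W)"
    by (rule seq_sum_Union) (rule small_blockD(2)[OF W])
  also have "\<dots> \<in> H" by (rule seq_sum_in_subgroup[OF H]) (use small_blockD(3)[OF W] in auto)
  finally have WH: "seq_sum G (\<Sum>\<^sub># W) \<in> H" .
  have "ssum A \<otimes> seq_sum G (\<Sum>\<^sub># W) = seq_sum G U"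
    unfolding U_eq using Ac finite_sub[OF Ac] Ws by (intro seq_sum_union[symmetric]) auto
  also have "\<dots> \<in> H" using U subgroup.one_closed[OF H] unfolding atom_def by simp
  finally show ?thesis using H_cancel[OF ssum_closed[OF Ac] WH] by simp
qed

lemma blocks_of_partition:
  assumes A: "A \<subseteq> carrier G - H" "inj_on (\<lambda>a. H #> a) A"
    and U_eq: "U = mset_set A + \<Sum>\<^sub># W" and W: "\<And>w. w \<in># W \<Longrightarrow> small_block w"
    and P: "P \<in> binary_code.partitions (codewords A) A"
  shows "blocks (W + image_mset mset_set (mset_set P))"
proof -
  interpret binary_code A "codewords A" "\<lambda>X. H #> ssum X" "rcosets H"
    by (rule binary_code_of_classes[OF A ssum_rest_in_H[OF A(1) U_eq W]])
  have P': "P \<subseteq> codewords A" "{} \<notin> P" "disjoint P" "\<Union>P = A" using P unfolding partitions_def by auto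
  have fP: "finite P" by (rule partitions_finite[OF P finite_A])
  have fX: "finite X" if "X \<in> P" for X using P'(1) that finite_in_C by auto
  have "\<Sum>\<^sub># (image_mset mset_set (mset_set P)) = mset_set A"
    using sum_mset_mset_set_disjoint[OF fP fX P'(3)] P'(4) by simp
  then have "\<Sum>\<^sub># (W + image_mset mset_set (mset_set P)) = U" using U_eq by simp
  moreover have "w \<noteq> {#} \<and> seq_sum G w \<in> H" if w: "w \<in># W + image_mset mset_set (mset_set P)" for w
  proof (cases "w \<in># W")
    case True then show ?thesis using small_blockD[OF W] by simp
  next
    case False
    then obtain X where X: "X \<in> P" "w = mset_set X" using w fP by auto
    have "X \<noteq> {}" using X(1) P'(2) by auto
    then have "w \<noteq> {#}" using X fX[OF X(1)] by (simp add: mset_set_empty_iff)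
    then show ?thesis using X P'(1) unfolding codewords_def by auto
  qed
  ultimately show ?thesis unfolding blocks_def by blast
qed

text \<open>
  Let \<open>A\<close> be partitioned into \<open>N \<ge> (|A| - 2) / 4\<close> codewords, and let
  \<open>S\<close> be the number of blocks of size one. The sums of all blocks form an atom \<open>Z\<close>
  over \<open>H\<close> of length \<open>|W| + N\<close>, so its most frequent term \<open>c\<close> occurs at
  least \<open>3 (|W| + N) - 2 k - 1\<close> times. At most \<open>S + N\<close> of these occurrences are not
  sums of pairs. With \<open>|U| = |A| + 2 |W| - S \<ge> 2 k + 5\<close> and \<open>|A| \<le> 31\<close> this
  leaves at least \<open>k - 25\<close> pairs.
\<close>

lemma ex_decomposition: "\<exists>A W c. decomposed_long_atom G H k U A W c"
proof -
  from pairing[OF Uc] obtain A W where AW: "A \<subseteq> carrier G - H" "inj_on (\<lambda>a. H #> a) A"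
     "U = mset_set A + \<Sum>\<^sub># W" "\<forall>w\<in>#W. small_block w"
    by (elim exE conjE)
  have Ws: "small_block w" if "w \<in># W" for w using AW(4) that by simp
  interpret binary_code A "codewords A" "\<lambda>X. H #> ssum X" "rcosets H"
    by (rule binary_code_of_classes[OF AW(1,2) ssum_rest_in_H[OF AW(1,3) Ws]])
  have "\<exists>P\<in>partitions A. card A \<le> 4 * card P + 2"
  proof (cases "A = {}")
    case True
    then have "{} \<in> partitions A" unfolding partitions_def disjoint_def by simp
    then show ?thesis using True by (intro bexI[of _ "{}"]) auto
  next
    case False
    then have "3 \<le> card A" by (rule card_ge_3[OF A_in])
    then have "4 * ((card A - 3) div 4) + 3 \<le> card A" by linarith
    from split_many[OF A_in this] obtain P where P: "P \<in> partitions A" "card P = (card A - 3) div 4 + 1" by blast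
    have "card A \<le> 4 * card P + 2" using P(2) \<open>3 \<le> card A\<close> by linarith
    then show ?thesis using P(1) by blast
  qed
  then obtain P where P: "P \<in> partitions A" "card A \<le> 4 * card P + 2" by blast
  let ?\<W> = "W + image_mset mset_set (mset_set P)"
  let ?Z = "image_mset (seq_sum G) ?\<W>"
  have bl: "blocks ?\<W>" by (rule blocks_of_partition[OF AW(1-3) Ws P(1)])
  note Z = atom_of_blocks[OF bl]
  have fP: "finite P" by (rule partitions_finite[OF P(1) finite_A])
  have sZ: "size ?Z = size W + card P" using fP by simp
  have L: "size W + card P \<le> k" using atom_size_le[OF H finH Z] sZ card_H by simp
  from frequent_term_atom[OF H finH Z] obtain c where c: "3 * size ?Z \<le> count ?Z c + 2 * card H + 1" by (elim exE)
  let ?T = "filter_mset (\<lambda>w. size w = 2 \<and> seq_sum G w = c) W"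
  let ?S = "filter_mset (\<lambda>w. size w = 1) W"
  have cnt: "count (image_mset (seq_sum G) M) c = size (filter_mset (\<lambda>w. seq_sum G w = c) M)" for M
    by (induction M) auto
  have cZ: "count ?Z c = size (filter_mset (\<lambda>w. seq_sum G w = c) W) +
      size (filter_mset (\<lambda>w. seq_sum G w = c) (image_mset mset_set (mset_set P)))"
    unfolding cnt by simp
  have "size (filter_mset (\<lambda>w. seq_sum G w = c) W) \<le> size ?T + size ?S"
    by (rule size_filter_mset_cover) (use small_blockD(4)[OF Ws] in auto)
  moreover have "size (filter_mset (\<lambda>w. seq_sum G w = c) (image_mset mset_set (mset_set P))) \<le> card P"
    using size_filter_mset_lesseq[of _ "image_mset mset_set (mset_set P)"] fP by simp
  ultimately have c1: "count ?Z c \<le> size ?T + size ?S + card P" using cZ by linarith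
  have sW: "size (\<Sum>\<^sub># W) + size ?S = 2 * size W" by (rule size_sum_mset_le_2) (rule small_blockD(4)[OF Ws])
  have sU: "2 * k + 5 \<le> card A + size (\<Sum>\<^sub># W)" using long AW(3) by simp
  have a31: "card A \<le> 31" by (rule card_classes[OF AW(1,2)])
  have c2: "3 * (size W + card P) \<le> size ?T + size ?S + card P + 2 * k + 1" using c unfolding sZ card_H using c1 by linarith
  have count: "2 * k \<le> 2 * T + 51" if "3 * (w + N) \<le> T + S + N + 2 * k + 1" "2 * k + 5 \<le> a + t"
    "t + S = 2 * w" "a \<le> 31" "a \<le> 4 * N + 2" for T S N w a t :: nat
  proof -
    have "3 * w + 2 * N \<le> T + S + 2 * k + 1" using that(1) by simp
    moreover have "2 * k + 5 + S \<le> a + 2 * w" using that(2,3) by simp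
    ultimately have "2 * k + 13 + S + 4 * N \<le> 3 * a + 2 * T" by simp
    then show ?thesis using that(4,5) by simp
  qed
  have "2 * k \<le> 2 * size ?T + 51" by (rule count[OF c2 sU sW a31 P(2)])
  then have many: "k \<le> size ?T + 25" by linarith
  have "size ?T \<le> size (filter_mset (\<lambda>w. seq_sum G w = c) W)"
    by (intro size_mset_mono filter_mset_mono_strong) auto
  then have "size ?T \<le> count ?Z c" using cZ by linarith
  then have "k < 2 * count ?Z c" using many k_ge by linarith
  from ord_of_frequent_term[OF Z this] have "ord c = k" "c \<in> H" .
  then have "decomposed_long_atom G H k U A W c"
    by (intro decomposed_long_atom.intro[OF long_atom_axioms] decomposed_long_atom_axioms.intro AW(1,2,3) Ws many)
  then show ?thesis by blast
qed

end

section \<open>The index of a block\<close>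

context decomposed_long_atom
begin

lemma cc: "c \<in> carrier G"
  using c(1) Hc by auto

lemma c_pow_one: "c [^] k = \<one>"
  using pow_ord_eq_1[OF cc] c(2) by simp

lemma c_pow_dvd:
  assumes "c [^] (a::nat) = c [^] (b::nat)" "a \<le> b"
  shows "k dvd b - a"
proof -
  have "c [^] a \<otimes> c [^] (b - a) = c [^] a \<otimes> \<one>"
    using assms nat_pow_mult[OF cc, of a "b - a"] cc by simp
  then have "c [^] (b - a) = \<one>" using cc by simp
  then show ?thesis using pow_eq_id[OF cc] c(2) by simp
qed

lemma c_pow_inj:
  assumes "c [^] (a::nat) = c [^] (b::nat)" "a < k" "b < k"
  shows "a = b"
proof -
  have *: "a = b" if "c [^] (a::nat) = c [^] (b::nat)" "a \<le> b" "b < k" for a b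
  proof -
    have "\<not> 0 < b - a" using c_pow_dvd[OF that(1,2)] that(3) by (meson dvd_imp_le less_imp_diff_less linorder_not_less)
    then show ?thesis using that(2) by simp
  qed
  show ?thesis using *[of a b] *[of b a] assms by (metis nat_le_linear)
qed

lemma H_powers: "z \<in> H \<Longrightarrow> \<exists>i<k. c [^] (i::nat) = z"
proof -
  assume z: "z \<in> H"
  have "inj_on (\<lambda>i::nat. c [^] i) {..<k}" by (rule inj_onI) (auto intro: c_pow_inj)
  then have "card ((\<lambda>i::nat. c [^] i) ` {..<k}) = card H" using card_H by (simp add: card_image)
  moreover have "(\<lambda>i::nat. c [^] i) ` {..<k} \<subseteq> H" using subgroup_nat_pow[OF H c(1)] by auto
  ultimately have "(\<lambda>i::nat. c [^] i) ` {..<k} = H" by (intro card_subset_eq finH)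
  then show ?thesis using z by auto
qed

text \<open>
  The exponent is taken in \<open>{1..k}\<close>, so that the identity has index \<open>k\<close> and all
  indices are positive.
\<close>

definition idx :: "'a \<Rightarrow> nat" where
  "idx z = (LEAST i. 1 \<le> i \<and> c [^] i = z)"

lemma idx: assumes "z \<in> H" shows "1 \<le> idx z" "c [^] idx z = z" "idx z \<le> k"
proof -
  obtain i where i: "i < k" "c [^] (i::nat) = z" using H_powers[OF assms] by blast
  define i' where "i' = (if i = 0 then k else i)"
  have "1 \<le> i'" "i' \<le> k" using i k_ge unfolding i'_def by auto
  moreover have "c [^] i' = z" using i c_pow_one unfolding i'_def by auto
  ultimately have i': "1 \<le> i' \<and> c [^] i' = z" "i' \<le> k" by auto
  have "1 \<le> idx z \<and> c [^] idx z = z" unfolding idx_def by (rule LeastI[of "\<lambda>i. 1 \<le> i \<and> c [^] i = z", OF i'(1)])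
  then show "1 \<le> idx z" "c [^] idx z = z" by auto
  have "idx z \<le> i'" unfolding idx_def by (rule Least_le[of "\<lambda>i. 1 \<le> i \<and> c [^] i = z", OF i'(1)])
  then show "idx z \<le> k" using i'(2) by simp
qed

lemma idx_c: "idx c = 1"
proof -
  have "idx c \<le> 1" unfolding idx_def by (rule Least_le) (use cc in simp)
  then show ?thesis using idx(1)[OF c(1)] by simp
qed

lemma seq_sum_idx:
  assumes "set_mset Z \<subseteq> H"
  shows "seq_sum G Z = c [^] \<Sum>\<^sub># (image_mset idx Z)"
  using assms
proof (induction Z)
  case (add z Z)
  have z: "z \<in> H" "set_mset Z \<subseteq> H" "z \<in> carrier G" "set_mset Z \<subseteq> carrier G" using add.prems Hc by auto
  have "seq_sum G (add_mset z Z) = c [^] idx z \<otimes> c [^] \<Sum>\<^sub># (image_mset idx Z)"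
    using add.IH[OF z(2)] idx(2)[OF z(1)] seq_sum_add_mset[OF z(3,4)] by simp
  then show ?case using cc by (simp add: nat_pow_mult)
qed simp

text \<open>
  Let \<open>X\<close> be a nonempty subsequence of the terms other than \<open>c\<close>. Its total index
  cannot be in \<open>{k - t<..k}\<close>, where \<open>t\<close> is the number of copies of \<open>c\<close>:
  fewer than \<open>t\<close> copies of \<open>c\<close> would complete \<open>X\<close> to a zero-sum
  subsequence. As there are \<open>t \<ge> k / 2\<close> copies, adding one term to \<open>X\<close> cannot jump
  from \<open>k - t\<close> beyond \<open>k\<close>, so the bound extends to all \<open>X\<close> by induction.
  The total index of \<open>Z\<close> is then a positive multiple of \<open>k\<close> that is at most
  \<open>k\<close>.
\<close>

lemma total_idx:
  assumes Z: "atom G Z" "set_mset Z \<subseteq> H" and many: "k \<le> 2 * count Z c"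
  shows "\<Sum>\<^sub># (image_mset idx Z) = k"
proof -
  define t where "t = count Z c"
  define V where "V = filter_mset (\<lambda>z. z \<noteq> c) Z"
  have ZV: "Z = replicate_mset t c + V"
    unfolding V_def t_def by (rule multiset_eqI) auto
  have VH: "set_mset V \<subseteq> H" using Z(2) unfolding V_def by auto
  have cV: "count V c = 0" unfolding V_def by simp
  have tk: "t \<le> k" using atom_size_le[OF H finH Z] card_H ZV by simp
  have s: "\<Sum>\<^sub># (image_mset idx X) + t \<le> k"
    if X: "X \<subseteq># V" "X \<noteq> {#}" "\<Sum>\<^sub># (image_mset idx X) \<le> k" for X
  proof (rule ccontr)
    assume *: "\<not> ?thesis"
    define n where "n = k - \<Sum>\<^sub># (image_mset idx X)"
    have n: "n < t" "n + \<Sum>\<^sub># (image_mset idx X) = k" using * X(3) unfolding n_def by auto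
    have XH: "set_mset X \<subseteq> H" using VH set_mset_mono[OF X(1)] by auto
    let ?Y = "replicate_mset n c + X"
    have "set_mset (replicate_mset n c) \<subseteq> carrier G" "set_mset X \<subseteq> carrier G" using cc XH Hc by auto
    then have "seq_sum G ?Y = c [^] n \<otimes> c [^] \<Sum>\<^sub># (image_mset idx X)"
      using seq_sum_union seq_sum_replicate[OF cc] seq_sum_idx[OF XH] by simp
    then have "seq_sum G ?Y = \<one>" using cc n(2) c_pow_one by (simp add: nat_pow_mult)
    moreover have "replicate_mset n c \<subseteq># replicate_mset t c" using n(1) by (simp add: replicate_mset_msubseteq_iff)
    then have "?Y \<subseteq># Z" unfolding ZV using X(1) by (rule subset_mset.add_mono)
    ultimately have "?Y = {#} \<or> ?Y = Z" using Z(1) unfolding atom_def by blast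
    moreover have "count ?Y c = n"
      using mset_subset_eq_count[OF X(1), of c] cV by simp
    then have "?Y \<noteq> Z" using n(1) unfolding t_def by auto
    ultimately show False using X(2) by simp
  qed
  have all: "\<Sum>\<^sub># (image_mset idx X) + t \<le> k" if "X \<subseteq># V" for X
    using that
  proof (induction X)
    case empty
    show ?case using tk by simp
  next
    case (add v X)
    have "v \<in># V" by (rule mset_subset_eqD[OF add.prems]) simp
    then have "{#v#} \<subseteq># V" by simp
    have "X \<subseteq># add_mset v X" by simp
    then have "X \<subseteq># V" using add.prems by (rule subset_mset.order_trans)
    have vH: "v \<in> H" using set_mset_mono[OF add.prems] VH by auto
    have "idx v + t \<le> k" using s[OF \<open>{#v#} \<subseteq># V\<close>] idx(3)[OF vH] by simp
    moreover have "\<Sum>\<^sub># (image_mset idx X) + t \<le> k" by (rule add.IH[OF \<open>X \<subseteq># V\<close>])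
    ultimately have "\<Sum>\<^sub># (image_mset idx (add_mset v X)) \<le> k" using many unfolding t_def by simp
    then show ?case using s[OF add.prems] by simp
  qed
  let ?t = "\<Sum>\<^sub># (image_mset idx Z)"
  have tt: "?t = t + \<Sum>\<^sub># (image_mset idx V)" unfolding ZV using idx_c by simp
  then have le: "?t \<le> k" using all[of V] by simp
  have "c [^] ?t = \<one>" using seq_sum_idx[OF Z(2)] Z(1) unfolding atom_def by simp
  then have "k dvd ?t" using pow_eq_id[OF cc] c(2) by simp
  moreover have "0 < ?t" using tt many k_ge unfolding t_def by linarith
  ultimately show ?thesis using le by (meson dvd_imp_le le_antisym)
qed

definition c_pairs :: "'a multiset multiset" where
  "c_pairs = filter_mset (\<lambda>w. size w = 2 \<and> seq_sum G w = c) W"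

lemma count_image_seq_sum: "count (image_mset (seq_sum G) M) c = size (filter_mset (\<lambda>w. seq_sum G w = c) M)"
  by (induction M) auto

lemma c_pairs_size: "k \<le> size c_pairs + 25" "c_pairs \<subseteq># W"
  using many unfolding c_pairs_def by simp_all

lemma c_pairs_count:
  assumes "R \<subseteq># c_pairs" shows "size R \<le> count (image_mset (seq_sum G) R) c"
proof -
  have "filter_mset (\<lambda>w. seq_sum G w = c) R = R"
  proof (rule filter_mset_eq_conv[THEN iffD2], intro conjI ballI)
    fix w assume "w \<in># R"
    then have "w \<in># c_pairs" using assms set_mset_mono by blast
    then show "seq_sum G w = c" unfolding c_pairs_def by simp
  qed simp_all
  then show ?thesis unfolding count_image_seq_sum by simp
qed

text \<open>
  Because \<open>70 \<le> k\<close>, any \<open>k - 35\<close> blocks of sum \<open>c\<close> are at least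
  \<open>k / 2\<close> many; this leaves room for rearranging a few of the \<open>k - 25\<close> available ones.
\<close>

lemma total_blocks:
  assumes "blocks \<W>" "R \<subseteq># c_pairs" "R \<subseteq># \<W>" "k \<le> size R + 35"
  shows "\<Sum>\<^sub># (image_mset (\<lambda>w. idx (seq_sum G w)) \<W>) = k"
proof -
  note Z = atom_of_blocks[OF assms(1)]
  have "size R \<le> count (image_mset (seq_sum G) R) c" by (rule c_pairs_count[OF assms(2)])
  also have "\<dots> \<le> count (image_mset (seq_sum G) \<W>) c"
    by (intro mset_subset_eq_count image_mset_subseteq_mono assms(3))
  finally have "k \<le> 2 * count (image_mset (seq_sum G) \<W>) c" using assms(4) k_ge by linarith
  from total_idx[OF Z this] show ?thesis by (simp add: multiset.map_comp comp_def)
qed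

sublocale code: binary_code A "codewords A" "\<lambda>X. H #> ssum X" "rcosets H"
  by (rule binary_code_of_classes[OF A ssum_rest_in_H[OF A(1) U_eq W]])

definition w_total :: nat where
  "w_total = \<Sum>\<^sub># (image_mset (\<lambda>w. idx (seq_sum G w)) W)"

lemma partition_total:
  assumes P: "P \<in> code.partitions A"
  shows "(\<Sum>X\<in>P. idx (ssum X)) + w_total = k"
proof -
  have "blocks (W + image_mset mset_set (mset_set P))" by (rule blocks_of_partition[OF A U_eq W P])
  from total_blocks[OF this subset_mset.order_refl]
  have "\<Sum>\<^sub># (image_mset (\<lambda>w. idx (seq_sum G w)) (W + image_mset mset_set (mset_set P))) = k"
    using c_pairs_size subset_mset.order_trans[OF c_pairs_size(2)] by simp
  then show ?thesis unfolding w_total_def by (simp add: sum_unfold_sum_mset multiset.map_comp comp_def)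
qed

lemma w_total_ge: "size W \<le> w_total"
proof -
  have "size V \<le> \<Sum>\<^sub># (image_mset (\<lambda>w. idx (seq_sum G w)) V)" if "set_mset V \<subseteq> set_mset W" for V
    using that
  proof (induction V)
    case (add w V)
    have "1 \<le> idx (seq_sum G w)" by (rule idx(1)[OF small_blockD(3)[OF W]]) (use add.prems in auto)
    then show ?case using add by simp
  qed simp
  then show ?thesis unfolding w_total_def by simp
qed

text \<open>
  The blocks in \<open>W\<close> have positive indices, so \<open>j(A) \<le> k - |W|\<close>, while
  \<open>|A| \<ge> |U| - 2 |W| \<ge> 2 k + 5 - 2 |W|\<close>.
\<close>

lemma A_nonempty_long: "A \<noteq> {}" "2 * idx (ssum A) + 5 \<le> card A"
proof -
  have "size (\<Sum>\<^sub># W) \<le> 2 * size W"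
    using size_sum_mset_le_2[of W, OF small_blockD(4)[OF W]] by linarith
  then have sU: "2 * k + 5 \<le> card A + 2 * size W" using long U_eq by simp
  show A0: "A \<noteq> {}"
  proof
    assume "A = {}"
    then have "{} \<in> code.partitions A" unfolding code.partitions_def disjoint_def by simp
    from partition_total[OF this] have "w_total = k" by simp
    then show False using sU w_total_ge \<open>A = {}\<close> by simp
  qed
  have "{A} \<in> code.partitions A" using A0 code.A_in unfolding code.partitions_def disjoint_def by simp
  from partition_total[OF this] have "idx (ssum A) + w_total = k" by simp
  then show "2 * idx (ssum A) + 5 \<le> card A" using sU w_total_ge by linarith
qed

definition j :: "'a set \<Rightarrow> nat" where
  "j X = (if X = {} then 0 else idx (ssum X))"

lemma codewordD: "X \<in> codewords A \<Longrightarrow> X \<subseteq> A" "X \<in> codewords A \<Longrightarrow> ssum X \<in> H"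
  "X \<in> codewords A \<Longrightarrow> X \<subseteq> carrier G"
  using A(1) unfolding codewords_def by auto

lemma c_pow_j: "X \<in> codewords A \<Longrightarrow> c [^] j X = ssum X"
  using idx(2)[OF codewordD(2)] unfolding j_def by auto

text \<open>
  A codeword and its complement in \<open>A\<close> have total index \<open>j(A)\<close>, and
  \<open>2 j(A) + 5 \<le> |A| \<le> 31\<close>.
\<close>

lemma j_le_13: assumes X: "X \<in> codewords A" shows "j X \<le> 13"
proof -
  have a: "j A \<le> 13" using A_nonempty_long card_classes[OF A] unfolding j_def by simp
  show ?thesis
  proof (cases "X = {} \<or> X = A")
    case True
    then show ?thesis
    proof
      assume "X = {}" then show ?thesis unfolding j_def by simp
    next
      assume "X = A" then show ?thesis using a by simp
    qed
  next
    case False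
    then have ne: "X \<noteq> {}" "A - X \<noteq> {}" using codewordD(1)[OF X] by auto
    have AX: "A - X \<in> codewords A" by (rule code.Diff_in[OF code.A_in X codewordD(1)[OF X]])
    have "{X, A - X} \<in> code.partitions A"
      unfolding code.partitions_def disjoint_def using X AX ne codewordD(1)[OF X] by auto
    from partition_total[OF this] have 1: "(\<Sum>Y\<in>{X, A - X}. idx (ssum Y)) + w_total = k" .
    have "{A} \<in> code.partitions A" using A_nonempty_long(1) code.A_in unfolding code.partitions_def disjoint_def by simp
    from partition_total[OF this] have 2: "idx (ssum A) + w_total = k" by simp
    have "X \<noteq> A - X" using ne by auto
    then have "idx (ssum X) \<le> idx (ssum A)" using 1 2 by simp
    then show ?thesis using a ne A_nonempty_long(1) unfolding j_def by simp
  qed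
qed

lemma c_pow_j_sym_diff:
  assumes X: "X \<in> codewords A" and Y: "Y \<in> codewords A"
  shows "c [^] (j X + j Y) = c [^] j (sym_diff X Y) \<otimes> (ssum (X \<inter> Y) \<otimes> ssum (X \<inter> Y))"
proof -
  have "c [^] (j X + j Y) = ssum X \<otimes> ssum Y" using c_pow_j X Y cc by (simp flip: nat_pow_mult)
  also have "\<dots> = ssum (sym_diff X Y) \<otimes> (ssum (X \<inter> Y) \<otimes> ssum (X \<inter> Y))"
    by (rule ssum_sym_diff) (use codewordD(3) X Y in auto)
  finally show ?thesis using c_pow_j[OF code.sym_diff_in[OF X Y]] by simp
qed

text \<open>
  Both sides agree modulo \<open>k\<close> by \<open>c_pow_j_sym_diff\<close>, and both are at most
  \<open>3 \<cdot> 13 < k\<close>.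
\<close>

lemma j_inter:
  assumes X: "X \<in> codewords A" and Y: "Y \<in> codewords A" and X': "X' \<in> codewords A" and Y': "Y' \<in> codewords A"
    and eq: "X \<inter> Y = X' \<inter> Y'"
  shows "j X + j Y + j (sym_diff X' Y') = j X' + j Y' + j (sym_diff X Y)"
proof (rule c_pow_inj)
  let ?s = "sym_diff X Y" and ?s' = "sym_diff X' Y'" and ?i = "ssum (X \<inter> Y) \<otimes> ssum (X \<inter> Y)"
  have ic: "?i \<in> carrier G" using ssum_closed[of "X \<inter> Y"] codewordD(3)[OF X] by auto
  have "c [^] (j X + j Y + j ?s') = c [^] j ?s \<otimes> ?i \<otimes> c [^] j ?s'"
    using c_pow_j_sym_diff[OF X Y] cc by (simp flip: nat_pow_mult)
  also have "\<dots> = c [^] j ?s' \<otimes> ?i \<otimes> c [^] j ?s" using ic cc by (simp add: m_ac)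
  also have "\<dots> = c [^] (j X' + j Y' + j ?s)"
    using c_pow_j_sym_diff[OF X' Y'] cc eq by (simp flip: nat_pow_mult)
  finally show "c [^] (j X + j Y + j ?s') = c [^] (j X' + j Y' + j ?s)" .
  have s: "?s \<in> codewords A" "?s' \<in> codewords A" using code.sym_diff_in X Y X' Y' by auto
  show "j X + j Y + j ?s' < k" using j_le_13[OF X] j_le_13[OF Y] j_le_13[OF s(2)] k_ge by linarith
  show "j X' + j Y' + j ?s < k" using j_le_13[OF X'] j_le_13[OF Y'] j_le_13[OF s(1)] k_ge by linarith
qed

sublocale weighted: weighted_code A "codewords A" "\<lambda>X. H #> ssum X" "rcosets H" j
proof unfold_locales
  show "1 \<le> j X" if "X \<in> codewords A" "X \<noteq> {}" for X
    using idx(1)[OF codewordD(2)[OF that(1)]] that(2) unfolding j_def by simp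
  show "j {} = 0" unfolding j_def by simp
  show "j X + j Y + j (sym_diff X' Y') = j X' + j Y' + j (sym_diff X Y)"
    if "X \<in> codewords A" "Y \<in> codewords A" "X' \<in> codewords A" "Y' \<in> codewords A" "X \<inter> Y = X' \<inter> Y'" for X Y X' Y'
    by (rule j_inter[OF that])
qed

lemma ex_pair_of_square_c:
  "\<exists>p q. {#p, q#} \<subseteq># U \<and> p \<in> carrier G \<and> q \<in> carrier G \<and> p \<otimes> q \<notin> H \<and> (p \<otimes> q) \<otimes> (p \<otimes> q) = c"
proof -
  have "2 * j A + 5 \<le> card A" using A_nonempty_long unfolding j_def by simp
  from weighted.unit_pair_of_long_code[OF this] obtain X Y where XY: "X \<in> codewords A" "Y \<in> codewords A"
    "card (X \<inter> Y) = 2" "j X + j Y = j (sym_diff X Y) + 1" unfolding weighted.unit_pair_def by blast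
  obtain p q where pq: "X \<inter> Y = {p, q}" "p \<noteq> q" using XY(3) by (auto simp: card_2_iff)
  have pA: "p \<in> A" "q \<in> A" using pq codewordD(1)[OF XY(1)] by auto
  then have pc: "p \<in> carrier G" "q \<in> carrier G" using A(1) by auto
  have spq: "ssum {p, q} = p \<otimes> q" using pq(2) pc by (simp add: seq_sum_add_mset)
  let ?s = "c [^] j (sym_diff X Y)" and ?i = "(p \<otimes> q) \<otimes> (p \<otimes> q)"
  have ic: "?i \<in> carrier G" using pc by simp
  have "?s \<otimes> ?i = ?s \<otimes> c"
    using c_pow_j_sym_diff[OF XY(1,2)] pq(1) spq XY(4) cc by simp
  then have 1: "?i = c" using ic cc by simp
  have 2: "p \<otimes> q \<notin> H"
  proof
    assume "p \<otimes> q \<in> H"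
    then have "H #> p = H #> q" using class_eq_iff[OF pc] by simp
    then show False using inj_onD[OF A(2) _ pA] pq(2) by simp
  qed
  have "mset_set {p, q} \<subseteq># mset_set A"
    by (rule subset_imp_msubset_mset_set) (use pA code.finite_A in auto)
  then have "{#p, q#} \<subseteq># mset_set A" using pq(2) by simp
  also have "\<dots> \<subseteq># U" unfolding U_eq by simp
  finally show ?thesis using 1 2 pc by blast
qed

text \<open>
  Two blocks of sum \<open>c\<close> have total index 2, and so do any two blocks that replace them; both new
  indices are therefore 1.
\<close>

lemma rewire:
  assumes VR: "blocks (R + {#v, w#})" and vw: "seq_sum G v = c" "seq_sum G w = c"
    and S: "S \<subseteq># c_pairs" "S \<subseteq># R" "k \<le> size S + 35"
    and new: "v' + w' = v + w" "v' \<noteq> {#}" "w' \<noteq> {#}" "seq_sum G v' \<in> H" "seq_sum G w' \<in> H"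
  shows "seq_sum G v' = c"
proof -
  let ?f = "\<lambda>w. idx (seq_sum G w)"
  have "\<Sum>\<^sub># (R + {#v', w'#}) = \<Sum>\<^sub># (R + {#v, w#})" using new(1) by (simp add: add.assoc add.left_commute)
  then have "blocks (R + {#v', w'#})" using VR new unfolding blocks_def by auto
  moreover have S': "S \<subseteq># R + {#v', w'#}" "S \<subseteq># R + {#v, w#}"
    using S(2) by (metis mset_subset_eq_add_left subset_mset.order_trans)+
  ultimately have "\<Sum>\<^sub># (image_mset ?f (R + {#v', w'#})) = k" using total_blocks[OF _ S(1) _ S(3)] by blast
  moreover have "\<Sum>\<^sub># (image_mset ?f (R + {#v, w#})) = k" using total_blocks[OF VR S(1) S'(2) S(3)] .
  ultimately have "?f v' + ?f w' = 2" using vw idx_c by simp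
  then have "?f v' = 1" using idx(1)[OF new(4)] idx(1)[OF new(5)] by linarith
  then show ?thesis using idx(2)[OF new(4)] cc by simp
qed

text \<open>
  There are more than 32 pairs of sum \<open>c\<close>, so two of them, \<open>{a, b}\<close> and
  \<open>{a', b'}\<close>, lie in the same class. The exchanges \<open>{a, a'}, {b, b'}\<close> and
  \<open>{a, b'}, {b, a'}\<close> again have sums \<open>c\<close>, which gives \<open>a' = b = b'\<close>.
\<close>

lemma ex_square_root_in_U: "\<exists>f. f \<in># U \<and> f \<notin> H \<and> f \<otimes> f = c"
proof -
  have fr: "finite (rcosets H)" "card (rcosets H) = 32" by (simp_all add: code.finite_F index)
  have pair: "\<exists>a b. a \<in> carrier G \<and> b \<in> carrier G \<and> a \<notin> H \<and> H #> a = H #> b \<and> w = {#a, b#}"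
    if "w \<in># c_pairs" for w
  proof -
    have "w \<in># W" "size w = 2" using that unfolding c_pairs_def by auto
    then show ?thesis using W[of w] unfolding small_block_def by auto
  qed
  \<comment> \<open>The common class of the two terms of a pair.\<close>
  define \<kappa> where "\<kappa> w = (SOME C. \<exists>a b. a \<in> carrier G \<and> b \<in> carrier G \<and> a \<notin> H \<and> H #> a = C \<and> H #> b = C \<and> w = {#a, b#})" for w
  have \<kappa>: "\<exists>a b. a \<in> carrier G \<and> b \<in> carrier G \<and> a \<notin> H \<and> H #> a = \<kappa> w \<and> H #> b = \<kappa> w \<and> w = {#a, b#}"
    if "w \<in># c_pairs" for w
  proof -
    have "\<exists>C a b. a \<in> carrier G \<and> b \<in> carrier G \<and> a \<notin> H \<and> H #> a = C \<and> H #> b = C \<and> w = {#a, b#}"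
      using pair[OF that] by metis
    then show ?thesis unfolding \<kappa>_def by (rule someI_ex)
  qed
  have "\<kappa> w \<in> rcosets H" if "w \<in># c_pairs" for w
    using \<kappa>[OF that] rcosetsI[OF Hc] by metis
  moreover have "card (rcosets H) < size c_pairs" using fr(2) c_pairs_size(1) k_ge by linarith
  ultimately obtain v w where vw: "{#v, w#} \<subseteq># c_pairs" "\<kappa> v = \<kappa> w"
    using two_of_same_kind[OF fr(1), of c_pairs \<kappa>] by blast
  define S where "S = c_pairs - {#v, w#}"
  have gS: "c_pairs = S + {#v, w#}" unfolding S_def using vw(1) by (metis subset_mset.diff_add)
  have Sg: "S \<subseteq># c_pairs" unfolding S_def by simp
  have mem: "v \<in># c_pairs" "w \<in># c_pairs" unfolding gS by simp_all
  obtain a b where ab: "a \<in> carrier G" "b \<in> carrier G" "a \<notin> H" "H #> a = \<kappa> v" "H #> b = \<kappa> v" "v = {#a, b#}"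
    using \<kappa>[OF mem(1)] by blast
  obtain a' b' where ab': "a' \<in> carrier G" "b' \<in> carrier G" "H #> a' = \<kappa> v" "H #> b' = \<kappa> v" "w = {#a', b'#}"
    using \<kappa>[OF mem(2)] vw(2) by metis
  have sum: "seq_sum G v = c" "seq_sum G w = c" using mem unfolding c_pairs_def by simp_all
  obtain R where R: "W = c_pairs + R" using c_pairs_size(2) by (metis subset_mset.add_diff_inverse)
  define P where "P = {A}"
  have P: "P \<in> code.partitions A" using A_nonempty_long(1) code.A_in unfolding P_def code.partitions_def disjoint_def by simp
  define R' where "R' = S + R + image_mset mset_set (mset_set P)"
  have W_eq: "W = S + {#v, w#} + R" using R[unfolded gS] .
  have move: "S + V + R + X = S + R + X + V" for V X :: "'a multiset multiset" by (simp add: ac_simps)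
  have "W + image_mset mset_set (mset_set P) = R' + {#v, w#}"
    unfolding R'_def move[symmetric] using W_eq by (rule arg_cong)
  then have bl: "blocks (R' + {#v, w#})" using blocks_of_partition[OF A U_eq W P] by (rule subst)
  have SR: "S \<subseteq># R'" unfolding R'_def by (simp add: add.assoc)
  have Sk: "k \<le> size S + 35" using c_pairs_size(1) gS by simp
  have inH: "x \<otimes> y \<in> H" if "x \<in> carrier G" "y \<in> carrier G" "H #> x = \<kappa> v" "H #> y = \<kappa> v" for x y
    using class_eq_iff[OF that(1,2)] that(3,4) by simp
  have ss: "seq_sum G {#x, y#} = x \<otimes> y" if "x \<in> carrier G" "y \<in> carrier G" for x y
    using that by (simp add: seq_sum_add_mset)
  have in_H: "seq_sum G {#a, a'#} \<in> H" "seq_sum G {#b, b'#} \<in> H" "seq_sum G {#a, b'#} \<in> H" "seq_sum G {#b, a'#} \<in> H"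
    unfolding ss[OF ab(1) ab'(1)] ss[OF ab(2) ab'(2)] ss[OF ab(1) ab'(2)] ss[OF ab(2) ab'(1)]
    by (rule inH; fact)+
  have "seq_sum G {#a, a'#} = c"
  proof (rule rewire[OF bl sum Sg SR Sk, where w' = "{#b, b'#}"])
    show "{#a, a'#} + {#b, b'#} = v + w" unfolding ab(6) ab'(5) by simp
  qed (simp_all add: in_H)
  then have 1: "a \<otimes> a' = c" unfolding ss[OF ab(1) ab'(1)] .
  have "seq_sum G {#a, b'#} = c"
  proof (rule rewire[OF bl sum Sg SR Sk, where w' = "{#b, a'#}"])
    show "{#a, b'#} + {#b, a'#} = v + w" unfolding ab(6) ab'(5) by simp
  qed (simp_all add: in_H)
  then have 2: "a \<otimes> b' = c" unfolding ss[OF ab(1) ab'(2)] .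
  have 3: "a \<otimes> b = c" "a' \<otimes> b' = c"
    using sum unfolding ab(6) ab'(5) ss[OF ab(1,2)] ss[OF ab'(1,2)] by simp_all
  have "a \<otimes> a' = a \<otimes> b" "a \<otimes> b' = a \<otimes> b" using 1 2 3(1) by simp_all
  then have e1: "a' = b" and e2: "b' = b" using ab(1,2) ab'(1,2) by simp_all
  have "b \<otimes> b = c" using 3(2) e1 e2 by simp
  moreover have "b \<notin> H"
  proof
    assume "b \<in> H"
    then have "H #> b = H" by (rule coset_join2[OF ab(2) H])
    then have "H #> a = H" using ab(4,5) by simp
    then show False using coset_join1[OF _ ab(1) H] ab(3) by simp
  qed
  moreover have "b \<in># U"
  proof -
    have "v \<in># W" using mem(1) c_pairs_size(2) set_mset_mono by blast
    moreover have "b \<in># v" using ab(6) by simp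
    ultimately have "b \<in># \<Sum>\<^sub># W" unfolding in_Union_mset_iff by blast
    then show ?thesis unfolding U_eq by simp
  qed
  ultimately show ?thesis by blast
qed

end

lemma (in long_atom) sum_linked_of_long_atom:
  assumes D: "size U = davenport G"
  shows "sum_linked G"
proof -
  obtain A W c where "decomposed_long_atom G H k U A W c" using ex_decomposition by blast
  then interpret decomposed_long_atom G H k U A W c .
  obtain p q where pq: "{#p, q#} \<subseteq># U" "p \<in> carrier G" "q \<in> carrier G" "p \<otimes> q \<notin> H" "(p \<otimes> q) \<otimes> (p \<otimes> q) = c"
    using ex_pair_of_square_c by blast
  obtain f where f: "f \<in># U" "f \<notin> H" "f \<otimes> f = c" using ex_square_root_in_U by blast
  have fc: "f \<in> carrier G" using f(1) Uc by auto
  have pqc: "p \<otimes> q \<in> carrier G" using pq by simp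
  have "f \<otimes> f = (p \<otimes> q) \<otimes> (p \<otimes> q)" using f(3) pq(5) by simp
  from automorphism_of_equal_squares[OF fin H sq fc f(2) pqc pq(4) this]
  obtain \<phi> where \<phi>: "\<phi> \<in> iso G G" "\<phi> f = p \<otimes> q" by blast
  have "atom G (image_mset \<phi> U)" by (rule atom_automorphism[OF \<phi>(1) U])
  moreover have "\<phi> f \<in># image_mset \<phi> U" using f(1) by simp
  ultimately show ?thesis unfolding sum_linked_def using U D pq(1) \<phi>(2)
    by (intro exI[of _ p] exI[of _ q] exI[of _ U] exI[of _ "image_mset \<phi> U"]) simp
qed

section \<open>The groups of rank five\<close>

lemma (in comm_group) squares_subgroup:
  shows "subgroup ((\<lambda>x. x \<otimes> x) ` carrier G) G"
proof (rule subgroupI)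
  show "(\<lambda>x. x \<otimes> x) ` carrier G \<subseteq> carrier G" by (intro image_subsetI m_closed)
  show "(\<lambda>x. x \<otimes> x) ` carrier G \<noteq> {}" by auto
  show "inv a \<in> (\<lambda>x. x \<otimes> x) ` carrier G" if a: "a \<in> (\<lambda>x. x \<otimes> x) ` carrier G" for a
  proof -
    obtain x where x: "a = x \<otimes> x" "x \<in> carrier G" using a by (rule imageE)
    then have "inv a = inv x \<otimes> inv x" by (simp add: inv_mult)
    then show ?thesis using x(2) by (intro image_eqI[of _ _ "inv x"]) simp_all
  qed
  show "a \<otimes> b \<in> (\<lambda>x. x \<otimes> x) ` carrier G"
    if ab: "a \<in> (\<lambda>x. x \<otimes> x) ` carrier G" "b \<in> (\<lambda>x. x \<otimes> x) ` carrier G" for a b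
  proof -
    obtain x where x: "a = x \<otimes> x" "x \<in> carrier G" using ab(1) by (rule imageE)
    obtain y where y: "b = y \<otimes> y" "y \<in> carrier G" using ab(2) by (rule imageE)
    have "a \<otimes> b = (x \<otimes> y) \<otimes> (x \<otimes> y)" using x y by (simp add: m_ac)
    then show ?thesis using x(2) y(2) by (intro image_eqI[of _ _ "x \<otimes> y"]) simp_all
  qed
qed

lemma card_squares_iso:
  assumes "\<phi> \<in> iso G H" and "group G"
  shows "card ((\<lambda>x. x \<otimes>\<^bsub>H\<^esub> x) ` carrier H) = card ((\<lambda>x. x \<otimes>\<^bsub>G\<^esub> x) ` carrier G)"
proof -
  have hom: "\<phi> \<in> hom G H" and inj: "inj_on \<phi> (carrier G)" and surj: "\<phi> ` carrier G = carrier H"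
    using assms(1) by (auto simp: iso_def bij_betw_def)
  have "(\<lambda>x. x \<otimes>\<^bsub>H\<^esub> x) ` carrier H = (\<lambda>x. \<phi> x \<otimes>\<^bsub>H\<^esub> \<phi> x) ` carrier G"
    unfolding surj[symmetric] by (simp add: image_image)
  also have "\<dots> = (\<lambda>x. \<phi> (x \<otimes>\<^bsub>G\<^esub> x)) ` carrier G"
    by (rule image_cong) (simp_all add: hom_mult[OF hom])
  also have "\<dots> = \<phi> ` ((\<lambda>x. x \<otimes>\<^bsub>G\<^esub> x) ` carrier G)" by (simp add: image_image)
  finally have eq: "(\<lambda>x. x \<otimes>\<^bsub>H\<^esub> x) ` carrier H = \<phi> ` ((\<lambda>x. x \<otimes>\<^bsub>G\<^esub> x) ` carrier G)" .
  have "(\<lambda>x. x \<otimes>\<^bsub>G\<^esub> x) ` carrier G \<subseteq> carrier G"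
    by (intro image_subsetI monoid.m_closed[OF group.is_monoid[OF assms(2)]])
  then have "inj_on \<phi> ((\<lambda>x. x \<otimes>\<^bsub>G\<^esub> x) ` carrier G)" by (rule inj_on_subset[OF inj])
  then show ?thesis unfolding eq by (rule card_image)
qed

abbreviation (input) rank_five_group :: "nat \<Rightarrow> ((nat \<Rightarrow> int) \<times> int) monoid" where
  "rank_five_group k \<equiv> product_group {..<4::nat} (\<lambda>_. integer_mod_group 2) \<times>\<times> integer_mod_group (2 * k)"

lemma group_rank_five: "group (rank_five_group k)"
  by (intro DirProd_group product_group group_integer_mod_group)

lemma carrier_rank_five:
  assumes "0 < k"
  shows "carrier (rank_five_group k) = ({..<4} \<rightarrow>\<^sub>E {0..<2}) \<times> {0..<2 * int k}"
  using assms by (simp add: DirProd_def carrier_integer_mod_group)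

lemma order_rank_five:
  assumes "0 < k"
  shows "order (rank_five_group k) = 32 * k"
  unfolding order_def carrier_rank_five[OF assms] by (simp add: card_cartesian_product card_PiE)

lemma card_squares_rank_five:
  assumes k: "0 < k"
  shows "card ((\<lambda>x. x \<otimes>\<^bsub>rank_five_group k\<^esub> x) ` carrier (rank_five_group k)) = k"
proof -
  let ?Q = "rank_five_group k"
  define z where "z = (\<lambda>i\<in>{..<4::nat}. 0 :: int)"
  have "(\<lambda>x. x \<otimes>\<^bsub>?Q\<^esub> x) ` carrier ?Q = (\<lambda>i. (z, 2 * int i)) ` {..<k}"
  proof (intro equalityI subsetI)
    fix y assume "y \<in> (\<lambda>x. x \<otimes>\<^bsub>?Q\<^esub> x) ` carrier ?Q"
    then obtain v b where vb: "v \<in> {..<4} \<rightarrow>\<^sub>E {0..<2}" "0 \<le> b" "b < 2 * int k"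
      "y = (v, b) \<otimes>\<^bsub>?Q\<^esub> (v, b)" unfolding carrier_rank_five[OF k] by auto
    have "(v i + v i) mod 2 = 0" for i by presburger
    then have "y = (z, (b + b) mod (2 * int k))" using vb(4) unfolding z_def by (simp add: DirProd_def)
    moreover have "(b + b) mod (2 * int k) = 2 * (b mod int k)" using mult_mod_right[of 2 b "int k"] by simp
    moreover have "b mod int k = int (nat (b mod int k))" "nat (b mod int k) < k"
      using k by (simp_all add: nat_less_iff)
    ultimately show "y \<in> (\<lambda>i. (z, 2 * int i)) ` {..<k}" by (intro image_eqI[of _ _ "nat (b mod int k)"]) auto
  next
    fix y assume "y \<in> (\<lambda>i. (z, 2 * int i)) ` {..<k}"
    then obtain i where i: "i < k" "y = (z, 2 * int i)" by auto
    have zc: "(z, int i) \<in> carrier ?Q" unfolding carrier_rank_five[OF k] z_def using i(1) by auto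
    have "(z, int i) \<otimes>\<^bsub>?Q\<^esub> (z, int i) = y" using i unfolding z_def by (simp add: DirProd_def restrict_def fun_eq_iff)
    then show "y \<in> (\<lambda>x. x \<otimes>\<^bsub>?Q\<^esub> x) ` carrier ?Q" using zc by (intro image_eqI[of _ _ "(z, int i)"]) auto
  qed
  also have "card \<dots> = k" by (subst card_image) (auto simp: inj_on_def)
  finally show ?thesis .
qed

context comm_group
begin

lemma independent_family_rank_five:
  assumes iso: "G \<cong> rank_five_group k" and k: "2 \<le> k"
  shows "\<exists>e. independent_family G 5 (\<lambda>i. if i < 4 then 2 else 2 * k) e"
proof -
  let ?Q = "rank_five_group k" and ?n = "\<lambda>i::nat. if i < 4 then 2 else 2 * k"
  let ?P = "product_group {..<4::nat} (\<lambda>_. integer_mod_group 2)"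
  obtain \<phi> where \<phi>: "\<phi> \<in> iso G ?Q" using iso by (auto simp: is_iso_def)
  define u :: "nat \<Rightarrow> (nat \<Rightarrow> int) \<times> int"
    where "u i = (\<lambda>l\<in>{..<4}. if l = i then 1 else 0, if i = 4 then 1 else 0)" for i
  define \<chi> :: "nat \<Rightarrow> (nat \<Rightarrow> int) \<times> int \<Rightarrow> int"
    where "\<chi> i x = (if i < 4 then fst x i else snd x)" for i x
  have uc: "u i \<in> carrier ?Q" for i
    unfolding u_def using k by (subst carrier_rank_five) (auto intro!: restrict_PiE_iff[THEN iffD2])
  have hom: "\<chi> i \<in> hom ?Q (integer_mod_group (?n i))" for i
  proof (cases "i < 4")
    case True
    have "(\<lambda>x. fst x i) \<in> hom ?Q (integer_mod_group 2)"
    proof (rule homI)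
      fix x y assume "x \<in> carrier ?Q" "y \<in> carrier ?Q"
      have "fst x \<in> {..<4} \<rightarrow>\<^sub>E carrier (integer_mod_group 2)"
        using \<open>x \<in> carrier ?Q\<close> by (cases x) (simp add: DirProd_def)
      from PiE_mem[OF this, of i] show "fst x i \<in> carrier (integer_mod_group 2)" using True by simp
      show "fst (x \<otimes>\<^bsub>?Q\<^esub> y) i = fst x i \<otimes>\<^bsub>integer_mod_group 2\<^esub> fst y i"
        using True by (cases x; cases y) (simp add: DirProd_def)
    qed
    then show ?thesis using True unfolding \<chi>_def by simp
  next
    case False
    have "snd \<in> hom ?Q (integer_mod_group (2 * k))"
    proof (rule homI)
      fix x y assume "x \<in> carrier ?Q" "y \<in> carrier ?Q"
      show "snd x \<in> carrier (integer_mod_group (2 * k))"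
        using \<open>x \<in> carrier ?Q\<close> by (cases x) (simp add: DirProd_def)
      show "snd (x \<otimes>\<^bsub>?Q\<^esub> y) = snd x \<otimes>\<^bsub>integer_mod_group (2 * k)\<^esub> snd y"
        by (cases x; cases y) (simp add: DirProd_def)
    qed
    then show ?thesis using False unfolding \<chi>_def by simp
  qed
  have P: "group ?Q" by (rule group_rank_five)
  show ?thesis
  proof (rule independent_family_of_iso[OF \<phi> P, where u = u and \<chi> = \<chi>])
    fix i :: nat assume i: "i < 5"
    have pow: "u i [^]\<^bsub>?Q\<^esub> n \<in> carrier ?Q" for n :: nat by (rule monoid.nat_pow_closed[OF group.is_monoid[OF P] uc])
    have coord: "\<chi> l (u i [^]\<^bsub>?Q\<^esub> ?n i) = 0" if l: "l < 5" for l
    proof -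
      have "\<chi> l (u i [^]\<^bsub>?Q\<^esub> ?n i) = (int (?n i) * \<chi> l (u i)) mod int (?n l)"
        using hom_nat_pow[OF hom uc P group_integer_mod_group] by simp
      also have "\<dots> = 0"
      proof (cases "l = i")
        case False
        then have "\<chi> l (u i) = 0" using l i unfolding \<chi>_def u_def by auto
        then show ?thesis by simp
      qed simp
      finally show ?thesis .
    qed
    define y where "y = u i [^]\<^bsub>?Q\<^esub> ?n i"
    have "0 < k" using k by simp
    from pow[of "?n i"] have "y \<in> ({..<4} \<rightarrow>\<^sub>E {0..<2}) \<times> {0..<2 * int k}"
      unfolding y_def carrier_rank_five[OF \<open>0 < k\<close>] .
    then have y: "fst y \<in> {..<4} \<rightarrow>\<^sub>E {0..<2}" unfolding mem_Times_iff by (rule conjunct1)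
    have "fst y l = 0" if "l < 4" for l using coord[of l] that unfolding y_def[symmetric] \<chi>_def by simp
    then have "fst y = (\<lambda>l\<in>{..<4}. 0)" using y by (intro PiE_ext[OF y]) auto
    moreover have "snd y = 0" using coord[of 4] unfolding y_def[symmetric] \<chi>_def by simp
    ultimately have "y = \<one>\<^bsub>?Q\<^esub>" by (cases y) (simp add: DirProd_def)
    then show "u i \<in> carrier ?Q \<and> u i [^]\<^bsub>?Q\<^esub> ?n i = \<one>\<^bsub>?Q\<^esub>" using uc unfolding y_def by simp
    show "\<chi> i \<in> hom ?Q (integer_mod_group (?n i))" by (rule hom)
  next
    fix i l :: nat assume "i < 5" "l < 5"
    then show "\<chi> i (u l) = (if l = i then 1 else 0)" unfolding \<chi>_def u_def by auto
  qed
qed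

lemma sum_linked_rank_five:
  assumes fin: "finite (carrier G)" and iso: "G \<cong> rank_five_group k" and k: "70 \<le> k"
  shows "sum_linked G"
proof -
  let ?n = "\<lambda>i::nat. if i < 4 then 2 else 2 * k"
  obtain e where e: "independent_family G 5 ?n e" using independent_family_rank_five[OF iso] k by auto
  have n2: "2 \<le> ?n i" for i using k by simp
  have "(\<Sum>i<5. ?n i - 1) = 2 * k + 3"
    using k by (simp add: eval_nat_numeral)
  then have star: "1 + (\<Sum>i<5. ?n i - 1) = 2 * k + 4" by simp
  have ge: "2 * k + 4 \<le> davenport G" using davenport_ge_independent[OF fin e n2] star by simp
  show ?thesis
  proof (cases "davenport G = 2 * k + 4")
    case True
    then have D: "davenport G = 1 + (\<Sum>i<5. ?n i - 1)" using star by simp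
    show ?thesis by (rule sum_linked_independent[OF e n2 _ _ _ _ D, of 0 4]) auto
  next
    case False
    obtain U where U: "atom G U" "size U = davenport G" using davenport_props(2)[OF fin] by blast
    obtain \<phi> where \<phi>: "\<phi> \<in> iso G (rank_five_group k)" using iso by (auto simp: is_iso_def)
    let ?H = "(\<lambda>x. x \<otimes> x) ` carrier G"
    have H: "subgroup ?H G" by (rule squares_subgroup)
    have cH: "card ?H = k" using card_squares_iso[OF \<phi> is_group] card_squares_rank_five[of k] k by simp
    have "order G = 32 * k" using iso_same_card[OF iso] order_rank_five[of k] k unfolding order_def by simp
    then have "card (rcosets ?H) * k = 32 * k" using lagrange[OF H] cH by simp
    then have idx: "card (rcosets ?H) = 32" using k by simp
    have long: "2 * k + 5 \<le> size U" using U(2) ge False by linarith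
    have sq: "x \<otimes> x \<in> ?H" if "x \<in> carrier G" for x using that by (rule imageI)
    have "long_atom G ?H k U"
      by (rule long_atom.intro[OF comm_group_axioms long_atom_axioms.intro[OF fin H sq cH k idx U(1) long]])
    then show ?thesis by (rule long_atom.sum_linked_of_long_atom[OF _ U(2)])
  qed
qed

end

section \<open>Sums of two terms of long atoms\<close>

theorem theorem4p2:
  fixes G :: "('a, 'b) monoid_scheme"
  assumes "comm_group G"
    and "finite (carrier G)"
    and "order G \<ge> 3"
    and "(cyclic_group G \<and> odd (order G))
       \<or> (\<not> cyclic_group G \<and> davenport G = davenport_star G)
       \<or> (odd (order G) \<and>
           (\<exists>U \<in> minimal_zero_sum_seqs G. size U = davenport G \<and> \<not> squarefree_seq U))
       \<or> (\<exists>k::nat. k \<ge> 70 \<and>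
           G \<cong> product_group {..<4::nat} (\<lambda>_. integer_mod_group 2) \<times>\<times> integer_mod_group (2 * k))"
  shows "\<exists>g1 \<in> carrier G. \<exists>g2 \<in> carrier G.
         \<exists>U1 \<in> minimal_zero_sum_seqs G. \<exists>U2 \<in> minimal_zero_sum_seqs G.
           size U1 = davenport G \<and> size U2 = davenport G \<and>
           {#g1, g2#} divides\<^bsub>sequences G\<^esub> U1 \<and>
           {#g1 \<otimes>\<^bsub>G\<^esub> g2#} divides\<^bsub>sequences G\<^esub> U2"
proof -
  interpret comm_group G by (rule assms(1))
  have fin: "finite (carrier G)" by (rule assms(2))
  from assms(4) have "sum_linked G"
  proof (elim disjE)
    assume "cyclic_group G \<and> odd (order G)"
    then show ?thesis using sum_linked_of_odd_cyclic[OF fin _ _ assms(3)] by simp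
  next
    assume "\<not> cyclic_group G \<and> davenport G = davenport_star G"
    then show ?thesis using sum_linked_of_davenport_star[OF fin] by simp
  next
    assume "odd (order G) \<and> (\<exists>U \<in> minimal_zero_sum_seqs G. size U = davenport G \<and> \<not> squarefree_seq U)"
    then obtain U where "odd (order G)" "atom G U" "size U = davenport G" "\<not> squarefree_seq U"
      using minimal_zero_sum_seqs_iff_atom by blast
    then show ?thesis by (rule sum_linked_of_repeated_term[OF fin])
  next
    assume "\<exists>k::nat. k \<ge> 70 \<and> G \<cong> rank_five_group k"
    then obtain k where "70 \<le> k" "G \<cong> rank_five_group k" by blast
    then show ?thesis using sum_linked_rank_five[OF fin] by simp
  qed
  then obtain g1 g2 U1 U2 where *: "atom G U1" "atom G U2" "size U1 = davenport G" "size U2 = davenport G"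
     "{#g1, g2#} \<subseteq># U1" "g1 \<otimes>\<^bsub>G\<^esub> g2 \<in># U2" unfolding sum_linked_def by blast
  have c: "set_mset U1 \<subseteq> carrier G" "set_mset U2 \<subseteq> carrier G" using *(1,2) unfolding atom_def by auto
  have g: "g1 \<in> carrier G" "g2 \<in> carrier G" using set_mset_mono[OF *(5)] c(1) by auto
  have "{#g1, g2#} divides\<^bsub>sequences G\<^esub> U1" by (rule sequences_dividesI[OF *(5) c(1)])
  moreover have "{#g1 \<otimes>\<^bsub>G\<^esub> g2#} divides\<^bsub>sequences G\<^esub> U2"
    by (rule sequences_dividesI[OF _ c(2)]) (use *(6) in simp)
  moreover have "U1 \<in> minimal_zero_sum_seqs G" "U2 \<in> minimal_zero_sum_seqs G"
    using *(1,2) minimal_zero_sum_seqs_iff_atom by auto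
  ultimately show ?thesis using g *(3,4)
    by (intro bexI[of _ g1] bexI[of _ g2] bexI[of _ U1] bexI[of _ U2] conjI)
qed

end
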